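(* Let $\mathcal A$ be the two-boundary Temperley-Lieb algebra over $\mathbb C$ with parameters $\delta=[2]$, $s_1=\frac{[\omega_1]}{[\omega_1+1]}$, $s_2=\frac{[\omega_2]}{[\omega_2+1]}$. (i) Every irreducible representation of $\mathcal A$ factors through a double quotient, i.e. for every irreducible $\mathcal A$-module $V$ there is $b\in\mathbb C$ such that $I_1I_2I_1=bI_1$ and $I_2I_1I_2=bI_2$ hold on $V$. (ii) Moreover, if $\theta$ is such that the central element $Z_N$ acts on an irreducible module $V$ as the scalar $[N]\frac{[2\theta]}{[\theta]}$ (where $\frac{[2\theta]}{[\theta]}$ denotes $q^{\theta}+q^{-\theta}$), then the relations $I_1I_2I_1=bI_1$ and $I_2I_1I_2=bI_2$ hold on $V$ with $$b=\frac{[(\omega_1+\omega_2+1+\theta)/2]\,[(\omega_1+\omega_2+1-\theta)/2]}{[\omega_1+1][\omega_2+1]}\quad\text{if }N\text{ is even},$$ $$b=-\frac{[(\omega_1-\omega_2+\theta)/2]\,[(\omega_1-\omega_2-\theta)/2]}{[\omega_1+1][\omega_2+1]}\quad\text{if }N\text{ is odd}.$$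
   Context: Let $N\ge 2$. Fix complex numbers $\eta,\omega_1,\omega_2$; for $x\in\mathbb C$ write $q^x=e^{\eta x}$ and $[x]=\frac{q^x-q^{-x}}{q-q^{-1}}$. Assume $q$ is not a root of unity and $[\omega_1],[\omega_1+1],[\omega_2],[\omega_2+1]$ are nonzero. The two-boundary Temperley-Lieb (2BTL) algebra with parameters $\delta,s_1,s_2$ is the unital associative algebra with generators $e_0,e_1,\dots,e_N$ and relations: $e_i^2=\delta e_i$ for $1\le i\le N-1$; $e_ie_{i\pm1}e_i=e_i$ whenever $1\le i\le N-1$ (with $i\pm1\in\{0,\dots,N\}$); $e_0^2=s_1e_0$; $e_N^2=s_2e_N$; $e_ie_j=e_je_i$ for $|i-j|>1$. Set, for $N$ even, $I_1=e_1e_3\cdots e_{N-1}$ and $I_2=e_0e_2e_4\cdots e_{N-2}e_N$; for $N$ odd, $I_1=e_1e_3\cdots e_{N-2}e_N$ and $I_2=e_0e_2\cdots e_{N-1}$. For $b\in\mathbb C$, the double quotient of 2BTL is its quotient by the relations $I_1I_2I_1=bI_1$, $I_2I_1I_2=bI_2$. In $\mathcal A$ put $g_i=e_i-q^{-1}$ ($1\le i\le N-1$), $g_0=q^{\omega_1}-(q^{1+\omega_1}-q^{-1-\omega_1})e_0$, $g_N=q^{\omega_2}-(q^{1+\omega_2}-q^{-1-\omega_2})e_N$; these are invertible. Put $J_0=g_1^{-1}g_2^{-1}\cdots g_{N-1}^{-1}\,g_N\,g_{N-1}\cdots g_2g_1g_0$ and $J_i=g_iJ_{i-1}g_i$ for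 $1\le i\le N-1$. Then $Z_N=\sum_{i=0}^{N-1}(J_i+J_i^{-1})$, which is central in $\mathcal A$. *)

theory Defs
  imports Complex_Main "HOL-Library.Poly_Mapping" "HOL-Algebra.QuotRing" "HOL-Algebra.Module"
begin

section \<open>Associative algebras given by generators and relations\<close>

datatype word = Word (letters: "nat list")

instantiation word :: monoid_add
begin

definition "0 = Word []"

definition "v + w = Word (letters v @ letters w)"

instance
  by standard (simp_all add: zero_word_def plus_word_def)

end

text \<open>
  Words are lists of letters wrapped into a type of their own, so that concatenation can be the
  (noncommutative) addition of the exponents of \<^typ>\<open>word \<Rightarrow>\<^sub>0 complex\<close>. The convolution product
  of \<^theory>\<open>HOL-Library.Poly_Mapping\<close> is then the product of the free associative algebra.
\<close>

text \<open>
  Unital algebras over the complex numbers are written as \<^typ>\<open>(complex, 'a) module\<close> records,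
  which provide a ring together with a scalar multiplication. (The locale \<^locale>\<open>module\<close> is
  not used, nor is the library's notion of an algebra, which is commutative.)
\<close>

definition free_algebra :: "nat set \<Rightarrow> (complex, word \<Rightarrow>\<^sub>0 complex) module" where
  "free_algebra X =
    \<lparr>carrier = {p. \<forall>w\<in>Poly_Mapping.keys p. set (letters w) \<subseteq> X},
     mult = (*), one = 1, zero = 0, add = (+),
     smult = (\<lambda>c p. Poly_Mapping.single 0 c * p)\<rparr>"

definition gen :: "nat \<Rightarrow> word \<Rightarrow>\<^sub>0 complex" where
  "gen i = Poly_Mapping.single (Word [i]) 1"

definition const :: "complex \<Rightarrow> word \<Rightarrow>\<^sub>0 complex" where
  "const c = Poly_Mapping.single 0 c"

text \<open>
  The ring part is \<^term>\<open>A Quot I\<close>; the scalar multiple of a coset is formed in the same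
  way as \<^const>\<open>rcoset_mult\<close>. A two-sided ideal of a unital algebra is closed under scalars.
\<close>

definition quotient_algebra ::
    "(complex, 'a) module \<Rightarrow> 'a set \<Rightarrow> (complex, 'a set) module" where
  "quotient_algebra A I =
    \<lparr>carrier = carrier (A Quot I), mult = mult (A Quot I), one = one (A Quot I),
     zero = zero (A Quot I), add = add (A Quot I),
     smult = (\<lambda>c X. \<Union>x\<in>X. I +>\<^bsub>A\<^esub> (c \<odot>\<^bsub>A\<^esub> x))\<rparr>"

definition list_prod :: "('a, 'b) monoid_scheme \<Rightarrow> 'a list \<Rightarrow> 'a" where
  "list_prod A xs = foldr (mult A) xs \<one>\<^bsub>A\<^esub>"


section \<open>Representations\<close>

text \<open>The representation space is the whole type \<^typ>\<open>'v\<close>, of arbitrary dimension.\<close>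

locale algebra_representation = vector_space scale
  for scale :: "complex \<Rightarrow> 'v::ab_group_add \<Rightarrow> 'v" +
  fixes A :: "(complex, 'a) module"
    and \<rho> :: "'a \<Rightarrow> 'v \<Rightarrow> 'v"
  assumes rep_linear: "a \<in> carrier A \<Longrightarrow> Vector_Spaces.linear scale scale (\<rho> a)"
    and rep_one: "\<rho> \<one>\<^bsub>A\<^esub> v = v"
    and rep_mult: "a \<in> carrier A \<Longrightarrow> b \<in> carrier A \<Longrightarrow> \<rho> (a \<otimes>\<^bsub>A\<^esub> b) v = \<rho> a (\<rho> b v)"
    and rep_add: "a \<in> carrier A \<Longrightarrow> b \<in> carrier A \<Longrightarrow> \<rho> (a \<oplus>\<^bsub>A\<^esub> b) v = \<rho> a v + \<rho> b v"
    and rep_smult: "a \<in> carrier A \<Longrightarrow> \<rho> (c \<odot>\<^bsub>A\<^esub> a) v = scale c (\<rho> a v)"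

locale irreducible_representation = algebra_representation scale A \<rho>
  for scale :: "complex \<Rightarrow> 'v::ab_group_add \<Rightarrow> 'v"
    and A :: "(complex, 'a) module"
    and \<rho> :: "'a \<Rightarrow> 'v \<Rightarrow> 'v" +
  assumes rep_nonzero: "\<exists>v::'v. v \<noteq> 0"
    and rep_irreducible:
      "subspace W \<Longrightarrow> (\<And>a w. a \<in> carrier A \<Longrightarrow> w \<in> W \<Longrightarrow> \<rho> a w \<in> W) \<Longrightarrow> W = {0} \<or> W = UNIV"


section \<open>The two-boundary Temperley-Lieb algebra\<close>

type_synonym btl = "(word \<Rightarrow>\<^sub>0 complex) set"

definition btl_relators ::
    "nat \<Rightarrow> complex \<Rightarrow> complex \<Rightarrow> complex \<Rightarrow> (word \<Rightarrow>\<^sub>0 complex) set" where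
  "btl_relators N \<delta> s1 s2 =
    {gen i * gen i - const \<delta> * gen i | i. 1 \<le> i \<and> i \<le> N - 1} \<union>
    {gen i * gen j * gen i - gen i | i j. 1 \<le> i \<and> i \<le> N - 1 \<and> (j = i + 1 \<or> j = i - 1)} \<union>
    {gen 0 * gen 0 - const s1 * gen 0, gen N * gen N - const s2 * gen N} \<union>
    {gen i * gen j - gen j * gen i | i j. i \<le> N \<and> j \<le> N \<and> \<bar>int i - int j\<bar> > 1}"

definition btl_ideal ::
    "nat \<Rightarrow> complex \<Rightarrow> complex \<Rightarrow> complex \<Rightarrow> (word \<Rightarrow>\<^sub>0 complex) set" where
  "btl_ideal N \<delta> s1 s2 = Idl\<^bsub>free_algebra {0..N}\<^esub> (btl_relators N \<delta> s1 s2)"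

definition two_BTL :: "nat \<Rightarrow> complex \<Rightarrow> complex \<Rightarrow> complex \<Rightarrow> (complex, btl) module" where
  "two_BTL N \<delta> s1 s2 = quotient_algebra (free_algebra {0..N}) (btl_ideal N \<delta> s1 s2)"

definition btl_e :: "nat \<Rightarrow> complex \<Rightarrow> complex \<Rightarrow> complex \<Rightarrow> nat \<Rightarrow> btl" where
  "btl_e N \<delta> s1 s2 i = btl_ideal N \<delta> s1 s2 +>\<^bsub>free_algebra {0..N}\<^esub> gen i"

text \<open>
  For both parities of \<open>N\<close>, \<open>I\<^sub>1\<close> is the product of the \<open>e\<^sub>i\<close> with \<open>i \<in> {0..N}\<close> odd and
  \<open>I\<^sub>2\<close> is the product of those with \<open>i \<in> {0..N}\<close> even, in increasing order.
\<close>

definition btl_I1 :: "nat \<Rightarrow> complex \<Rightarrow> complex \<Rightarrow> complex \<Rightarrow> btl" where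
  "btl_I1 N \<delta> s1 s2 =
    list_prod (two_BTL N \<delta> s1 s2) (map (btl_e N \<delta> s1 s2) (filter odd [0..<N + 1]))"

definition btl_I2 :: "nat \<Rightarrow> complex \<Rightarrow> complex \<Rightarrow> complex \<Rightarrow> btl" where
  "btl_I2 N \<delta> s1 s2 =
    list_prod (two_BTL N \<delta> s1 s2) (map (btl_e N \<delta> s1 s2) (filter even [0..<N + 1]))"

definition double_quotient_ideal ::
    "nat \<Rightarrow> complex \<Rightarrow> complex \<Rightarrow> complex \<Rightarrow> complex \<Rightarrow> btl set" where
  "double_quotient_ideal N \<delta> s1 s2 b =
    (let A = two_BTL N \<delta> s1 s2; I1 = btl_I1 N \<delta> s1 s2; I2 = btl_I2 N \<delta> s1 s2
     in Idl\<^bsub>A\<^esub> {I1 \<otimes>\<^bsub>A\<^esub> I2 \<otimes>\<^bsub>A\<^esub> I1 \<ominus>\<^bsub>A\<^esub> b \<odot>\<^bsub>A\<^esub> I1, I2 \<otimes>\<^bsub>A\<^esub> I1 \<otimes>\<^bsub>A\<^esub> I2 \<ominus>\<^bsub>A\<^esub> b \<odot>\<^bsub>A\<^esub> I2})"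

definition double_quotient ::
    "nat \<Rightarrow> complex \<Rightarrow> complex \<Rightarrow> complex \<Rightarrow> complex \<Rightarrow> (complex, btl set) module" where
  "double_quotient N \<delta> s1 s2 b =
    quotient_algebra (two_BTL N \<delta> s1 s2) (double_quotient_ideal N \<delta> s1 s2 b)"

definition factors_through_double_quotient ::
    "nat \<Rightarrow> complex \<Rightarrow> complex \<Rightarrow> complex \<Rightarrow> complex \<Rightarrow>
      (complex \<Rightarrow> 'v::ab_group_add \<Rightarrow> 'v) \<Rightarrow> (btl \<Rightarrow> 'v \<Rightarrow> 'v) \<Rightarrow> bool" where
  "factors_through_double_quotient N \<delta> s1 s2 b scale \<rho> \<longleftrightarrow>
    (\<exists>\<sigma>. algebra_representation scale (double_quotient N \<delta> s1 s2 b) \<sigma> \<and>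
      (\<forall>a\<in>carrier (two_BTL N \<delta> s1 s2).
        \<rho> a = \<sigma> (double_quotient_ideal N \<delta> s1 s2 b +>\<^bsub>two_BTL N \<delta> s1 s2\<^esub> a)))"

definition double_quotient_relations_hold ::
    "nat \<Rightarrow> complex \<Rightarrow> complex \<Rightarrow> complex \<Rightarrow> complex \<Rightarrow>
      (btl \<Rightarrow> 'v \<Rightarrow> 'v) \<Rightarrow> bool" where
  "double_quotient_relations_hold N \<delta> s1 s2 b \<rho> \<longleftrightarrow>
    (let A = two_BTL N \<delta> s1 s2; I1 = btl_I1 N \<delta> s1 s2; I2 = btl_I2 N \<delta> s1 s2
     in \<rho> (I1 \<otimes>\<^bsub>A\<^esub> I2 \<otimes>\<^bsub>A\<^esub> I1) = \<rho> (b \<odot>\<^bsub>A\<^esub> I1) \<and> \<rho> (I2 \<otimes>\<^bsub>A\<^esub> I1 \<otimes>\<^bsub>A\<^esub> I2) = \<rho> (b \<odot>\<^bsub>A\<^esub> I2))"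


section \<open>The parametrisation by \<open>q\<close>, \<open>\<omega>\<^sub>1\<close>, \<open>\<omega>\<^sub>2\<close> and the central element\<close>

definition qpow :: "complex \<Rightarrow> complex \<Rightarrow> complex" where
  "qpow \<eta> x = exp (\<eta> * x)"

definition qnum :: "complex \<Rightarrow> complex \<Rightarrow> complex" where
  "qnum \<eta> x = (qpow \<eta> x - qpow \<eta> (- x)) / (qpow \<eta> 1 - qpow \<eta> (- 1))"

definition btl_param :: "complex \<Rightarrow> complex \<Rightarrow> complex" where
  "btl_param \<eta> \<omega> = qnum \<eta> \<omega> / qnum \<eta> (\<omega> + 1)"

context
  fixes N :: nat and \<eta> \<omega>1 \<omega>2 :: complex
begin

definition alg_A :: "(complex, btl) module" where
  "alg_A = two_BTL N (qnum \<eta> 2) (btl_param \<eta> \<omega>1) (btl_param \<eta> \<omega>2)"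

definition elt_e :: "nat \<Rightarrow> btl" where
  "elt_e = btl_e N (qnum \<eta> 2) (btl_param \<eta> \<omega>1) (btl_param \<eta> \<omega>2)"

definition elt_g :: "nat \<Rightarrow> btl" where
  "elt_g i =
    (if i = 0 then
       qpow \<eta> \<omega>1 \<odot>\<^bsub>alg_A\<^esub> \<one>\<^bsub>alg_A\<^esub>
         \<ominus>\<^bsub>alg_A\<^esub> (qpow \<eta> (1 + \<omega>1) - qpow \<eta> (- 1 - \<omega>1)) \<odot>\<^bsub>alg_A\<^esub> elt_e 0
     else if i = N then
       qpow \<eta> \<omega>2 \<odot>\<^bsub>alg_A\<^esub> \<one>\<^bsub>alg_A\<^esub>
         \<ominus>\<^bsub>alg_A\<^esub> (qpow \<eta> (1 + \<omega>2) - qpow \<eta> (- 1 - \<omega>2)) \<odot>\<^bsub>alg_A\<^esub> elt_e N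
     else elt_e i \<ominus>\<^bsub>alg_A\<^esub> qpow \<eta> (- 1) \<odot>\<^bsub>alg_A\<^esub> \<one>\<^bsub>alg_A\<^esub>)"

primrec elt_J :: "nat \<Rightarrow> btl" where
  "elt_J 0 =
    list_prod alg_A
      (map (\<lambda>i. inv\<^bsub>alg_A\<^esub> elt_g i) [1..<N] @ [elt_g N] @ map elt_g (rev [0..<N]))"
| "elt_J (Suc i) = elt_g (Suc i) \<otimes>\<^bsub>alg_A\<^esub> elt_J i \<otimes>\<^bsub>alg_A\<^esub> elt_g (Suc i)"

definition elt_Z :: btl where
  "elt_Z = (\<Oplus>\<^bsub>alg_A\<^esub>i\<in>{0..<N}. elt_J i \<oplus>\<^bsub>alg_A\<^esub> inv\<^bsub>alg_A\<^esub> elt_J i)"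

end

end

theory Submission
  imports Defs "HOL-Computational_Algebra.Fundamental_Theorem_Algebra"
begin

text \<open>
  Let \<open>I\<close> be one of \<open>I\<^sub>1\<close>, \<open>I\<^sub>2\<close> and \<open>I'\<close> the other. Reducing words by means of heaps of tiles shows that
  \<open>I w I\<close> is a multiple of some power \<open>(I I')\<^sup>k I\<close> for every word \<open>w\<close>. On an irreducible module \<open>V\<close>, of
  whatever dimension, every nonzero vector of \<open>I V\<close> therefore generates \<open>I V\<close> over the polynomials in
  \<open>I I'\<close>, so that \<open>I I'\<close> acts on \<open>I V\<close> as a scalar \<open>b\<close>.

  For the value of \<open>b\<close>, the centrality of \<open>Z\<^sub>N\<close> is not needed: since \<open>I Z\<^sub>N I\<close> is a multiple of \<open>I\<close>, it
  suffices to compute it. Between two factors \<open>I\<close> the elements \<open>J\<^sub>i\<close> and \<open>J\<^sub>i\<^sup>-\<^sup>1\<close> that belong to a generator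
  contained in \<open>I\<close> are proportional to each other and to those of the next such generator, with powers
  of \<open>q\<close> as factors, so the sum over \<open>i\<close> is geometric; together with the elements at the ends it gives
  \<open>[N]\<close> times an affine function of \<open>I I'\<close>.
\<close>

section \<open>The corner of the two-boundary Temperley-Lieb algebra\<close>

text \<open>The step from a cyclic corner to a scalar works without finite dimension: if
  \<open>x = I I'\<close> does not kill a generator \<open>v\<close> of the corner, then
  \<open>x v\<close> generates it too, so \<open>v = f(x) x v\<close> and the nonzero polynomial
  \<open>X f - 1\<close> annihilates \<open>v\<close>. Splitting off linear factors gives an
  eigenvector, and its cyclic span is a line that exhausts the corner.

  Either product may act as zero on \<open>V\<close>, so \<open>I Z I\<close> has to be known for
  both. Which boundary generators belong to \<open>I\<close> depends on the product and on the
  parity of \<open>N\<close>; this gives four cases, which differ in the treatment of the ends of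
  the sum.

  That \<open>J_i\<close> and its inverse are proportional in the corner comes from
  \<open>e_{i+1} J_i g_{i+1} J_i = q^(-3-2i) e_{i+1}\<close>, to which both boundaries contribute
  through the same identity, \<open>blob_relation\<close>.

  The q-numbers in \<open>b\<close> arise from a factorisation. With
  \<open>x = \<omega>1 + \<omega>2 + 1\<close> for even \<open>N\<close> and
  \<open>x = \<omega>1 - \<omega>2\<close> for odd \<open>N\<close>, the coefficient of
  \<open>I I\<close> in \<open>I Z I\<close> is \<open>[N] (q^x + q^-x)\<close>, and subtracting the
  assumed scalar leaves \<open>[N]\<close> times \<open>q^x + q^-x - q^\<theta> - q^-\<theta> = (q -
  q^-1)^2 [(x+\<theta>)/2] [(x-\<theta>)/2]\<close>.\<close>

text \<open>
  Commutation of distant generators is assumed for all indices; in the application \<open>E i = 0\<close> for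
  \<open>i > N\<close>.
\<close>

locale btl_action = vector_space scale
  for scale :: "complex \<Rightarrow> 'v::ab_group_add \<Rightarrow> 'v" (infixr \<open>*s\<close> 75) +
  fixes N :: nat and E :: "nat \<Rightarrow> 'v \<Rightarrow> 'v" and c s1 s2 :: complex
  assumes N_ge_2: "2 \<le> N"
    and E_add: "E i (v + w) = E i v + E i w"
    and E_scale: "E i (a *s v) = a *s E i v"
    and E_sq: "1 \<le> i \<Longrightarrow> i < N \<Longrightarrow> E i (E i v) = c *s E i v"
    and E_sq_left: "E 0 (E 0 v) = s1 *s E 0 v"
    and E_sq_right: "E N (E N v) = s2 *s E N v"
    and E_TL_up: "1 \<le> i \<Longrightarrow> i < N \<Longrightarrow> E i (E (Suc i) (E i v)) = E i v"
    and E_TL_down: "Suc i < N \<Longrightarrow> E (Suc i) (E i (E (Suc i) v)) = E (Suc i) v"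
    and E_far: "Suc i < j \<Longrightarrow> E i (E j v) = E j (E i v)"
    and c_nonzero: "c \<noteq> 0"
begin

lemma E_zero [simp]: "E i 0 = 0"
  using E_scale[of i 0 0] by simp

lemma E_neg: "E i (- v) = - E i v"
  using E_scale[of i "-1" v] by simp

lemma E_diff: "E i (v - w) = E i v - E i w"
  using E_add[of i v "- w"] by (simp add: E_neg)

lemma E_far': "Suc i < j \<or> Suc j < i \<Longrightarrow> E i (E j v) = E j (E i v)"
  using E_far by metis

definition wt :: "nat \<Rightarrow> complex"
  where "wt i = (if i = 0 then s1 else if i = N then s2 else c)"

lemma E_sq_wt: "i \<le> N \<Longrightarrow> E i (E i v) = wt i *s E i v"
  unfolding wt_def using E_sq E_sq_left E_sq_right by auto

abbreviation word_op :: "nat list \<Rightarrow> 'v \<Rightarrow> 'v"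
  where "word_op \<equiv> foldr E"

lemma word_op_add: "word_op xs (v + w) = word_op xs v + word_op xs w"
  by (induction xs) (simp_all add: E_add)

lemma word_op_scale: "word_op xs (a *s v) = a *s word_op xs v"
  by (induction xs) (simp_all add: E_scale)

lemma word_op_zero [simp]: "word_op xs 0 = 0"
  by (induction xs) simp_all

lemma E_word_op_far:
  "(\<And>j. j \<in> set xs \<Longrightarrow> Suc i < j \<or> Suc j < i) \<Longrightarrow> E i (word_op xs v) = word_op xs (E i v)"
  by (induction xs) (auto simp: E_far'[of i])

definition sites :: "bool \<Rightarrow> nat list"
  where "sites p = filter (\<lambda>i. even i = p) [0..<N + 1]"

lemma set_sites: "set (sites p) = {i. i \<le> N \<and> even i = p}"
  by (auto simp: sites_def le_less)

lemma distinct_sites: "distinct (sites p)"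
  by (simp add: sites_def)

text \<open>\<open>Iop False\<close> is \<open>I\<^sub>1\<close> and \<open>Iop True\<close> is \<open>I\<^sub>2\<close>.\<close>

abbreviation Iop :: "bool \<Rightarrow> 'v \<Rightarrow> 'v"
  where "Iop p \<equiv> word_op (sites p)"

lemma same_parity_far: "even i = even j \<Longrightarrow> i \<noteq> j \<Longrightarrow> Suc i < j \<or> Suc j < i" for i j :: nat
  by presburger

text \<open>Distinct sites of equal parity are at distance at least two, so the factors of
  \<open>Iop p\<close> commute and any one of them can be moved to either end.\<close>

lemma Iop_split:
  assumes "i \<le> N" "even i = p"
  obtains w where "\<And>v. Iop p v = E i (w v)" "\<And>v. Iop p v = w (E i v)"
proof -
  obtain xs ys where s: "sites p = xs @ i # ys"
    using split_list[of i "sites p"] assms by (auto simp: set_sites)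
  have far: "Suc i < j \<or> Suc j < i" if "j \<in> set xs \<union> set ys" for j
  proof (rule same_parity_far)
    show "even i = even j"
      using that assms set_sites[of p] s by auto
    show "i \<noteq> j"
      using that distinct_sites[of p] s by auto
  qed
  have xs: "E i (word_op xs v) = word_op xs (E i v)" for v
    by (rule E_word_op_far) (use far in blast)
  have ys: "E i (word_op ys v) = word_op ys (E i v)" for v
    by (rule E_word_op_far) (use far in blast)
  have "Iop p v = E i (word_op (xs @ ys) v)" and "Iop p v = word_op (xs @ ys) (E i v)" for v
    by (simp_all add: s xs ys flip: ys)
  then show ?thesis
    using that by blast
qed

lemma Iop_top:
  assumes "i \<le> N" "even i = p"
  shows "\<exists>y. Iop p v = E i y"
proof -
  obtain w where "\<And>v. Iop p v = E i (w v)" using Iop_split[OF assms] by metis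
  then show ?thesis by blast
qed

lemma E_Iop: "i \<le> N \<Longrightarrow> even i = p \<Longrightarrow> E i (Iop p v) = wt i *s Iop p v"
  by (metis Iop_split E_sq_wt)

lemma Iop_E: "i \<le> N \<Longrightarrow> even i = p \<Longrightarrow> Iop p (E i v) = wt i *s Iop p v"
  by (metis Iop_split E_sq_wt word_op_scale)


subsection \<open>Heaps over the zigzag path\<close>

text \<open>
  A word applied to \<^term>\<open>Iop p u\<close> is drawn as a heap of tiles on top of a zigzag path on the
  sites \<open>0, \<dots>, N\<close>, whose local maxima are the sites of parity \<^term>\<open>p\<close>; the tile of \<^term>\<open>E i\<close>
  raises the path at site \<^term>\<open>i\<close> by two. Only reduced words produce such heaps; the relations
  reduce any other word to a multiple of a reduced one.
\<close>

definition zigzag :: "bool \<Rightarrow> nat \<Rightarrow> int"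
  where "zigzag p i = (if even i = p then 0 else -1)"

definition lmax :: "(nat \<Rightarrow> int) \<Rightarrow> nat \<Rightarrow> bool"
  where "lmax h i \<longleftrightarrow> i \<le> N \<and> (0 < i \<longrightarrow> h (i - 1) < h i) \<and> (i < N \<longrightarrow> h (Suc i) < h i)"

definition lmin :: "(nat \<Rightarrow> int) \<Rightarrow> nat \<Rightarrow> bool"
  where "lmin h i \<longleftrightarrow> i \<le> N \<and> (0 < i \<longrightarrow> h i < h (i - 1)) \<and> (i < N \<longrightarrow> h i < h (Suc i))"

definition slope :: "(nat \<Rightarrow> int) \<Rightarrow> nat \<Rightarrow> bool"
  where "slope h i \<longleftrightarrow> 0 < i \<and> i < N \<and>
    (h (i - 1) < h i \<and> h i < h (Suc i) \<or> h (Suc i) < h i \<and> h i < h (i - 1))"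

definition is_path :: "(nat \<Rightarrow> int) \<Rightarrow> bool"
  where "is_path h \<longleftrightarrow> (\<forall>i<N. \<bar>h (Suc i) - h i\<bar> = 1)"

inductive heap :: "'v \<Rightarrow> bool \<Rightarrow> nat \<Rightarrow> (nat \<Rightarrow> int) \<Rightarrow> 'v \<Rightarrow> bool"
  for u :: 'v and p :: bool where
  heap_base: "heap u p 0 (zigzag p) (Iop p u)"
| heap_step: "heap u p n h x \<Longrightarrow> lmin h i \<Longrightarrow> heap u p (Suc n) (h(i := h i + 2)) (E i x)"

lemma path_diff: "is_path h \<Longrightarrow> i < N \<Longrightarrow> h (Suc i) = h i + 1 \<or> h (Suc i) = h i - 1"
  unfolding is_path_def by (smt (verit))

lemma path_diff_pred: "is_path h \<Longrightarrow> 0 < i \<Longrightarrow> i \<le> N \<Longrightarrow> h (i - 1) = h i + 1 \<or> h (i - 1) = h i - 1"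
  using path_diff[of h "i - 1"] by force

lemma path_cases: "is_path h \<Longrightarrow> i \<le> N \<Longrightarrow> lmin h i \<or> lmax h i \<or> slope h i"
  unfolding lmin_def lmax_def slope_def
  using path_diff[of h i] path_diff_pred[of h i] by linarith

lemma zigzag_path: "is_path (zigzag p)"
  by (auto simp: is_path_def zigzag_def)

lemma heap_path: "heap u p n h x \<Longrightarrow> is_path h"
proof (induction rule: heap.induct)
  case heap_base
  then show ?case by (rule zigzag_path)
next
  case (heap_step n h x i)
  then have "\<bar>(h(i := h i + 2)) (Suc j) - (h(i := h i + 2)) j\<bar> = 1" if "j < N" for j
    using that path_diff[of h j] by (auto simp: lmin_def)
  then show ?case by (simp add: is_path_def)
qed

lemma heap_ge: "heap u p n h x \<Longrightarrow> zigzag p i \<le> h i"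
  by (induction rule: heap.induct) auto

text \<open>Tiles only raise the path, so a path at base level carries none.\<close>

lemma heap_zigzag: "heap u p n h x \<Longrightarrow> (\<And>i. i \<le> N \<Longrightarrow> h i = zigzag p i) \<Longrightarrow> x = Iop p u"
proof (induction rule: heap.cases)
  case (heap_step n h x i)
  then have "h i + 2 = zigzag p i"
    by (metis fun_upd_same lmin_def)
  then show ?case
    using heap_ge[OF heap_step(4), of i] by simp
qed simp

lemma lmax_not_adjacent: "lmax h i \<Longrightarrow> lmax h j \<Longrightarrow> i \<noteq> j \<Longrightarrow> Suc i < j \<or> Suc j < i"
proof (rule ccontr)
  assume a: "lmax h i" "lmax h j" "i \<noteq> j" "\<not> (Suc i < j \<or> Suc j < i)"
  then consider "j = Suc i" | "i = Suc j" by linarith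
  then show False
    using a by cases (auto simp: lmax_def)
qed

lemma lmin_raise: "is_path h \<Longrightarrow> lmin h i \<Longrightarrow> lmax (h(i := h i + 2)) i"
  using path_diff[of h i] path_diff_pred[of h i] by (auto simp: lmin_def lmax_def)

lemma lmax_upd: "Suc i < j \<or> Suc j < i \<Longrightarrow> lmax (h(i := a)) j = lmax h j"
  by (auto simp: lmax_def)

lemma lmin_upd: "Suc i < j \<or> Suc j < i \<Longrightarrow> lmin (h(i := a)) j = lmin h j"
  by (auto simp: lmin_def)

lemma slope_upd: "Suc i < j \<or> Suc j < i \<Longrightarrow> slope (h(i := a)) j = slope h j"
  by (auto simp: slope_def)

text \<open>A tile just laid makes its site a local maximum, and local maxima are never adjacent.
  Hence every tile laid after the last one at \<open>i\<close> is distant from \<open>i\<close> and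
  commutes with it.\<close>

lemma heap_peel:
  assumes "heap u p n h x" "lmax h i" "zigzag p i < h i"
  shows "\<exists>y m. n = Suc m \<and> x = E i y \<and> heap u p m (h(i := h i - 2)) y"
  using assms
proof (induction arbitrary: rule: heap.induct)
  case (heap_step n h x j)
  let ?h = "h(j := h j + 2)"
  show ?case
  proof (cases "i = j")
    case True
    have "(h(j := h j + 2))(j := (h(j := h j + 2)) j - 2) = h" by auto
    then show ?thesis using heap_step(1) True by metis
  next
    case False
    have far: "Suc i < j \<or> Suc j < i"
      using lmax_not_adjacent[OF heap_step.prems(1) lmin_raise] heap_step heap_path False by blast
    then have "lmax h i"
      using heap_step lmax_upd[of j i] by blast
    moreover have "zigzag p i < h i" using heap_step.prems(2) False by simp
    ultimately obtain y m where y: "n = Suc m" "x = E i y" "heap u p m (h(i := h i - 2)) y"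
      using heap_step.IH by blast
    have "heap u p (Suc m) ((h(i := h i - 2))(j := (h(i := h i - 2)) j + 2)) (E j y)"
      by (rule heap.heap_step) (use y far heap_step lmin_upd[of i j] in auto)
    then have "heap u p (Suc m) (?h(i := ?h i - 2)) (E j y)"
      using False by (simp add: fun_upd_twist)
    moreover have "E j x = E i (E j y)" using y(2) far E_far'[of j i] by auto
    ultimately show ?thesis using y(1) by blast
  qed
qed simp

text \<open>At base height no tile has been laid at \<open>i\<close>, so the factor
  \<open>E i\<close> comes from \<open>Iop p\<close> itself; all tiles are distant from
  \<open>i\<close> and let it pass.\<close>

lemma heap_bottom:
  assumes "heap u p n h x" "lmax h i" "h i = zigzag p i"
  shows "\<exists>y. x = E i y"
  using assms
proof (induction rule: heap.induct)
  case heap_base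
  then have "even i = p"
    using N_ge_2 by (cases "i = 0") (auto simp: lmax_def zigzag_def split: if_splits)
  then show ?case
    using Iop_top heap_base(1) by (simp add: lmax_def)
next
  case (heap_step n h x j)
  have ne: "i \<noteq> j"
    using heap_step heap_ge[OF heap_step(1), of j] by auto
  have far: "Suc i < j \<or> Suc j < i"
    using lmax_not_adjacent[OF heap_step.prems(1) lmin_raise] heap_step heap_path ne by blast
  then have "lmax h i"
    using heap_step lmax_upd[of j i] by blast
  then obtain y where "x = E i y"
    using heap_step ne by auto
  then show ?case
    using far E_far'[of j i] by metis
qed

lemma heap_top:
  assumes "heap u p n h x" "lmax h i"
  shows "\<exists>y. x = E i y"
  using heap_peel[OF assms] heap_bottom[OF assms] heap_ge[OF assms(1), of i] by force

text \<open>For instance, a global maximum of the path has the required properties.\<close>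

lemma slope_peak:
  assumes h: "heap u p n h x" and i: "slope h i"
  shows "\<exists>j. lmax h j \<and> zigzag p j < h j \<and> j \<noteq> i \<and>
    (Suc i < j \<or> Suc j < i \<or> lmax (h(j := h j - 2)) i)"
proof -
  have p: "is_path h" using h by (rule heap_path)
  define M where "M = Max (h ` {..N})"
  have "M \<in> h ` {..N}"
    unfolding M_def by (rule Max_in) auto
  then obtain j where j: "j \<le> N" "h j = M" by auto
  have le: "h k \<le> h j" if "k \<le> N" for k
    unfolding j(2) M_def using that by simp
  have jm: "lmax h j"
    unfolding lmax_def using j le path_diff[OF p, of j] path_diff_pred[OF p, of j]
    by (smt (verit) Suc_leI diff_le_self order_trans)
  \<comment> \<open>The lower neighbour of a slope has height at least -1. The maximum is strictly
    above \<open>h i\<close>, hence above every base height, and so carries a tile.\<close>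
  have pos: "0 \<le> h i"
    using i heap_ge[OF h, of "i - 1"] heap_ge[OF h, of "Suc i"]
    by (auto simp: slope_def zigzag_def split: if_splits)
  have up: "h i + 1 \<le> h j"
    using i le[of "Suc i"] le[of "i - 1"] unfolding slope_def by linarith
  have "zigzag p j < h j"
    using pos up by (auto simp: zigzag_def)
  moreover have "j \<noteq> i" using up by auto
  moreover have "lmax (h(j := h j - 2)) i" if "\<not> (Suc i < j \<or> Suc j < i)"
  proof -
    have "j = Suc i \<or> j = i - 1" using that \<open>j \<noteq> i\<close> by linarith
    then consider "j = Suc i" "h (i - 1) < h i" | "j = i - 1" "h (Suc i) < h i"
      using i up unfolding slope_def by force
    then show ?thesis
      by cases (use i path_diff[OF p, of i] path_diff_pred[OF p, of i] in \<open>auto simp: slope_def lmax_def\<close>)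
  qed
  ultimately show ?thesis using jm by blast
qed

text \<open>
  On a slope the word is not reduced: either the tile above cancels against \<open>E i\<close> by
  \<open>e\<^sub>i e\<^sub>i\<^sub>\<plusminus>\<^sub>1 e\<^sub>i = e\<^sub>i\<close>, or a distant peak can be taken off first. The heap shrinks in both cases, which
  is what allows the peak to be put back by the induction hypothesis.
\<close>

lemma heap_E:
  assumes "heap u p n h x" "i \<le> N"
  shows "\<exists>a h' x' m. E i x = a *s x' \<and> heap u p m h' x' \<and> lmax h' i
    \<and> (\<forall>k. lmax h k \<and> (Suc k < i \<or> Suc i < k) \<longrightarrow> lmax h' k)
    \<and> m \<le> Suc n \<and> (slope h i \<longrightarrow> m < n)"
  using assms
proof (induction n arbitrary: h x i rule: less_induct)
  case (less n)
  note h = less.prems(1)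
  have p: "is_path h" using h by (rule heap_path)
  consider "lmin h i" | "lmax h i" | "slope h i"
    using path_cases[OF p less.prems(2)] by blast
  then show ?case
  proof cases
    case 1
    have "\<not> slope h i" using 1 by (auto simp: lmin_def slope_def)
    moreover have "E i x = 1 *s E i x" by simp
    moreover have "lmax (h(i := h i + 2)) k" if "lmax h k" "Suc k < i \<or> Suc i < k" for k
      using that lmax_upd[of i k] by blast
    ultimately show ?thesis
      using heap_step[OF h 1] lmin_raise[OF p 1] by blast
  next
    case 2
    obtain y where "x = E i y" using heap_top[OF h 2] by blast
    then have "E i x = wt i *s x" using E_sq_wt less.prems(2) by simp
    moreover have "\<not> slope h i" using 2 by (auto simp: lmax_def slope_def)
    ultimately show ?thesis
      using h 2 by (intro exI[of _ "wt i"] exI[of _ h] exI[of _ x] exI[of _ n]) auto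
  next
    case 3
    obtain j where j: "lmax h j" "zigzag p j < h j" "j \<noteq> i"
      and dis: "Suc i < j \<or> Suc j < i \<or> lmax (h(j := h j - 2)) i"
      using slope_peak[OF h 3] by blast
    obtain y m where y: "n = Suc m" "x = E j y" "heap u p m (h(j := h j - 2)) y"
      using heap_peel[OF h j(1,2)] by blast
    have keep: "lmax (h(j := h j - 2)) k" if "lmax h k" "k \<noteq> j" for k
      using that lmax_not_adjacent[OF j(1) that(1)] lmax_upd[of j k] by blast
    show ?thesis
    proof (cases "Suc i < j \<or> Suc j < i")
      case far: True
      have "slope (h(j := h j - 2)) i" using 3 far slope_upd[of j i] by blast
      then obtain a1 h1 x1 m1 where 1: "E i y = a1 *s x1" "heap u p m1 h1 x1" "lmax h1 i" "m1 < m"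
        and k1: "\<And>k. lmax (h(j := h j - 2)) k \<Longrightarrow> Suc k < i \<or> Suc i < k \<Longrightarrow> lmax h1 k"
        using less.IH[OF _ y(3) less.prems(2)] y(1) by blast
      have jN: "j \<le> N" using j by (simp add: lmax_def)
      \<comment> \<open>Acting with \<open>E i\<close> removed at least one of the remaining
        \<open>n - 1\<close> tiles; putting back \<open>E j\<close> adds at most one, so the total
        stays below \<open>n\<close>.\<close>
      have "m1 < n" using 1 y(1) by simp
      from less.IH[OF this 1(2) jN]
      obtain a2 h2 x2 m2 where 2: "E j x1 = a2 *s x2" "heap u p m2 h2 x2" "lmax h2 j"
        and k2: "\<And>k. lmax h1 k \<Longrightarrow> Suc k < j \<or> Suc j < k \<Longrightarrow> lmax h2 k"
        and le: "m2 \<le> Suc m1"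
        by blast
      have "E i x = (a1 * a2) *s x2"
        using 1 2 y far by (simp add: E_far'[of i j] E_scale)
      moreover have "lmax h2 i" using k2[OF 1(3)] far by blast
      moreover have "lmax h2 k" if "lmax h k" "Suc k < i \<or> Suc i < k" for k
        using that keep k1 k2 2(3) lmax_not_adjacent[OF j(1) that(1)] by metis
      moreover have "m2 < n" using le 1(4) y(1) by simp
      ultimately show ?thesis using 2(2) by (intro exI[of _ "a1 * a2"] exI[of _ h2] exI[of _ x2] exI[of _ m2]) auto
    next
      case False
      then have im: "lmax (h(j := h j - 2)) i" and adj: "j = Suc i \<or> i = Suc j"
        using dis \<open>j \<noteq> i\<close> by auto
      obtain z where z: "y = E i z" using heap_top[OF y(3) im] by blast
      \<comment> \<open>A slope lies strictly between the boundaries, so \<open>E i\<close>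
        satisfies the cubic relation even if the peak \<open>j\<close> is \<open>0\<close> or
        \<open>N\<close>.\<close>
      have "E i x = y"
        unfolding y(2) z using adj 3 E_TL_up[of i z] E_TL_down[of j z] by (auto simp: slope_def)
      then have "E i x = 1 *s y" by simp
      moreover have "lmax (h(j := h j - 2)) k" if "lmax h k" "Suc k < i \<or> Suc i < k" for k
        using that keep adj by auto
      ultimately show ?thesis
        using y im
        by (intro exI[of _ "1 :: complex"] exI[of _ "h(j := h j - 2)"] exI[of _ y] exI[of _ m])
          (auto simp del: fun_upd_apply)
    qed
  qed
qed

text \<open>The sites in \<open>xs\<close> are pairwise distant, so each further generator keeps the
  local maxima already created. This is the purpose of the preservation clause in
  \<open>heap_E\<close>.\<close>

lemma heap_word:
  assumes "heap u p n h x" "distinct xs" "set xs \<subseteq> {i. i \<le> N \<and> even i = q}"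
  shows "\<exists>a h' x' m. word_op xs x = a *s x' \<and> heap u p m h' x' \<and> (\<forall>i\<in>set xs. lmax h' i)"
  using assms(2,3)
proof (induction xs)
  case Nil
  have "word_op [] x = 1 *s x" by simp
  then show ?case using assms(1) by (metis empty_iff empty_set)
next
  case (Cons i xs)
  then obtain a h1 x1 m1 where 1: "word_op xs x = a *s x1" "heap u p m1 h1 x1" "\<forall>k\<in>set xs. lmax h1 k"
    by auto
  obtain b h2 x2 m2 where 2: "E i x1 = b *s x2" "heap u p m2 h2 x2" "lmax h2 i"
    "\<forall>k. lmax h1 k \<and> (Suc k < i \<or> Suc i < k) \<longrightarrow> lmax h2 k"
    using heap_E[OF 1(2), of i] Cons.prems by auto
  have "lmax h2 k" if "k \<in> set (i # xs)" for k
  proof (cases "k = i")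
    case False
    then have "Suc k < i \<or> Suc i < k"
      using that Cons.prems same_parity_far[of k i] by auto
    then show ?thesis using that False 1 2 by auto
  qed (use 2 in simp)
  moreover have "word_op (i # xs) x = (a * b) *s x2"
    using 1 2 by (simp add: E_scale)
  ultimately show ?case using 2(2) by blast
qed

lemma heap_any_word:
  assumes "set xs \<subseteq> {..N}"
  shows "\<exists>a n h x. word_op xs (Iop p u) = a *s x \<and> heap u p n h x"
  using assms
proof (induction xs)
  case Nil
  have "word_op [] (Iop p u) = 1 *s Iop p u" by simp
  then show ?case using heap_base by blast
next
  case (Cons i xs)
  then obtain a n h x where 1: "word_op xs (Iop p u) = a *s x" "heap u p n h x" by auto
  obtain b h2 x2 m2 where 2: "E i x = b *s x2" "heap u p m2 h2 x2"
    using heap_E[OF 1(2), of i] Cons.prems by auto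
  have "word_op (i # xs) (Iop p u) = (a * b) *s x2"
    using 1 2 by (simp add: E_scale)
  then show ?case using 2(2) by blast
qed

lemma heap_peel_sites:
  assumes "heap u p n h x" "distinct xs" "set xs \<subseteq> {i. i \<le> N \<and> even i = q}"
    and "\<And>i. i \<in> set xs \<Longrightarrow> lmax h i \<and> zigzag p i < h i"
  shows "\<exists>y m. n = m + length xs \<and> x = word_op xs y \<and>
    heap u p m (\<lambda>i. if i \<in> set xs then h i - 2 else h i) y"
  using assms
proof (induction xs arbitrary: n h x)
  case (Cons i xs)
  obtain y m where y: "n = Suc m" "x = E i y" "heap u p m (h(i := h i - 2)) y"
    using heap_peel[OF Cons.prems(1), of i] Cons.prems(4)[of i] by (meson list.set_intros(1))
  have below: "lmax (h(i := h i - 2)) k \<and> zigzag p k < (h(i := h i - 2)) k" if "k \<in> set xs" for k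
  proof -
    have "k \<noteq> i" "even k = even i" using that Cons.prems by auto
    then show ?thesis
      using Cons.prems(4)[of k] that same_parity_far[of i k] lmax_upd[of i k] by auto
  qed
  have "distinct xs" "set xs \<subseteq> {i. i \<le> N \<and> even i = q}" using Cons.prems(2,3) by auto
  then obtain z l where z: "m = l + length xs" "y = word_op xs z"
    "heap u p l (\<lambda>k. if k \<in> set xs then (h(i := h i - 2)) k - 2 else (h(i := h i - 2)) k) z"
    using Cons.IH[OF y(3) _ _ below] by blast
  have "(\<lambda>k. if k \<in> set xs then (h(i := h i - 2)) k - 2 else (h(i := h i - 2)) k)
    = (\<lambda>k. if k \<in> set (i # xs) then h k - 2 else h k)"
    using Cons.prems(2) by auto
  then show ?case
    using z y by (intro exI[of _ z] exI[of _ l]) auto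
qed simp

abbreviation IJ :: "bool \<Rightarrow> 'v \<Rightarrow> 'v"
  where "IJ p v \<equiv> Iop p (Iop (\<not> p) v)"

text \<open>When every site of parity \<open>p\<close> is a local maximum, all steps of the path are
  forced and it is a vertical translate of the base. Its tiles then come off in complete layers,
  alternately \<open>Iop p\<close> and \<open>Iop (\<not> p)\<close>.\<close>

lemma heap_full:
  assumes "heap u p n h x" "\<And>i. i \<le> N \<Longrightarrow> even i = p \<Longrightarrow> lmax h i"
  shows "\<exists>k. x = (IJ p ^^ k) (Iop p u)"
  using assms
proof (induction n arbitrary: h x rule: less_induct)
  case (less n)
  note h = less.prems(1)
  have p: "is_path h" using h by (rule heap_path)
  define H where "H = h 0 - zigzag p 0"
  have H: "h i = H + zigzag p i" if "i \<le> N" for i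
    using that
  proof (induction i)
    case (Suc i)
    then have "even i = p \<and> lmax h i \<or> even (Suc i) = p \<and> lmax h (Suc i)"
      using less.prems(2)[of i] less.prems(2)[of "Suc i"] by auto
    then show ?case
      using Suc path_diff[OF p, of i] by (auto simp: lmax_def zigzag_def)
  qed (simp add: H_def)
  have "0 \<le> H" using H[of 0] heap_ge[OF h, of 0] by simp
  then consider "H = 0" | "0 < H" by linarith
  then show ?case
  proof cases
    case 1
    then have "x = (IJ p ^^ 0) (Iop p u)" using heap_zigzag[OF h] H by simp
    then show ?thesis by blast
  next
    case 2
    have "lmax h i \<and> zigzag p i < h i" if "i \<in> set (sites p)" for i
      using that less.prems(2) H 2 by (simp add: set_sites)
    then obtain y m where y: "n = m + length (sites p)" "x = Iop p y"
      "heap u p m (\<lambda>i. if i \<in> set (sites p) then h i - 2 else h i) y"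
      using heap_peel_sites[OF h distinct_sites, of p p] by (auto simp: set_sites)
    let ?h = "\<lambda>i. if i \<in> set (sites p) then h i - 2 else h i"
    have "lmax ?h i \<and> zigzag p i < ?h i" if "i \<in> set (sites (\<not> p))" for i
      using that H[of i] H[of "i - 1"] H[of "Suc i"] 2
      by (auto simp: set_sites lmax_def zigzag_def)
    then obtain z l where z: "m = l + length (sites (\<not> p))" "y = Iop (\<not> p) z"
      "heap u p l (\<lambda>i. if i \<in> set (sites (\<not> p)) then ?h i - 2 else ?h i) z"
      using heap_peel_sites[OF y(3) distinct_sites, of "\<not> p" "\<not> p"] by (auto simp: set_sites)
    have "lmax (\<lambda>i. if i \<in> set (sites (\<not> p)) then ?h i - 2 else ?h i) i"
      if "i \<le> N" "even i = p" for i
      using that less.prems(2)[OF that] by (auto simp: set_sites lmax_def)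
    moreover have "l < n"
    proof -
      have "0 \<in> set (sites p) \<union> set (sites (\<not> p))" by (auto simp: set_sites)
      then have "0 < length (sites p) + length (sites (\<not> p))" by auto
      then show ?thesis using y(1) z(1) by linarith
    qed
    ultimately obtain k where "z = (IJ p ^^ k) (Iop p u)"
      using less.IH z(3) by blast
    then have "x = (IJ p ^^ Suc k) (Iop p u)" using y(2) z(2) by simp
    then show ?thesis by blast
  qed
qed

text \<open>Whatever heap the word has produced, the outer \<open>Iop p\<close> turns all sites of
  parity \<open>p\<close> into local maxima, and \<open>heap_full\<close> applies.\<close>

theorem corner_word:
  assumes "set xs \<subseteq> {..N}"
  shows "\<exists>a k. Iop p (word_op xs (Iop p u)) = a *s (IJ p ^^ k) (Iop p u)"
proof -
  obtain a n h x where 1: "word_op xs (Iop p u) = a *s x" "heap u p n h x"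
    using heap_any_word[OF assms] by blast
  obtain b m g y where 2: "Iop p x = b *s y" "heap u p m g y" "\<forall>i\<in>set (sites p). lmax g i"
    using heap_word[OF 1(2) distinct_sites[of p], of p] by (auto simp: set_sites)
  obtain k where "y = (IJ p ^^ k) (Iop p u)"
    using heap_full[OF 2(2)] 2(3) by (auto simp: set_sites)
  then have "Iop p (word_op xs (Iop p u)) = (a * b) *s (IJ p ^^ k) (Iop p u)"
    using 1 2 by (simp add: word_op_scale)
  then show ?thesis by blast
qed


subsection \<open>The corner of an irreducible representation is a scalar\<close>

context
  fixes t :: "'v \<Rightarrow> 'v"
  assumes t_add: "t (v + w) = t v + t w" and t_scale: "t (a *s v) = a *s t v"
begin

definition poly_op :: "complex poly \<Rightarrow> 'v \<Rightarrow> 'v"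
  where "poly_op f v = fold_coeffs (\<lambda>a w. a *s v + t w) f 0"

lemma t_zero: "t 0 = 0"
  using t_scale[of 0 0] by simp

lemma poly_op_0 [simp]: "poly_op 0 v = 0"
  by (simp add: poly_op_def)

lemma poly_op_pCons [simp]: "poly_op (pCons a f) v = a *s v + t (poly_op f v)"
  by (cases "a = 0 \<and> f = 0") (auto simp: poly_op_def t_zero)

lemma poly_op_add: "poly_op (f + g) v = poly_op f v + poly_op g v"
proof (induction f g rule: poly_induct2)
  case (pCons a f b g)
  then show ?case by (simp add: t_add scale_left_distrib algebra_simps)
qed simp

lemma poly_op_smult: "poly_op (smult a f) v = a *s poly_op f v"
  by (induction f) (simp_all add: t_scale scale_right_distrib)

lemma poly_op_monom: "poly_op (monom 1 k) v = (t ^^ k) v"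
  by (induction k) (simp_all add: monom_0 monom_Suc t_zero)

lemma subspace_poly_op: "subspace (range (\<lambda>f. poly_op f v))"
  by (auto simp: subspace_def simp flip: poly_op_add poly_op_smult intro: range_eqI[of _ _ 0])

lemma span_powers: "span (range (\<lambda>k. (t ^^ k) v)) \<subseteq> range (\<lambda>f. poly_op f v)"
  by (rule span_minimal[OF _ subspace_poly_op]) (auto simp flip: poly_op_monom)

text \<open>Linear factors are split off \<open>f\<close> as long as the cofactor still annihilates
  \<open>v\<close>; the first cofactor that does not gives an eigenvector. The annihilating
  polynomial takes the place of finite dimension.\<close>

lemma eigenvector_of_annihilator:
  assumes "f \<noteq> 0" "poly_op f v = 0" "v \<noteq> 0"
  shows "\<exists>g b. poly_op g v \<noteq> 0 \<and> t (poly_op g v) = b *s poly_op g v"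
  using assms(1,2)
proof (induction "degree f" arbitrary: f)
  case 0
  then obtain a where "f = [:a:]" by (metis degree_eq_zeroE)
  then show ?case using 0 assms(3) by (auto simp: t_zero)
next
  case (Suc n)
  obtain b where "poly f b = 0"
    using fundamental_theorem_of_algebra[of f] Suc(2) by (auto simp: constant_degree)
  then obtain g where g: "f = [:- b, 1:] * g" by (auto simp: poly_eq_0_iff_dvd)
  then have "f = smult (- b) g + pCons 0 g" by simp
  then have "poly_op f v = t (poly_op g v) - b *s poly_op g v"
    by (simp only: poly_op_add poly_op_smult poly_op_pCons) simp
  then have "t (poly_op g v) = b *s poly_op g v" using Suc by simp
  moreover have "degree f = Suc (degree g)" "g \<noteq> 0"
  proof -
    show "g \<noteq> 0" using g Suc(3) by auto
    then show "degree f = Suc (degree g)" unfolding g by (subst degree_mult_eq) auto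
  qed
  ultimately show ?case using Suc by (cases "poly_op g v = 0") auto
qed

end

definition E_irreducible :: bool
  where "E_irreducible \<longleftrightarrow>
    (\<forall>W. subspace W \<longrightarrow> (\<forall>i\<le>N. \<forall>w\<in>W. E i w \<in> W) \<longrightarrow> W = {0} \<or> W = UNIV)"

text \<open>The words applied to \<open>Iop p u\<close> span a subspace stable under all generators,
  hence the whole space; \<open>corner_word\<close> describes its image under
  \<open>Iop p\<close>.\<close>

lemma corner_cyclic:
  assumes "E_irreducible" "Iop p u \<noteq> 0"
  shows "Iop p v \<in> span (range (\<lambda>k. (IJ p ^^ k) (Iop p u)))"
proof -
  define S where "S = {word_op xs (Iop p u) | xs. set xs \<subseteq> {..N}}"
  have "\<forall>w\<in>span S. E i w \<in> span S" if "i \<le> N" for i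
  proof
    fix w assume "w \<in> span S"
    then show "E i w \<in> span S"
    proof (induction rule: span_induct_alt)
      case (step a x y)
      then obtain xs where xs: "x = word_op xs (Iop p u)" "set xs \<subseteq> {..N}"
        by (auto simp: S_def)
      then have "E i x = word_op (i # xs) (Iop p u)" "set (i # xs) \<subseteq> {..N}" using that by auto
      then have "E i x \<in> span S" unfolding S_def by (metis (mono_tags, lifting) mem_Collect_eq span_base)
      then show ?case using step by (simp add: E_add E_scale span_add span_scale)
    qed (simp add: span_zero)
  qed
  moreover have "Iop p u \<in> span S"
    by (rule span_base) (auto simp: S_def intro: exI[of _ "[]"])
  ultimately have "span S = UNIV"
    using assms unfolding E_irreducible_def by (metis singletonD subspace_span)
  then have "v \<in> span S" by simp
  then show ?thesis
  proof (induction rule: span_induct_alt)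
    case (step a x y)
    then obtain xs where xs: "x = word_op xs (Iop p u)" "set xs \<subseteq> {..N}"
      by (auto simp: S_def)
    obtain b k where "Iop p x = b *s (IJ p ^^ k) (Iop p u)"
      using corner_word[OF xs(2)] xs(1) by blast
    then have "Iop p x \<in> span (range (\<lambda>k. (IJ p ^^ k) (Iop p u)))"
      by (simp add: span_scale span_base)
    then show ?case using step by (simp add: word_op_add word_op_scale span_add span_scale)
  qed (simp add: span_zero)
qed

lemma corner_scalar:
  assumes irr: "E_irreducible"
  shows "\<exists>b. \<forall>v. IJ p (Iop p v) = b *s Iop p v"
proof (cases "\<exists>u. Iop p u \<noteq> 0")
  case True
  then obtain u where u: "Iop p u \<noteq> 0" by blast
  let ?t = "IJ p"
  have t: "?t (v + w) = ?t v + ?t w" "?t (a *s v) = a *s ?t v" for a v w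
    by (simp_all add: word_op_add word_op_scale)
  note P = poly_op_pCons[of ?t, OF t] poly_op_monom[of ?t, OF t] t_zero[of ?t, OF t]
  have image: "\<exists>w. poly_op ?t f (Iop p u) = Iop p w" for f
  proof (induction f)
    case 0
    show ?case using poly_op_0[of ?t, OF t] word_op_zero by metis
  next
    case (pCons a f)
    then obtain w where "poly_op ?t f (Iop p u) = Iop p w" by blast
    then have "poly_op ?t (pCons a f) (Iop p u) = Iop p (a *s u + Iop (\<not> p) (Iop p w))"
      by (simp add: P word_op_add word_op_scale)
    then show ?case by blast
  qed
  have "\<exists>f. f \<noteq> 0 \<and> poly_op ?t f (Iop p u) = 0"
  proof (cases "?t (Iop p u) = 0")
    case True
    then have "poly_op ?t [:0, 1:] (Iop p u) = 0" using poly_op_0[of ?t, OF t] by (simp add: P)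
    then show ?thesis by (metis one_neq_zero pCons_eq_0_iff)
  next
    case False
    then obtain f where f: "Iop p u = poly_op ?t f (?t (Iop p u))"
      using corner_cyclic[OF irr, of p "Iop (\<not> p) (Iop p u)" u] span_powers[of ?t, OF t] by fastforce
    have "poly_op ?t f (?t w) = ?t (poly_op ?t f w)" for w
      using poly_op_0[of ?t, OF t] by (induction f) (simp_all add: P word_op_add word_op_scale)
    \<comment> \<open>This is the polynomial \<open>X f - 1\<close>, nonzero because of its constant
      coefficient.\<close>
    then have "poly_op ?t (pCons (-1) f) (Iop p u) = 0" using f by (simp add: P)
    then show ?thesis by (metis neg_equal_0_iff_equal one_neq_zero pCons_eq_0_iff)
  qed
  then obtain f where "f \<noteq> 0" "poly_op ?t f (Iop p u) = 0" by blast
  then obtain g b where g: "poly_op ?t g (Iop p u) \<noteq> 0"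
      "?t (poly_op ?t g (Iop p u)) = b *s poly_op ?t g (Iop p u)"
    using eigenvector_of_annihilator[of ?t, OF t _ _ u] by blast
  obtain w where w: "poly_op ?t g (Iop p u) = Iop p w" using image by blast
  \<comment> \<open>The powers of \<open>?t\<close> keep the eigenvector on its line, and by
    \<open>corner_cyclic\<close> they span the corner, which is therefore that line.\<close>
  have pow: "(?t ^^ k) (Iop p w) = b ^ k *s Iop p w" for k
    using g(2) w by (induction k) (simp_all add: t)
  have "\<exists>a. Iop p v = a *s Iop p w" for v
  proof -
    have "range (\<lambda>k. (?t ^^ k) (Iop p w)) \<subseteq> span {Iop p w}"
      by (auto simp: pow span_scale span_base)
    then have "span (range (\<lambda>k. (?t ^^ k) (Iop p w))) \<subseteq> span {Iop p w}"
      by (simp add: span_minimal)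
    moreover have "Iop p v \<in> span (range (\<lambda>k. (?t ^^ k) (Iop p w)))"
      using corner_cyclic[OF irr] g(1) w by simp
    ultimately show ?thesis by (auto simp: span_singleton)
  qed
  then have "?t (Iop p v) = b *s Iop p v" for v
    using g(2) w by (metis t(2) scale_left_commute)
  then show ?thesis by blast
qed auto

text \<open>
  Evaluating \<open>IJIJI\<close> in two ways shows that the two corners give the same scalar, unless one of
  \<open>I\<close>, \<open>J\<close> acts as zero, in which case both corners vanish.
\<close>

theorem double_quotient_scalar:
  assumes irr: "E_irreducible"
  shows "\<exists>b. \<forall>p v. IJ p (Iop p v) = b *s Iop p v"
proof -
  obtain b1 where b1: "\<And>v. IJ True (Iop True v) = b1 *s Iop True v"
    using corner_scalar[OF irr] by blast
  obtain b0 where b0: "\<And>v. IJ False (Iop False v) = b0 *s Iop False v"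
    using corner_scalar[OF irr] by blast
  show ?thesis
  proof (cases "(\<forall>v. Iop True v = 0) \<or> (\<forall>v. Iop False v = 0)")
    case True
    then have "\<forall>p v. IJ p (Iop p v) = 0 *s Iop p v"
      by (metis (full_types) scale_zero_left word_op_zero)
    then show ?thesis by blast
  next
    case False
    then obtain v w where v: "Iop True v \<noteq> 0" and w: "Iop False w \<noteq> 0" by blast
    have "(b1 * b1) *s Iop True v = (b0 * b1) *s Iop True v"
    proof -
      have "(b1 * b1) *s Iop True v = IJ True (IJ True (Iop True v))"
        by (simp only: b1 word_op_scale scale_scale)
      also have "\<dots> = Iop True (IJ False (Iop False (Iop True v)))" by simp
      also have "\<dots> = b0 *s IJ True (Iop True v)"
        by (simp only: b0 word_op_scale) simp
      also have "\<dots> = (b0 * b1) *s Iop True v"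
        by (simp only: b1 scale_scale)
      finally show ?thesis .
    qed
    moreover have "(b0 * b0) *s Iop False w = (b1 * b0) *s Iop False w"
    proof -
      have "(b0 * b0) *s Iop False w = IJ False (IJ False (Iop False w))"
        by (simp only: b0 word_op_scale scale_scale)
      also have "\<dots> = Iop False (IJ True (Iop True (Iop False w)))" by simp
      also have "\<dots> = b1 *s IJ False (Iop False w)"
        by (simp only: b1 word_op_scale) simp
      also have "\<dots> = (b1 * b0) *s Iop False w"
        by (simp only: b0 scale_scale)
      finally show ?thesis .
    qed
    ultimately have "b1 * b1 = b0 * b1" "b0 * b0 = b1 * b0"
      using v w scale_right_imp_eq by blast+
    then have "b0 = b1" by auto
    then show ?thesis using b0 b1 by (metis (full_types))
  qed
qed

end

section \<open>The action of the central element\<close>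

text \<open>
  In the application \<open>t = q\<^sup>-\<^sup>1\<close>, \<open>a\<^sub>i\<close> and \<open>b\<^sub>i\<close> are the powers of \<open>q\<close> with exponents
  \<open>\<omega>\<^sub>i\<close> and \<open>- \<omega>\<^sub>i\<close>, and \<open>k\<^sub>i\<close> is the coefficient of the boundary generator in \<open>g\<^sub>0\<close>, \<open>g\<^sub>N\<close>.
\<close>

locale btl_q_action = btl_action scale N E c s1 s2
  for scale :: "complex \<Rightarrow> 'v::ab_group_add \<Rightarrow> 'v" (infixr \<open>*s\<close> 75)
    and N E c s1 s2 +
  fixes q t a1 b1 k1 a2 b2 k2 :: complex
  assumes c_eq: "c = q + t"
    and qt: "q * t = 1"
    and q_neq_t: "q \<noteq> t"
    and ab1: "a1 * b1 = 1" and k1_eq: "k1 = q * a1 - t * b1" and k1_s1: "k1 * s1 = a1 - b1"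
    and ab2: "a2 * b2 = 1" and k2_eq: "k2 = q * a2 - t * b2" and k2_s2: "k2 * s2 = a2 - b2"
    and s1_nonzero: "s1 \<noteq> 0" and s2_nonzero: "s2 \<noteq> 0"
begin

text \<open>
  \<open>gg t i\<close> is \<open>g\<^sub>i\<close> and \<open>gg q i\<close> is its inverse. Everything below that is valid for both is stated
  for a pair of parameters \<open>r\<close>, \<open>r'\<close> that is either \<open>t\<close>, \<open>q\<close> or \<open>q\<close>, \<open>t\<close>.
\<close>

definition gg :: "complex \<Rightarrow> nat \<Rightarrow> 'v \<Rightarrow> 'v"
  where "gg r i v = E i v - r *s v"

definition dual :: "complex \<Rightarrow> complex \<Rightarrow> bool"
  where "dual r r' \<longleftrightarrow> r + r' = c \<and> r * r' = 1"

lemma dual_tq: "dual t q" and dual_qt: "dual q t"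
  unfolding dual_def using c_eq qt by (simp_all add: mult.commute)

lemma E_TL: "1 \<le> i \<Longrightarrow> i < N \<Longrightarrow> j = Suc i \<or> i = Suc j \<Longrightarrow> E i (E j (E i v)) = E i v"
  using E_TL_up E_TL_down by blast

lemma gg_add: "gg r i (v + w) = gg r i v + gg r i w"
  by (simp add: gg_def E_add algebra_simps)

lemma gg_scale: "gg r i (a *s v) = a *s gg r i v"
  by (simp add: gg_def E_scale algebra_simps)

lemma gg_diff: "gg r i (v - w) = gg r i v - gg r i w"
  by (simp add: gg_def E_diff algebra_simps)

lemma gg_inv:
  assumes "dual r r'" "1 \<le> i" "i < N"
  shows "gg r i (gg r' i v) = v"
proof -
  have c: "c = r + r'" and rr: "r * r' = 1" using assms(1) by (auto simp: dual_def)
  show ?thesis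
    by (simp add: gg_def E_diff E_scale E_sq[OF assms(2,3)]) (simp add: c rr algebra_simps)
qed

text \<open>The terms in \<open>E i v\<close> alone have total coefficient
  \<open>1 - r c + r^2\<close>, which vanishes because \<open>r\<close> is a root of
  \<open>X^2 - c X + 1\<close>.\<close>

lemma E_gg_gg:
  assumes "dual r r'" "1 \<le> i" "i < N" "j = Suc i \<or> i = Suc j"
  shows "E i (gg r j (gg r i v)) = - r *s E i (E j v)"
proof -
  have c: "c = r + r'" and rr: "r * r' = 1" using assms(1) by (auto simp: dual_def)
  show ?thesis
    by (simp add: gg_def E_diff E_scale E_sq[OF assms(2,3)] E_TL[OF assms(2-4)])
      (simp add: c rr algebra_simps)
qed

lemma gg_gg_E:
  assumes "dual r r'" "1 \<le> i" "i < N" "j = Suc i \<or> i = Suc j"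
  shows "gg r i (gg r j (E i v)) = - r *s E j (E i v)"
proof -
  have c: "c = r + r'" and rr: "r * r' = 1" using assms(1) by (auto simp: dual_def)
  show ?thesis
    by (simp add: gg_def E_diff E_scale E_sq[OF assms(2,3)] E_TL[OF assms(2-4)])
      (simp add: c rr algebra_simps)
qed

text \<open>Both sides equal \<open>- r *s E i (E j v)\<close>.\<close>

lemma E_gg_gg_swap:
  assumes "dual r r'" "1 \<le> i" "i < N" "1 \<le> j" "j < N" "j = Suc i \<or> i = Suc j"
  shows "E i (gg r j (gg r i v)) = gg r j (gg r i (E j v))"
proof -
  have "i = Suc j \<or> j = Suc i" using assms(6) by blast
  then show ?thesis
    using E_gg_gg[OF assms(1-3,6)] gg_gg_E[OF assms(1,4,5)] by metis
qed

lemma E_gg_far: "Suc i < j \<or> Suc j < i \<Longrightarrow> E i (gg r j v) = gg r j (E i v)"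
  by (simp add: gg_def E_diff E_scale E_far'[of i j])

lemma E_gg_same: "dual r r' \<Longrightarrow> 1 \<le> i \<Longrightarrow> i < N \<Longrightarrow> E i (gg r i v) = r' *s E i v"
  by (simp add: gg_def E_diff E_scale E_sq) (auto simp: dual_def simp flip: scale_left_diff_distrib)

lemma gg_E_same: "dual r r' \<Longrightarrow> 1 \<le> i \<Longrightarrow> i < N \<Longrightarrow> gg r i (E i v) = r' *s E i v"
  by (simp add: gg_def E_sq) (auto simp: dual_def simp flip: scale_left_diff_distrib)

lemma absorb:
  assumes "1 \<le> i" "i < N" "even i = p"
  shows "E i (Iop p v) = c *s Iop p v" "Iop p (E i v) = c *s Iop p v"
  using E_Iop[of i p v] Iop_E[of i p v] assms by (simp_all add: wt_def)

lemma scale_cancel: "a \<noteq> 0 \<Longrightarrow> a *s v = a *s w \<Longrightarrow> v = w"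
  by simp


subsection \<open>Towers\<close>

text \<open>
  The common form of the families \<open>J\<^sub>i\<close>, \<open>J\<^sub>i\<^sup>-\<^sup>1\<close>, and of their factors that involve the left boundary
  only.
\<close>

definition tower :: "complex \<Rightarrow> (nat \<Rightarrow> 'v \<Rightarrow> 'v) \<Rightarrow> bool"
  where "tower r K \<longleftrightarrow> (\<forall>i v. K (Suc i) v = gg r (Suc i) (K i (gg r (Suc i) v)))
    \<and> (\<forall>v w. K 0 (v + w) = K 0 v + K 0 w) \<and> (\<forall>a v. K 0 (a *s v) = a *s K 0 v)
    \<and> (\<forall>k v. 2 \<le> k \<longrightarrow> k < N \<longrightarrow> K 0 (E k v) = E k (K 0 v))"

context
  fixes r r' :: complex and K :: "nat \<Rightarrow> 'v \<Rightarrow> 'v"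
  assumes dual: "dual r r'" and tower: "tower r K"
begin

lemma dual_sum: "c = r + r'" and dual_prod: "r * r' = 1"
  using dual by (auto simp: dual_def)

lemma K_Suc: "K (Suc i) v = gg r (Suc i) (K i (gg r (Suc i) v))"
  using tower by (simp add: tower_def)

lemma K_add: "K i (v + w) = K i v + K i w"
  using tower by (induction i arbitrary: v w) (simp_all add: tower_def gg_add)

lemma K_scale: "K i (a *s v) = a *s K i v"
  using tower by (induction i arbitrary: v) (simp_all add: tower_def gg_scale)

lemma K_diff: "K i (v - w) = K i v - K i w"
  using K_add[of i v "-1 *s w"] K_scale[of i "-1" w] by simp

lemma E_K_far: "Suc (Suc i) \<le> k \<Longrightarrow> k < N \<Longrightarrow> E k (K i v) = K i (E k v)"
proof (induction i arbitrary: v)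
  case 0
  then show ?case using tower by (simp add: tower_def numeral_2_eq_2)
next
  case (Suc i)
  then show ?case by (simp add: K_Suc E_gg_far[of k "Suc i"])
qed

lemma gg_K_far: "Suc (Suc i) \<le> k \<Longrightarrow> k < N \<Longrightarrow> gg x k (K i v) = K i (gg x k v)"
  by (simp add: gg_def K_diff K_scale E_K_far)

text \<open>The generator crosses the two outer factors on one side as
  \<open>E (Suc (Suc i))\<close>, commutes with \<open>K i\<close> in this form, and is turned back
  by the factors on the other side.\<close>

lemma E_K_near:
  assumes "Suc (Suc i) < N"
  shows "E (Suc i) (K (Suc (Suc i)) v) = K (Suc (Suc i)) (E (Suc i) v)"
proof -
  have 1: "E (Suc i) (gg r (Suc (Suc i)) (gg r (Suc i) w))
      = gg r (Suc (Suc i)) (gg r (Suc i) (E (Suc (Suc i)) w))" for w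
    by (rule E_gg_gg_swap[OF dual]) (use assms in auto)
  have 2: "E (Suc (Suc i)) (gg r (Suc i) (gg r (Suc (Suc i)) w))
      = gg r (Suc i) (gg r (Suc (Suc i)) (E (Suc i) w))" for w
    by (rule E_gg_gg_swap[OF dual]) (use assms in auto)
  show ?thesis
    using assms by (simp add: K_Suc 1 2 E_K_far)
qed

lemma K_sandwich:
  assumes "Suc (Suc i) < N"
  shows "E (Suc i) (K (Suc (Suc i)) (E (Suc i) v))
    = (r * r * c) *s E (Suc i) (E (Suc (Suc i)) (K i (E (Suc i) v)))"
proof -
  have 1: "E (Suc i) (gg r (Suc (Suc i)) (gg r (Suc i) w)) = - r *s E (Suc i) (E (Suc (Suc i)) w)" for w
    by (rule E_gg_gg[OF dual]) (use assms in auto)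
  have 2: "gg r (Suc i) (gg r (Suc (Suc i)) (E (Suc i) w)) = - r *s E (Suc (Suc i)) (E (Suc i) w)" for w
    by (rule gg_gg_E[OF dual]) (use assms in auto)
  have "E (Suc i) (K (Suc (Suc i)) (E (Suc i) v))
    = (r * r) *s E (Suc i) (E (Suc (Suc i)) (K i (E (Suc (Suc i)) (E (Suc i) v))))"
    by (simp only: K_Suc 1 2 K_scale E_scale scale_scale) simp
  also have "K i (E (Suc (Suc i)) (E (Suc i) v)) = E (Suc (Suc i)) (K i (E (Suc i) v))"
    using assms by (simp add: E_K_far)
  also have "E (Suc (Suc i)) (E (Suc (Suc i)) w) = c *s E (Suc (Suc i)) w" for w
    using assms E_sq by simp
  finally show ?thesis by (simp add: E_scale)
qed

text \<open>\<open>Iop p\<close> reproduces itself up to the factor \<open>c\<close> under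
  \<open>E (Suc i)\<close>. So a copy of this generator can be drawn out on each side, the sandwich
  identity applied, and the copies reabsorbed. Most corner identities below use this device.\<close>

lemma corner_K_step:
  assumes i: "Suc (Suc i) < N" "even (Suc i) = p"
    and far: "\<And>x. x \<in> set xs \<Longrightarrow> Suc (Suc i) < x \<or> Suc x < Suc i"
  shows "Iop p (word_op xs (K (Suc (Suc i)) (Iop p v)))
    = (r * r * c) *s Iop p (word_op xs (E (Suc (Suc i)) (K i (Iop p v))))"
proof -
  have si: "1 \<le> Suc i" "Suc i < N" using i by auto
  note ab = absorb[OF si i(2)]
  have comm: "word_op xs (E (Suc i) w) = E (Suc i) (word_op xs w)" for w
    by (rule E_word_op_far[symmetric]) (use far in blast)
  have "(c * c) *s Iop p (word_op xs (K (Suc (Suc i)) (Iop p v)))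
    = Iop p (word_op xs (E (Suc i) (K (Suc (Suc i)) (E (Suc i) (Iop p v)))))"
    by (simp add: comm ab K_scale word_op_scale)
  also have "\<dots> = (c * c) *s (r * r * c) *s Iop p (word_op xs (E (Suc (Suc i)) (K i (Iop p v))))"
    by (simp add: K_sandwich[OF i(1)] word_op_scale) (simp add: comm ab K_scale E_scale word_op_scale mult_ac)
  finally show ?thesis
    by (rule scale_cancel[rotated]) (simp add: c_nonzero)
qed

lemma corner_K_up1:
  assumes "Suc i < N" "even (Suc i) = p"
  shows "Iop p (K (Suc i) (Iop p v)) = (r' * r') *s Iop p (K i (Iop p v))"
proof -
  have "gg r (Suc i) (Iop p w) = r' *s Iop p w" for w
    using assms absorb(1)[of "Suc i" p] dual
    by (auto simp: gg_def dual_def simp flip: scale_left_diff_distrib)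
  moreover have "Iop p (gg r (Suc i) w) = r' *s Iop p w" for w
  proof -
    have "Iop p (gg r (Suc i) w) = Iop p (E (Suc i) w) + (- r) *s Iop p w"
      unfolding gg_def using word_op_add[of _ "E (Suc i) w" "(- r) *s w"] by (simp only: word_op_scale) simp
    then show ?thesis
      using assms absorb(2)[of "Suc i" p w] dual
      by (auto simp: dual_def simp flip: scale_left_diff_distrib)
  qed
  ultimately show ?thesis by (simp add: K_Suc K_scale word_op_scale)
qed

text \<open>The generator left behind by \<open>corner_K_step\<close> is removed by the next factor
  of \<open>Iop p\<close> through \<open>e_j e_{j-1} e_j = e_j\<close>. That factor must be
  interior; when \<open>N\<close> has parity \<open>p\<close>, the index \<open>N - 1\<close> is
  therefore left over in the later sums.\<close>

lemma corner_K_up2: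
  assumes "Suc (Suc (Suc i)) < N" "even (Suc i) = p"
  shows "Iop p (K (Suc (Suc i)) (Iop p v)) = (r * r) *s Iop p (K i (Iop p v))"
proof -
  let ?j = "Suc (Suc (Suc i))"
  have j: "1 \<le> ?j" "?j < N" "even ?j = p" using assms by auto
  note ab = absorb[OF j]
  have "(c * c) *s Iop p (E (Suc (Suc i)) (K i (Iop p v)))
      = Iop p (E ?j (E (Suc (Suc i)) (K i (E ?j (Iop p v)))))"
    by (simp add: ab E_scale K_scale word_op_scale)
  also have "K i (E ?j (Iop p v)) = E ?j (K i (Iop p v))"
    using j(2) by (simp add: E_K_far)
  also have "E ?j (E (Suc (Suc i)) (E ?j (K i (Iop p v)))) = E ?j (K i (Iop p v))"
    using j by (intro E_TL) auto
  finally have "c *s c *s Iop p (E (Suc (Suc i)) (K i (Iop p v))) = c *s Iop p (K i (Iop p v))"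
    by (simp add: ab)
  then have "c *s Iop p (E (Suc (Suc i)) (K i (Iop p v))) = Iop p (K i (Iop p v))"
    using c_nonzero scale_cancel by blast
  then show ?thesis
    using corner_K_step[of i p "[]" v] assms by simp (metis scale_scale mult.commute)
qed

text \<open>
  \<open>E\<^sub>i K\<^sub>i\<^sub>-\<^sub>1 E\<^sub>i\<close> is a closed loop around everything to the left or right, which may be slid past a
  neighbouring strand; the next two identities do this in the two directions.
\<close>

lemma loop_down:
  assumes "Suc (Suc i) < N"
  shows "E (Suc (Suc i)) (K (Suc i) (E (Suc (Suc i)) v))
    = E (Suc (Suc i)) (E (Suc i) (K i (E (Suc i) (E (Suc (Suc i)) v))))
      - (r * r * (r' - r)) *s K i (E (Suc (Suc i)) v)"
proof -
  let ?i = "Suc i" and ?j = "Suc (Suc i)"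
  have ij: "1 \<le> ?i" "?i < N" "1 \<le> ?j" "?j < N" using assms by auto
  have TL: "E ?j (E ?i (E ?j w)) = E ?j w" for w using ij E_TL by simp
  have sq: "E ?j (E ?j w) = c *s E ?j w" for w using ij E_sq by simp
  have com: "K i (E ?j w) = E ?j (K i w)" for w using ij E_K_far by simp
  have 1: "E ?j (E ?i (K i (E ?j v))) = K i (E ?j v)" by (simp add: com TL)
  have 2: "E ?j (K i (E ?i (E ?j v))) = K i (E ?j v)" by (simp add: com[symmetric] TL)
  have 3: "E ?j (K i (E ?j v)) = c *s K i (E ?j v)" by (simp add: com sq)
  have "E ?j (K ?i (E ?j v)) = E ?j (E ?i (K i (E ?i (E ?j v)))) - r *s K i (E ?j v)
      - r *s K i (E ?j v) + (r * r) *s c *s K i (E ?j v)"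
    by (simp add: K_Suc gg_def K_diff K_add K_scale E_diff E_add E_scale 1 2 3 algebra_simps)
  also have "\<dots> = E ?j (E ?i (K i (E ?i (E ?j v)))) - (r + r - r * r * c) *s K i (E ?j v)"
    by (simp only: scale_left_distrib scale_left_diff_distrib scale_scale) (simp add: algebra_simps)
  also have "r + r - r * r * c = r * r * (r' - r)"
    using dual_sum dual_prod by Groebner_Basis.algebra
  finally show ?thesis .
qed

lemma loop_up:
  assumes "Suc (Suc i) < N"
  shows "E (Suc i) (K (Suc i) (E (Suc i) v))
    = E (Suc i) (E (Suc (Suc i)) (K (Suc (Suc i)) (E (Suc (Suc i)) (E (Suc i) v))))
      + (r' * r' * (r' - r)) *s K (Suc (Suc i)) (E (Suc i) v)"
proof -
  let ?i = "Suc i" and ?j = "Suc (Suc i)"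
  have ij: "1 \<le> ?i" "?i < N" "1 \<le> ?j" "?j < N" using assms by auto
  have d': "dual r' r" using dual by (auto simp: dual_def algebra_simps)
  have inv: "gg r' ?j (gg r ?j w) = w" "gg r ?j (gg r' ?j w) = w" for w
    using gg_inv[OF d'] gg_inv[OF dual] ij by auto
  have K: "K ?i w = gg r' ?j (K ?j (gg r' ?j w))" for w
    by (simp add: K_Suc[of ?i] inv)
  have sq: "E ?i (E ?i w) = c *s E ?i w" for w using ij E_sq by simp
  have com: "K ?j (E ?i w) = E ?i (K ?j w)" for w using E_K_near[OF assms] by simp
  have TL: "E ?i (E ?j (E ?i w)) = E ?i w" for w using ij E_TL by simp
  have 1: "E ?i (E ?j (K ?j (E ?i v))) = K ?j (E ?i v)" by (simp add: com TL)
  have 2: "E ?i (K ?j (E ?j (E ?i v))) = K ?j (E ?i v)" by (simp add: com[symmetric] TL)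
  have 3: "E ?i (K ?j (E ?i v)) = c *s K ?j (E ?i v)" by (simp add: com sq)
  have "E ?i (K ?i (E ?i v)) = E ?i (E ?j (K ?j (E ?j (E ?i v)))) - r' *s K ?j (E ?i v)
      - r' *s K ?j (E ?i v) + (r' * r') *s c *s K ?j (E ?i v)"
    by (simp add: K gg_def K_diff K_add K_scale E_diff E_add E_scale 1 2 3 algebra_simps)
  also have "\<dots> = E ?i (E ?j (K ?j (E ?j (E ?i v)))) + (r' * r' * c - r' - r') *s K ?j (E ?i v)"
    by (simp only: scale_left_distrib scale_left_diff_distrib scale_scale) (simp add: algebra_simps)
  also have "r' * r' * c - r' - r' = r' * r' * (r' - r)"
    using dual_sum dual_prod by Groebner_Basis.algebra
  finally show ?thesis .
qed

text \<open>Each step lowers the index by two and leaves behind one generator of the parity opposite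
  to \<open>p\<close>. For \<open>l = n\<close> and \<open>N = 2 * n + e + 1\<close> these are all
  the factors of \<open>Iop (\<not> p)\<close> except the leftmost, which can then come from
  \<open>K e\<close>.\<close>

lemma corner_K_chain:
  assumes e: "2 * n + e < N" "even e \<noteq> p" and l: "l \<le> n"
  shows "Iop p (K (2 * n + e) (Iop p v))
    = (r * r * c) ^ l *s Iop p (word_op (map (\<lambda>j. 2 * j + e) [Suc (n - l)..<Suc n])
        (K (2 * (n - l) + e) (Iop p v)))"
  using l
proof (induction l)
  case (Suc l)
  define m where "m = n - Suc l"
  have nl: "n - l = Suc m" using Suc.prems by (simp add: m_def)
  define i where "i = 2 * m + e"
  define xs where "xs = map (\<lambda>j. 2 * j + e) [Suc (Suc m)..<Suc n]"
  have far: "Suc (Suc i) < x" if "x \<in> set xs" for x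
    using that by (auto simp: i_def xs_def)
  have "Iop p (word_op xs (K (Suc (Suc i)) (Iop p v)))
    = (r * r * c) *s Iop p (word_op xs (E (Suc (Suc i)) (K i (Iop p v))))"
    by (rule corner_K_step) (use far e nl in \<open>auto simp: i_def\<close>)
  also have "word_op xs (E (Suc (Suc i)) w) = word_op (map (\<lambda>j. 2 * j + e) [Suc m..<Suc n]) w" for w
  proof -
    have "Suc (Suc (Suc i)) < x \<or> Suc x < Suc (Suc i)" if "x \<in> set xs" for x
      using that by (auto simp: i_def xs_def)
    then have "word_op xs (E (Suc (Suc i)) w) = E (Suc (Suc i)) (word_op xs w)"
      by (simp add: E_word_op_far)
    also have "[Suc m..<Suc n] = Suc m # [Suc (Suc m)..<Suc n]"
      using nl Suc.prems by (intro upt_conv_Cons) auto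
    ultimately show ?thesis by (simp add: i_def xs_def)
  qed
  finally have step: "Iop p (word_op xs (K (Suc (Suc i)) (Iop p v))) = (r * r * c) *s
    Iop p (word_op (map (\<lambda>j. 2 * j + e) [Suc m..<Suc n]) (K i (Iop p v)))" .
  have "2 * Suc m + e = Suc (Suc i)" by (simp add: i_def)
  then have "Iop p (K (2 * n + e) (Iop p v))
      = (r * r * c) ^ l *s Iop p (word_op xs (K (Suc (Suc i)) (Iop p v)))"
    using Suc.IH[OF Suc_leD[OF Suc.prems]] unfolding nl xs_def by metis
  then show ?case
    unfolding step m_def[symmetric] i_def[symmetric] by (simp only: power_Suc2 scale_scale)
qed simp

end

text \<open>This evaluates the terms in which \<open>K e\<close> does not supply the missing
  leftmost factor: the relations \<open>e_j e_{j+1} e_j = e_j\<close> then undo the word letter by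
  letter.\<close>

lemma corner_word_collapse:
  assumes e: "2 * n + e < N" "even e \<noteq> p" and l: "l \<le> n"
  shows "c ^ l *s Iop p (word_op (map (\<lambda>j. 2 * j + e) [Suc (n - l)..<Suc n]) (Iop p v)) = Iop p (Iop p v)"
  using l
proof (induction l)
  case (Suc l)
  define m where "m = n - Suc l"
  have nl: "n - l = Suc m" using Suc.prems by (simp add: m_def)
  define i where "i = 2 * m + e"
  define xs where "xs = map (\<lambda>j. 2 * j + e) [Suc (Suc m)..<Suc n]"
  have i: "1 \<le> Suc i" "Suc i < N" "even (Suc i) = p" "Suc (Suc i) < N"
    using e Suc.prems by (auto simp: i_def m_def)
  note ab = absorb[OF i(1-3)]
  have "Suc (Suc i) < x \<or> Suc x < Suc i" if "x \<in> set xs" for x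
    using that by (auto simp: i_def xs_def)
  then have com: "E (Suc i) (word_op xs w) = word_op xs (E (Suc i) w)" for w
    by (rule E_word_op_far)
  have up: "map (\<lambda>j. 2 * j + e) [Suc m..<Suc n] = Suc (Suc i) # xs"
    using nl Suc.prems by (subst upt_conv_Cons) (auto simp: i_def xs_def)
  have "(c * c) *s Iop p (E (Suc (Suc i)) (word_op xs (Iop p v)))
    = Iop p (E (Suc i) (E (Suc (Suc i)) (word_op xs (E (Suc i) (Iop p v)))))"
    by (simp add: ab E_scale word_op_scale)
  also have "\<dots> = Iop p (E (Suc i) (word_op xs (Iop p v)))"
    using i by (simp add: com[symmetric] E_TL)
  finally have "c *s c *s Iop p (E (Suc (Suc i)) (word_op xs (Iop p v)))
      = c *s Iop p (word_op xs (Iop p v))"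
    by (simp add: ab)
  then have "c *s Iop p (E (Suc (Suc i)) (word_op xs (Iop p v))) = Iop p (word_op xs (Iop p v))"
    using c_nonzero scale_cancel by blast
  then have "c ^ Suc l *s Iop p (word_op (map (\<lambda>j. 2 * j + e) [Suc m..<Suc n]) (Iop p v))
    = c ^ l *s Iop p (word_op xs (Iop p v))"
    by (simp only: up foldr.simps comp_apply power_Suc2 flip: scale_scale)
  also have "\<dots> = Iop p (Iop p v)" using Suc nl by (simp add: xs_def)
  finally show ?case by (simp add: m_def)
qed simp

section \<open>Braid relation and boundary relations\<close>

lemma braid:
  assumes "dual r r'" "1 \<le> i" "i < N" "1 \<le> j" "j < N" "j = Suc i \<or> i = Suc j"
  shows "gg r i (gg r j (gg r i v)) = gg r j (gg r i (gg r j v))"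
proof -
  have "gg r i (gg r j (gg r i v)) = gg r j (gg r i (E j v)) - r *s gg r j (gg r i v)"
    by (subst gg_def) (simp only: E_gg_gg_swap[OF assms])
  also have "\<dots> = gg r j (gg r i (E j v - r *s v))"
    by (simp only: gg_diff gg_scale)
  also have "E j v - r *s v = gg r j v"
    by (simp only: gg_def)
  finally show ?thesis .
qed

text \<open>It serves both boundaries, with \<open>P\<close> either \<open>E 0\<close> or a
  conjugate of \<open>E N\<close>. The relations between \<open>a\<close>, \<open>b\<close>,
  \<open>k\<close> and \<open>s\<close> make the coefficient of \<open>E i (P v)\<close> vanish, and
  the coefficient of \<open>E i v\<close> is \<open>a (q a - k) = t a b = t\<close>.\<close>

lemma blob_relation:
  assumes "1 \<le> i" "i < N"
    and P: "\<And>v w. P (v - w) = P v - P w" "\<And>x v. P (x *s v) = x *s P v"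
      "\<And>v. P (P v) = s *s P v" "\<And>v. E i (P (E i v)) = E i v"
    and ab: "a * b = 1" and k: "k = q * a - t * b" and ks: "k * s = a - b"
    and X: "\<And>v. X v = a *s v - k *s P v"
  shows "E i (X (gg t i (X v))) = t *s E i v"
proof -
  have "E i (X (gg t i (X v))) = (a * a * c - a * k - t * a * a) *s E i v
    + ((k * k - a * k * c - t * k * k * s) *s E i (P v) + ((t * a * k) *s E i (P v) + (t * a * k) *s E i (P v)))"
    by (simp add: X gg_def P E_diff E_scale E_sq[OF assms(1,2)] scale_left_distrib scale_left_diff_distrib
        scale_right_distrib scale_right_diff_distrib)
      (simp add: algebra_simps)
  also have "\<dots> = (a * a * c - a * k - t * a * a) *s E i v
    + (k * k - a * k * c - t * k * k * s + (t * a * k + t * a * k)) *s E i (P v)"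
    by (simp only: scale_left_distrib)
  also have "a * a * c - a * k - t * a * a = t"
    using ab k c_eq by Groebner_Basis.algebra
  also have "k * k - a * k * c - t * k * k * s + (t * a * k + t * a * k) = 0"
    using ab k c_eq ks by Groebner_Basis.algebra
  finally show ?thesis by simp
qed

primrec tow :: "complex \<Rightarrow> ('v \<Rightarrow> 'v) \<Rightarrow> nat \<Rightarrow> 'v \<Rightarrow> 'v" where
  "tow r B 0 v = B v"
| "tow r B (Suc i) v = gg r (Suc i) (tow r B i (gg r (Suc i) v))"

lemma tower_tow:
  assumes "\<And>v w. B (v + w) = B v + B w" "\<And>a v. B (a *s v) = a *s B v"
    "\<And>k v. 2 \<le> k \<Longrightarrow> k < N \<Longrightarrow> B (E k v) = E k (B v)"
  shows "tower r (tow r B)"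
  using assms by (simp add: tower_def)

text \<open>\<open>bd0 a1 k1\<close> is \<open>g\<^sub>0\<close>, and its inverse is \<open>bd0 b1 (- k1)\<close>.\<close>

definition bd0 :: "complex \<Rightarrow> complex \<Rightarrow> 'v \<Rightarrow> 'v"
  where "bd0 a k v = a *s v - k *s E 0 v"

lemma bd0_add: "bd0 a k (v + w) = bd0 a k v + bd0 a k w"
  by (simp add: bd0_def E_add algebra_simps)

lemma bd0_scale: "bd0 a k (x *s v) = x *s bd0 a k v"
  by (simp add: bd0_def E_scale algebra_simps)

lemma bd0_far: "2 \<le> i \<Longrightarrow> bd0 a k (E i v) = E i (bd0 a k v)"
  by (simp add: bd0_def E_diff E_scale E_far'[of 0 i])

lemma tower_bd0: "tower r (tow r (bd0 a k))"
  by (rule tower_tow) (simp_all add: bd0_add bd0_scale bd0_far)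

lemma bd0_inv: "bd0 a1 k1 (bd0 b1 (- k1) v) = v" "bd0 b1 (- k1) (bd0 a1 k1 v) = v"
proof -
  have 1: "a1 * k1 - k1 * b1 - k1 * k1 * s1 = 0" using k1_s1 by Groebner_Basis.algebra
  have "bd0 a1 k1 (bd0 b1 (- k1) v) = (a1 * b1) *s v + (a1 * k1 - k1 * b1 - k1 * k1 * s1) *s E 0 v"
    by (simp add: bd0_def E_add E_scale E_sq_left scale_left_distrib scale_left_diff_distrib)
      (simp add: algebra_simps)
  then show "bd0 a1 k1 (bd0 b1 (- k1) v) = v" by (simp add: 1 ab1)
  have "bd0 b1 (- k1) (bd0 a1 k1 v) = (a1 * b1) *s v + (a1 * k1 - k1 * b1 - k1 * k1 * s1) *s E 0 v"
    by (simp add: bd0_def E_diff E_scale E_sq_left scale_left_distrib scale_left_diff_distrib)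
      (simp add: algebra_simps)
  then show "bd0 b1 (- k1) (bd0 a1 k1 v) = v" by (simp add: 1 ab1)
qed


subsection \<open>Conjugates of the right boundary generator\<close>

text \<open>
  \<open>P i\<close> is \<open>e\<^sub>N\<close> conjugated by \<open>g\<^sub>N\<^sub>-\<^sub>1 \<cdots> g\<^sub>i\<^sub>+\<^sub>1\<close>, and \<open>T i\<close> below is the same conjugate of \<open>g\<^sub>N\<close>.
  \<open>Pd\<close> counts from the right end to make the recursion primitive.
\<close>

primrec Pd :: "nat \<Rightarrow> 'v \<Rightarrow> 'v" where
  "Pd 0 v = E N v"
| "Pd (Suc k) v = gg q (N - 1 - k) (Pd k (gg t (N - 1 - k) v))"

definition P :: "nat \<Rightarrow> 'v \<Rightarrow> 'v"
  where "P i = Pd (N - 1 - i)"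

lemma P_last: "P (N - 1) v = E N v"
  by (simp add: P_def)

lemma P_step:
  assumes "Suc i < N"
  shows "P i v = gg q (Suc i) (P (Suc i) (gg t (Suc i) v))"
proof -
  have "N - 1 - i = Suc (N - 1 - Suc i)" "N - 1 - (N - 1 - Suc i) = Suc i" using assms by auto
  then show ?thesis by (simp only: P_def Pd.simps)
qed

lemma P_induct [consumes 1, case_names last step]:
  assumes "i < N" "Q (N - 1)" "\<And>n. Suc n < N \<Longrightarrow> Q (Suc n) \<Longrightarrow> Q n"
  shows "Q i"
  using assms by (intro inc_induct[of i "N - 1" Q]) auto

lemma P_add: "P i (v + w) = P i v + P i w"
proof -
  have "Pd k (v + w) = Pd k v + Pd k w" for k
    by (induction k arbitrary: v w) (simp_all add: E_add gg_add)
  then show ?thesis by (simp add: P_def)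
qed

lemma P_scale: "P i (a *s v) = a *s P i v"
proof -
  have "Pd k (a *s v) = a *s Pd k v" for k
    by (induction k arbitrary: v) (simp_all add: E_scale gg_scale)
  then show ?thesis by (simp add: P_def)
qed

lemma P_diff: "P i (v - w) = P i v - P i w"
  using P_add[of i v "-1 *s w"] P_scale[of i "-1" w] by simp

lemma gg_tq: "1 \<le> i \<Longrightarrow> i < N \<Longrightarrow> gg t i (gg q i v) = v"
  and gg_qt: "1 \<le> i \<Longrightarrow> i < N \<Longrightarrow> gg q i (gg t i v) = v"
  using gg_inv[OF dual_tq] gg_inv[OF dual_qt] by auto

lemma P_sq: "i < N \<Longrightarrow> P i (P i v) = s2 *s P i v"
proof (induction arbitrary: v rule: P_induct)
  case last
  show ?case by (simp only: P_last E_sq_right)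
next
  case (step n)
  then show ?case by (simp add: P_step gg_tq gg_scale)
qed

lemma E_P_near: "i < N \<Longrightarrow> k < i \<Longrightarrow> E k (P i v) = P i (E k v)"
proof (induction arbitrary: v rule: P_induct)
  case last
  then show ?case by (auto simp: P_last[simplified] intro!: E_far)
next
  case (step n)
  then show ?case by (simp add: P_step E_gg_far[of k "Suc n"])
qed

text \<open>At \<open>k = i + 2\<close> the generator crosses two conjugating factors as
  \<open>E (i + 1)\<close>, which is distant from everything in the remaining conjugate
  \<open>P (i + 2)\<close>. Larger \<open>k\<close> reduce to this by commutation.\<close>

lemma E_P_far: "i < N \<Longrightarrow> Suc (Suc i) \<le> k \<Longrightarrow> k < N \<Longrightarrow> E k (P i v) = P i (E k v)"
proof (induction arbitrary: v rule: P_induct)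
  case (step n)
  show ?case
  proof (cases "k = Suc (Suc n)")
    case False
    then show ?thesis using step by (simp add: P_step E_gg_far[of k "Suc n"])
  next
    case True
    have n: "Suc n < N" "Suc (Suc n) < N" using step True by auto
    have 1: "E (Suc (Suc n)) (gg q (Suc n) (gg q (Suc (Suc n)) w))
        = gg q (Suc n) (gg q (Suc (Suc n)) (E (Suc n) w))" for w
      by (rule E_gg_gg_swap[OF dual_qt]) (use n in auto)
    have 2: "E (Suc n) (gg t (Suc (Suc n)) (gg t (Suc n) w))
        = gg t (Suc (Suc n)) (gg t (Suc n) (E (Suc (Suc n)) w))" for w
      by (rule E_gg_gg_swap[OF dual_tq]) (use n in auto)
    show ?thesis
      using n by (simp add: True P_step 1 2 E_P_near)
  qed
qed simp

lemma gg_P_near: "i < N \<Longrightarrow> k < i \<Longrightarrow> gg r k (P i v) = P i (gg r k v)"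
  by (simp add: gg_def P_diff P_scale E_P_near)

text \<open>By \<open>E_gg_gg\<close>, each outer conjugating factor at \<open>i + 1\<close> next to
  \<open>E i\<close> is traded for \<open>E (i + 1)\<close> and a factor at \<open>i\<close>. The
  two factors at \<open>i\<close> are mutually inverse and commute with \<open>P (i + 1)\<close>, so
  they cancel. This is the hypothesis of \<open>blob_relation\<close> at the right boundary.\<close>

lemma E_P_E: "i < N \<Longrightarrow> 1 \<le> i \<Longrightarrow> E i (P i (E i v)) = E i v"
proof (induction arbitrary: v rule: P_induct)
  case last
  then show ?case using N_ge_2 by (simp add: P_last[simplified] E_TL)
next
  case (step n)
  let ?i = n and ?j = "Suc n"
  have ij: "1 \<le> ?i" "?i < N" "1 \<le> ?j" "?j < N" using step by auto
  have 1: "E ?i (gg q ?j w) = - q *s E ?i (E ?j (gg t ?i w))" for w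
    using E_gg_gg[OF dual_qt ij(1,2), of ?j "gg t ?i w"] ij gg_qt by simp
  have 2: "gg t ?j (E ?i w) = - t *s gg q ?i (E ?j (E ?i w))" for w
    using arg_cong[OF gg_gg_E[OF dual_tq ij(1,2), of ?j w], of "gg q ?i"] ij gg_qt
    by (simp add: gg_scale[of _ _ "- t", simplified])
  have "E ?i (P ?i (E ?i v)) = (q * t) *s E ?i (E ?j (P ?j (E ?j (E ?i v))))"
    using ij by (simp add: P_step 1 2 P_scale[of _ "- t", simplified] gg_scale[of _ _ "- t", simplified]
        E_scale[of _ "- t", simplified] gg_P_near gg_tq)
  also have "\<dots> = E ?i v"
    using step ij by (simp add: qt E_TL)
  finally show ?case .
qed

lemma P_sandwich:
  assumes "Suc (Suc i) < N"
  shows "E (Suc (Suc i)) (P i (E (Suc (Suc i)) v))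
    = c *s E (Suc (Suc i)) (E (Suc i) (P (Suc (Suc i)) (E (Suc (Suc i)) v)))"
proof -
  let ?i = "Suc i" and ?j = "Suc (Suc i)"
  have ij: "1 \<le> ?i" "?i < N" "1 \<le> ?j" "?j < N" using assms by auto
  have 1: "E ?j (gg q ?i (gg q ?j w)) = - q *s E ?j (E ?i w)" for w
    by (rule E_gg_gg[OF dual_qt]) (use ij in auto)
  have 2: "gg t ?j (gg t ?i (E ?j w)) = - t *s E ?i (E ?j w)" for w
    by (rule gg_gg_E[OF dual_tq]) (use ij in auto)
  have com: "P ?j (E ?i w) = E ?i (P ?j w)" for w using E_P_near ij by simp
  have "E ?j (P i (E ?j v)) = (q * t) *s E ?j (E ?i (E ?i (P ?j (E ?j v))))"
    using ij by (simp add: P_step[of i] P_step[of ?i] 1 2 P_scale[of _ "- t", simplified]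
        E_scale[of _ "- t", simplified] com)
  also have "\<dots> = c *s E ?j (E ?i (P ?j (E ?j v)))"
    using ij by (simp add: qt E_sq E_scale)
  finally show ?thesis .
qed

lemma corner_P_step:
  assumes i: "Suc (Suc i) < N" "even i = p"
    and far: "\<And>x. x \<in> set xs \<Longrightarrow> Suc x < Suc (Suc i)"
  shows "Iop p (word_op xs (P i (Iop p v)))
    = c *s Iop p (word_op xs (E (Suc i) (P (Suc (Suc i)) (Iop p v))))"
proof -
  have si: "1 \<le> Suc (Suc i)" "Suc (Suc i) < N" "even (Suc (Suc i)) = p" using i by auto
  note ab = absorb[OF si]
  have comm: "word_op xs (E (Suc (Suc i)) w) = E (Suc (Suc i)) (word_op xs w)" for w
    by (rule E_word_op_far[symmetric]) (use far in blast)
  have "(c * c) *s Iop p (word_op xs (P i (Iop p v)))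
    = Iop p (word_op xs (E (Suc (Suc i)) (P i (E (Suc (Suc i)) (Iop p v)))))"
    by (simp add: comm ab P_scale word_op_scale)
  also have "\<dots> = (c * c) *s c *s Iop p (word_op xs (E (Suc i) (P (Suc (Suc i)) (Iop p v))))"
    by (simp add: P_sandwich[OF i(1)] word_op_scale) (simp add: comm ab P_scale E_scale word_op_scale mult_ac)
  finally show ?thesis by (rule scale_cancel[rotated]) (simp add: c_nonzero)
qed

text \<open>These generators accumulate while \<open>P e\<close> is moved to the right into
  \<open>P (2 * n + e)\<close>. Once that is \<open>P (N - 1) = E N\<close>, it completes them to
  the product of the other parity.\<close>

definition below :: "nat \<Rightarrow> nat \<Rightarrow> nat list"
  where "below e n = filter (\<lambda>i. even i \<noteq> even e) [0..<2 * n + e]"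

lemma below_Suc: "below e (Suc n) = below e n @ [Suc (2 * n + e)]"
  by (simp add: below_def)

lemma sites_below: "N = Suc (2 * n + e) \<Longrightarrow> sites (odd e) = below e n @ [N]"
proof -
  assume N: "N = Suc (2 * n + e)"
  have "[0..<N + 1] = [0..<2 * n + e] @ [2 * n + e, N]" unfolding N by simp
  then show ?thesis unfolding below_def sites_def by (simp add: N)
qed

lemma corner_P_chain:
  "2 * n + e < N \<Longrightarrow> even e = p \<Longrightarrow> Iop p (word_op (below e 0) (P e (Iop p v)))
    = c ^ n *s Iop p (word_op (below e n) (P (2 * n + e) (Iop p v)))"
proof (induction n)
  case (Suc n)
  have "Iop p (word_op (below e n) (P (2 * n + e) (Iop p v)))
    = c *s Iop p (word_op (below e n) (E (Suc (2 * n + e)) (P (Suc (Suc (2 * n + e))) (Iop p v))))"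
    by (rule corner_P_step) (use Suc.prems in \<open>auto simp: below_def\<close>)
  then show ?case using Suc by (simp add: below_Suc mult_ac)
qed simp

lemma corner_below_collapse:
  "2 * n + e < N \<Longrightarrow> even e = p \<Longrightarrow>
    c ^ n *s Iop p (word_op (below e n) (Iop p v)) = Iop p (word_op (below e 0) (Iop p v))"
proof (induction n)
  case (Suc n)
  let ?j = "Suc (Suc (2 * n + e))"
  have j: "1 \<le> ?j" "?j < N" "even ?j = p" using Suc.prems by auto
  note ab = absorb[OF j]
  have com: "E ?j (word_op (below e n) w) = word_op (below e n) (E ?j w)" for w
    by (rule E_word_op_far) (auto simp: below_def)
  have "(c * c) *s Iop p (word_op (below e (Suc n)) (Iop p v))
    = Iop p (E ?j (word_op (below e n) (E (Suc (2 * n + e)) (E ?j (Iop p v)))))"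
    by (simp add: below_Suc ab E_scale word_op_scale)
  also have "\<dots> = Iop p (word_op (below e n) (E ?j (E (Suc (2 * n + e)) (E ?j (Iop p v)))))"
    by (simp only: com)
  also have "E ?j (E (Suc (2 * n + e)) (E ?j (Iop p v))) = E ?j (Iop p v)"
    using j by (intro E_TL) auto
  also have "Iop p (word_op (below e n) (E ?j (Iop p v))) = c *s Iop p (word_op (below e n) (Iop p v))"
    by (simp add: ab word_op_scale)
  finally have "c *s c *s Iop p (word_op (below e (Suc n)) (Iop p v))
    = c *s Iop p (word_op (below e n) (Iop p v))" by simp
  then have "c *s Iop p (word_op (below e (Suc n)) (Iop p v)) = Iop p (word_op (below e n) (Iop p v))"
    using c_nonzero scale_cancel by blast
  then show ?case using Suc by (simp only: power_Suc2 flip: scale_scale) simp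
qed simp


subsection \<open>The Jucys-Murphy elements\<close>

text \<open>
  \<open>J i = T i \<circ> X i\<close>, where \<open>T i\<close> involves only the generators to the right of site \<open>i\<close>, and \<open>X i\<close>
  only those with index at most \<open>i\<close>. A trailing \<open>i\<close> in a name marks the inverse.
\<close>

definition T :: "nat \<Rightarrow> 'v \<Rightarrow> 'v"
  where "T i v = a2 *s v - k2 *s P i v"

definition Ti :: "nat \<Rightarrow> 'v \<Rightarrow> 'v"
  where "Ti i v = b2 *s v + k2 *s P i v"

definition J :: "nat \<Rightarrow> 'v \<Rightarrow> 'v"
  where "J = tow t (\<lambda>v. T 0 (bd0 a1 k1 v))"

definition Ji :: "nat \<Rightarrow> 'v \<Rightarrow> 'v"
  where "Ji = tow q (\<lambda>v. bd0 b1 (- k1) (Ti 0 v))"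

definition X :: "nat \<Rightarrow> 'v \<Rightarrow> 'v"
  where "X = tow t (bd0 a1 k1)"

definition Xi :: "nat \<Rightarrow> 'v \<Rightarrow> 'v"
  where "Xi = tow q (bd0 b1 (- k1))"

lemma T_add: "T i (v + w) = T i v + T i w" and Ti_add: "Ti i (v + w) = Ti i v + Ti i w"
  by (simp_all add: T_def Ti_def P_add algebra_simps)

lemma T_scale: "T i (x *s v) = x *s T i v" and Ti_scale: "Ti i (x *s v) = x *s Ti i v"
  by (simp_all add: T_def Ti_def P_scale algebra_simps)

lemma T_inv:
  assumes "i < N"
  shows "T i (Ti i v) = v" "Ti i (T i v) = v"
proof -
  have 1: "a2 * k2 - k2 * b2 - k2 * k2 * s2 = 0" using k2_s2 by Groebner_Basis.algebra
  have "T i (Ti i v) = (a2 * b2) *s v + (a2 * k2 - k2 * b2 - k2 * k2 * s2) *s P i v"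
    by (simp add: T_def Ti_def P_add P_scale P_sq[OF assms] scale_left_distrib scale_left_diff_distrib)
      (simp add: algebra_simps)
  then show "T i (Ti i v) = v" by (simp add: 1 ab2)
  have "Ti i (T i v) = (a2 * b2) *s v + (a2 * k2 - k2 * b2 - k2 * k2 * s2) *s P i v"
    by (simp add: T_def Ti_def P_diff P_scale P_sq[OF assms] scale_left_distrib scale_left_diff_distrib)
      (simp add: algebra_simps)
  then show "Ti i (T i v) = v" by (simp add: 1 ab2)
qed

lemma E_T: "i < N \<Longrightarrow> k < i \<or> Suc (Suc i) \<le> k \<and> k < N \<Longrightarrow> E k (T i v) = T i (E k v)"
  and E_Ti: "i < N \<Longrightarrow> k < i \<or> Suc (Suc i) \<le> k \<and> k < N \<Longrightarrow> E k (Ti i v) = Ti i (E k v)"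
  using E_P_near E_P_far by (auto simp: T_def Ti_def E_diff E_add E_scale)

lemma T_step: "Suc i < N \<Longrightarrow> T i v = gg q (Suc i) (T (Suc i) (gg t (Suc i) v))"
  and Ti_step: "Suc i < N \<Longrightarrow> Ti i v = gg q (Suc i) (Ti (Suc i) (gg t (Suc i) v))"
  by (simp_all add: T_def Ti_def P_step gg_diff gg_add gg_scale gg_qt)

lemma tower_J: "tower t J"
  unfolding J_def by (rule tower_tow) (use N_ge_2 in \<open>simp_all add: T_add T_scale bd0_add bd0_scale bd0_far E_T\<close>)

lemma tower_Ji: "tower q Ji"
  unfolding Ji_def by (rule tower_tow) (use N_ge_2 in \<open>simp_all add: Ti_add Ti_scale bd0_add bd0_scale flip: bd0_far E_Ti\<close>)

lemma tower_X: "tower t X" and tower_Xi: "tower q Xi"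
  by (simp_all add: X_def Xi_def tower_bd0)

lemma J_0: "J 0 v = T 0 (bd0 a1 k1 v)" and Ji_0: "Ji 0 v = bd0 b1 (- k1) (Ti 0 v)"
  by (simp_all add: J_def Ji_def)

lemma J_Suc: "J (Suc i) v = gg t (Suc i) (J i (gg t (Suc i) v))"
  and Ji_Suc: "Ji (Suc i) v = gg q (Suc i) (Ji i (gg q (Suc i) v))"
  by (simp_all add: J_def Ji_def)

lemma J_inv: "i < N \<Longrightarrow> J i (Ji i v) = v" "i < N \<Longrightarrow> Ji i (J i v) = v"
  using N_ge_2 by (induction i arbitrary: v)
    (auto simp: J_0 Ji_0 J_Suc Ji_Suc T_inv bd0_inv gg_tq gg_qt)

text \<open>Conjugating \<open>T i\<close> by the factor at \<open>i + 1\<close> shortens it to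
  \<open>T (i + 1)\<close>, so the tower over \<open>T 0\<close> and \<open>g_0\<close> becomes a
  tower over \<open>g_0\<close> with \<open>T i\<close> in front.\<close>

lemma J_eq_T_X: "i < N \<Longrightarrow> J i v = T i (X i v)"
proof (induction i arbitrary: v)
  case (Suc i)
  then show ?case using T_step[of i] by (simp add: J_Suc X_def gg_tq)
qed (simp add: J_0 X_def)

lemma Ji_eq_Xi_Ti: "i < N \<Longrightarrow> Ji i v = Xi i (Ti i v)"
proof (induction i arbitrary: v)
  case (Suc i)
  then show ?case using Ti_step[of i] by (simp add: Ji_Suc Xi_def gg_tq)
qed (simp add: Ji_0 Xi_def)

text \<open>Write \<open>J 0\<close> as \<open>g_1^-1 T_1 g_1 g_0\<close>. The inner factors at site
  1 cancel and \<open>T_1\<close> commutes with \<open>g_0\<close>, so the blob relation applies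
  once for \<open>T_1\<close> and once for \<open>g_0\<close>. Each gives a factor \<open>t\<close>;
  the third comes from \<open>E 1\<close> absorbing \<open>g_1^-1\<close>.\<close>

lemma JgJ_base: "E 1 (J 0 (gg t 1 (J 0 v))) = t ^ 3 *s E 1 v"
proof -
  have N: "1 \<le> (1::nat)" "1 < N" using N_ge_2 by auto
  have T0: "T 0 w = gg q 1 (T 1 (gg t 1 w))" for w using T_step[of 0] N by simp
  have 1: "E 1 (gg q 1 w) = t *s E 1 w" for w using E_gg_same[OF dual_qt N] .
  have 2: "bd0 a1 k1 (T 1 w) = T 1 (bd0 a1 k1 w)" for w
    using E_T[of 1 0] N by (simp add: bd0_def T_def P_diff P_scale E_diff E_scale E_P_near algebra_simps)
  have 3: "E 1 (T 1 (gg t 1 (T 1 w))) = t *s E 1 w" for w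
    by (rule blob_relation[OF N _ _ _ _ ab2 k2_eq k2_s2, where P = "P 1"])
      (use N in \<open>simp_all add: P_diff P_scale P_sq E_P_E[of 1, simplified] T_def\<close>)
  have 4: "E 1 (bd0 a1 k1 (gg t 1 (bd0 a1 k1 w))) = t *s E 1 w" for w
    by (rule blob_relation[OF N _ _ _ _ ab1 k1_eq k1_s1, where P = "E 0"])
      (use N in \<open>simp_all add: E_diff E_scale E_sq_left E_TL[of 1, simplified] bd0_def\<close>)
  show ?thesis
    by (simp add: J_0 T0 1[simplified] gg_tq[of 1, simplified N, simplified] 2[simplified] 3[simplified] 4[simplified] power3_eq_cube)
qed

text \<open>The braid relation brings the product for \<open>i\<close> into the middle of that for
  \<open>i + 1\<close>. The pairs of factors around it contribute \<open>- t\<close> each, so every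
  step adds two to the exponent.\<close>

lemma JgJ: "Suc i < N \<Longrightarrow> E (Suc i) (J i (gg t (Suc i) (J i v))) = t ^ (3 + 2 * i) *s E (Suc i) v"
proof (induction i arbitrary: v)
  case 0
  then show ?case using JgJ_base by simp
next
  case (Suc i)
  let ?j = "Suc i" and ?l = "Suc (Suc i)"
  have N: "1 \<le> ?j" "?j < N" "1 \<le> ?l" "?l < N" using Suc.prems by auto
  have br: "gg t ?j (gg t ?l (gg t ?j w)) = gg t ?l (gg t ?j (gg t ?l w))" for w
    by (rule braid[OF dual_tq N]) simp
  have com: "J i (gg t ?l w) = gg t ?l (J i w)" for w
    using gg_K_far[OF dual_tq tower_J] N by simp
  have 1: "E ?l (gg t ?j (gg t ?l w)) = - t *s E ?l (E ?j w)" for w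
    by (rule E_gg_gg[OF dual_tq]) (use N in auto)
  have 2: "E ?j (gg t ?l (gg t ?j w)) = - t *s E ?j (E ?l w)" for w
    by (rule E_gg_gg[OF dual_tq]) (use N in auto)
  have "E ?l (J ?j (gg t ?l (J ?j v)))
      = E ?l (gg t ?j (J i (gg t ?l (gg t ?j (gg t ?l (J i (gg t ?j v)))))))"
    by (simp only: J_Suc br)
  also have "gg t ?l (J i (gg t ?j v)) = J i (gg t ?l (gg t ?j v))"
    by (simp only: com)
  also have "J i (gg t ?l w) = gg t ?l (J i w)" for w
    by (rule com)
  also have "E ?l (gg t ?j (gg t ?l (J i (gg t ?j (J i (gg t ?l (gg t ?j v)))))))
      = (t * t * t ^ (3 + 2 * i)) *s E ?l (E ?j (E ?l v))"
    by (simp only: 1 2 Suc.IH[OF N(2)] E_scale scale_scale) (simp add: mult_ac)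
  also have "t * t * t ^ (3 + 2 * i) = t ^ (3 + 2 * ?j)"
    by (simp add: eval_nat_numeral mult_ac)
  finally show ?case using N by (simp add: E_TL)
qed

text \<open>\<open>JgJ\<close> is solved for the inverse: \<open>J_i E\<close> is written as
  \<open>J_i g J_i\<close> applied to \<open>J_i^-1 g^-1 E\<close>, and the last factor
  \<open>g^-1\<close> is absorbed by \<open>E\<close>.\<close>

lemma E_Ji_E:
  assumes "Suc i < N"
  shows "E (Suc i) (Ji i (E (Suc i) v)) = q ^ (4 + 2 * i) *s E (Suc i) (J i (E (Suc i) v))"
proof -
  let ?j = "Suc i"
  have N: "1 \<le> ?j" "?j < N" using assms by auto
  have "E ?j (J i (E ?j v)) = E ?j (J i (gg t ?j (J i (Ji i (gg q ?j (E ?j v))))))"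
    using N by (simp add: J_inv gg_tq)
  also have "\<dots> = t ^ (3 + 2 * i) *s E ?j (Ji i (gg q ?j (E ?j v)))"
    by (rule JgJ[OF assms])
  also have "gg q ?j (E ?j v) = t *s E ?j v"
    using gg_E_same[OF dual_qt N] .
  finally have "E ?j (J i (E ?j v)) = t ^ (4 + 2 * i) *s E ?j (Ji i (E ?j v))"
    using K_scale[OF dual_qt tower_Ji] by (simp add: E_scale eval_nat_numeral mult_ac)
  then show ?thesis
    by (simp add: qt flip: power_mult_distrib)
qed


subsection \<open>The central element on the corner\<close>

definition wts :: "nat list \<Rightarrow> complex"
  where "wts xs = prod_list (map wt xs)"

lemma wts_append [simp]: "wts (xs @ ys) = wts xs * wts ys" and wts_Nil [simp]: "wts [] = 1"
  and wts_Cons [simp]: "wts (x # xs) = wt x * wts xs"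
  by (simp_all add: wts_def)

lemma wts_odd: "2 * m \<le> N \<Longrightarrow> wts (filter odd [0..<2 * m]) = c ^ m"
  by (induction m) (auto simp: wt_def)

lemma wts_even: "2 * m < N \<Longrightarrow> wts (filter even [0..<Suc (2 * m)]) = s1 * c ^ m"
  by (induction m) (auto simp: wt_def)

lemma wts_sites:
  "N = 2 * m \<Longrightarrow> wts (sites False) = c ^ m"
  "N = Suc (2 * m) \<Longrightarrow> wts (sites False) = c ^ m * s2"
  "N = Suc (2 * m) \<Longrightarrow> wts (sites True) = s1 * c ^ m"
  "N = Suc (Suc (2 * m)) \<Longrightarrow> wts (sites True) = s1 * c ^ m * s2"
proof -
  assume N: "N = 2 * m"
  have "sites False = filter odd [0..<2 * m]" using N unfolding sites_def by simp
  then show "wts (sites False) = c ^ m" using wts_odd N by simp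
next
  assume N: "N = Suc (2 * m)"
  have "sites False = filter odd [0..<2 * m] @ [N]" using N unfolding sites_def by simp
  moreover have "wts (filter odd [0..<2 * m]) = c ^ m" using wts_odd[of m] N by simp
  ultimately show "wts (sites False) = c ^ m * s2" using N_ge_2 by (simp add: wt_def)
  have "sites True = filter even [0..<Suc (2 * m)]" using N unfolding sites_def by simp
  then show "wts (sites True) = s1 * c ^ m" using wts_even[of m] N by simp
next
  assume N: "N = Suc (Suc (2 * m))"
  have "sites True = filter even [0..<Suc (2 * m)] @ [N]" using N unfolding sites_def by simp
  moreover have "wts (filter even [0..<Suc (2 * m)]) = s1 * c ^ m" using wts_even[of m] N by simp
  ultimately show "wts (sites True) = s1 * c ^ m * s2" using N_ge_2 by (simp add: wt_def)
qed

lemma wts_nonzero: "wts xs \<noteq> 0"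
  using s1_nonzero s2_nonzero c_nonzero by (induction xs) (auto simp: wt_def)

lemma Iop_Iop: "Iop p (Iop p v) = wts (sites p) *s Iop p v"
proof -
  have "set xs \<subseteq> set (sites p) \<Longrightarrow> word_op xs (Iop p v) = wts xs *s Iop p v" for xs
    by (induction xs) (auto simp: set_sites E_scale E_Iop mult_ac)
  then show ?thesis by blast
qed

lemma sites_map:
  "N = Suc (2 * n) \<Longrightarrow> sites True = map (\<lambda>j. 2 * j) [0..<Suc n]"
  "N = Suc (Suc (2 * n)) \<Longrightarrow> sites False = map (\<lambda>j. 2 * j + 1) [0..<Suc n]"
proof -
  have 0: "filter even [0..<Suc (Suc (2 * n))] = map (\<lambda>j. 2 * j) [0..<Suc n]" for n
    by (induction n) auto
  have 1: "filter odd [0..<Suc (Suc (Suc (2 * n)))] = map (\<lambda>j. 2 * j + 1) [0..<Suc n]" for n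
    by (induction n) auto
  show "N = Suc (2 * n) \<Longrightarrow> sites True = map (\<lambda>j. 2 * j) [0..<Suc n]"
    using 0[of n] unfolding sites_def by simp
  show "N = Suc (Suc (2 * n)) \<Longrightarrow> sites False = map (\<lambda>j. 2 * j + 1) [0..<Suc n]"
    using 1[of n] unfolding sites_def by simp
qed

section \<open>Summing \<open>J_i\<close> and its inverse between two factors of
  \<open>I\<close>\<close>

abbreviation JJ :: "bool \<Rightarrow> 'v \<Rightarrow> nat \<Rightarrow> 'v"
  where "JJ p v i \<equiv> Iop p (J i (Iop p v)) + Iop p (Ji i (Iop p v))"

lemma corner_K_pairs:
  assumes "dual r r'" "tower r K" "even (Suc e) = p" "Suc (2 * k + e) < N"
  shows "Iop p (K (2 * k + e) (Iop p v)) = r ^ (2 * k) *s Iop p (K e (Iop p v))"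
    and "Iop p (K (Suc (2 * k + e)) (Iop p v)) = (r' ^ 2 * r ^ (2 * k)) *s Iop p (K e (Iop p v))"
proof -
  have "Suc (2 * k + e) < N \<Longrightarrow> Iop p (K (2 * k + e) (Iop p v)) = r ^ (2 * k) *s Iop p (K e (Iop p v))"
  proof (induction k)
    case (Suc k)
    then have "Iop p (K (2 * Suc k + e) (Iop p v)) = (r * r) *s Iop p (K (2 * k + e) (Iop p v))"
      using corner_K_up2[OF assms(1,2), of "2 * k + e" p v] assms(3) by simp
    then show ?case using Suc by (simp add: mult_ac)
  qed simp
  then show 1: "Iop p (K (2 * k + e) (Iop p v)) = r ^ (2 * k) *s Iop p (K e (Iop p v))"
    using assms(4) .
  show "Iop p (K (Suc (2 * k + e)) (Iop p v)) = (r' ^ 2 * r ^ (2 * k)) *s Iop p (K e (Iop p v))"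
    using corner_K_up1[OF assms(1,2,4), of p v] assms(3) by (simp add: 1 power2_eq_square)
qed

lemma corner_Ji:
  assumes "Suc e < N" "even (Suc e) = p"
  shows "Iop p (Ji e (Iop p v)) = q ^ (4 + 2 * e) *s Iop p (J e (Iop p v))"
proof -
  have e: "1 \<le> Suc e" "Suc e < N" "even (Suc e) = p" using assms by auto
  note ab = absorb[OF e]
  have "(c * c) *s Iop p (Ji e (Iop p v)) = Iop p (E (Suc e) (Ji e (E (Suc e) (Iop p v))))"
    using K_scale[OF dual_qt tower_Ji] by (simp add: ab word_op_scale)
  also have "\<dots> = (c * c) *s q ^ (4 + 2 * e) *s Iop p (J e (Iop p v))"
    unfolding E_Ji_E[OF assms(1)] using K_scale[OF dual_tq tower_J]
    by (simp add: ab word_op_scale E_scale mult_ac)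
  finally show ?thesis by (rule scale_cancel[rotated]) (simp add: c_nonzero)
qed

text \<open>Interior sites of parity \<open>p\<close> group the indices in pairs. The sum starts at
  \<open>e = 0\<close> for \<open>I_1\<close> and at \<open>e = 1\<close> for \<open>I_2\<close>;
  the factor \<open>q - t\<close> turns the geometric sum into a difference of its end
  terms.\<close>

lemma sum_pairs:
  assumes "even (Suc e) = p" "Suc e < N"
  shows "2 * m + e \<le> N \<Longrightarrow> (q - t) *s (\<Sum>i\<in>{e..<2 * m + e}. JJ p v i)
    = (q ^ (2 + e) * c * (q ^ (2 * m + e) - t ^ (2 * m + e) - (q ^ e - t ^ e))) *s Iop p (J e (Iop p v))"
proof (induction m)
  case (Suc m)
  have N: "Suc (2 * m + e) < N" using Suc.prems by simp
  note J = corner_K_pairs[OF dual_tq tower_J assms(1) N, of v]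
    and Ji = corner_K_pairs[OF dual_qt tower_Ji assms(1) N, of v]
  let ?x = "Iop p (J e (Iop p v))"
  have new: "JJ p v (2 * m + e) + JJ p v (Suc (2 * m + e))
      = ((1 + q ^ 2) * t ^ (2 * m) + (1 + t ^ 2) * q ^ (2 * m) * q ^ (4 + 2 * e)) *s ?x"
    unfolding J Ji corner_Ji[OF assms(2,1)] by (simp add: algebra_simps)
  have "{e..<2 * Suc m + e} = {e..<2 * m + e} \<union> {2 * m + e, Suc (2 * m + e)}" by auto
  then have split: "(\<Sum>i\<in>{e..<2 * Suc m + e}. JJ p v i)
      = (\<Sum>i\<in>{e..<2 * m + e}. JJ p v i) + (JJ p v (2 * m + e) + JJ p v (Suc (2 * m + e)))"
    by (simp add: algebra_simps)
  have "(q - t) *s (\<Sum>i\<in>{e..<2 * Suc m + e}. JJ p v i)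
      = (q ^ (2 + e) * c * (q ^ (2 * m + e) - t ^ (2 * m + e) - (q ^ e - t ^ e))
        + (q - t) * ((1 + q ^ 2) * t ^ (2 * m) + (1 + t ^ 2) * q ^ (2 * m) * q ^ (4 + 2 * e))) *s ?x"
  proof -
    define S x where "S = (\<Sum>i\<in>{e..<2 * m + e}. JJ p v i)" and "x = ?x"
    have IH: "(q - t) *s S = (q ^ (2 + e) * c * (q ^ (2 * m + e) - t ^ (2 * m + e) - (q ^ e - t ^ e))) *s x"
      using Suc unfolding S_def x_def by simp
    show ?thesis
      unfolding split new S_def[symmetric] x_def[symmetric]
      by (simp only: scale_right_distrib IH scale_scale scale_left_distrib)
        (simp add: distrib_left scale_left_distrib)
  qed
  also have "q ^ (2 + e) * c * (q ^ (2 * m + e) - t ^ (2 * m + e) - (q ^ e - t ^ e))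
        + (q - t) * ((1 + q ^ 2) * t ^ (2 * m) + (1 + t ^ 2) * q ^ (2 * m) * q ^ (4 + 2 * e))
      = q ^ (2 + e) * c * (q ^ (2 * Suc m + e) - t ^ (2 * Suc m + e) - (q ^ e - t ^ e))"
  proof -
    \<comment> \<open>Powers with symbolic exponents become unknowns with
      \<open>A B = u w = 1\<close>, so that a polynomial identity remains.\<close>
    define A B u w where "A = q ^ (2 * m)" and "B = t ^ (2 * m)" and "u = q ^ e" and "w = t ^ e"
    have AB: "A * B = 1" "u * w = 1"
      by (simp_all add: A_def B_def u_def w_def qt flip: power_mult_distrib)
    have p: "q ^ (2 + e) = q * q * u" "q ^ (2 * m + e) = A * u" "t ^ (2 * m + e) = B * w"
      "q ^ (4 + 2 * e) = q * q * q * q * u * u" "q ^ (2 * Suc m + e) = q * q * A * u"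
      "t ^ (2 * Suc m + e) = t * t * B * w" "q ^ 2 = q * q" "t ^ 2 = t * t"
      "q ^ (2 * m) = A" "t ^ (2 * m) = B" "q ^ e = u" "t ^ e = w"
      by (simp_all add: A_def B_def u_def w_def power_add eval_nat_numeral mult_ac power_mult_distrib)
    show ?thesis unfolding p using AB qt c_eq by Groebner_Basis.algebra
  qed
  finally show ?case .
qed simp

text \<open>\<open>T (N - 1)\<close> is \<open>g_N\<close>, which \<open>Iop p\<close> absorbs as a
  scalar because it contains \<open>E N\<close>; only the left boundary remains.\<close>

lemma corner_J_last:
  assumes "even N = p"
  shows "Iop p (J (N - 1) (Iop p v)) = b2 *s Iop p (X (N - 1) (Iop p v))"
    and "Iop p (Ji (N - 1) (Iop p v)) = a2 *s Iop p (Xi (N - 1) (Iop p v))"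
proof -
  have ab: "E N (Iop p w) = s2 *s Iop p w" "Iop p (E N w) = s2 *s Iop p w" for w
    using E_Iop[of N p w] Iop_E[of N p w] assms N_ge_2 by (simp_all add: wt_def)
  have b2: "a2 - k2 * s2 = b2" "b2 + k2 * s2 = a2" using k2_s2 by simp_all
  have N: "N - 1 < N" using N_ge_2 by simp
  have "Iop p (T (N - 1) w) = b2 *s Iop p w" for w
    using word_op_add[of "sites p" "a2 *s w" "(- k2) *s E N w"]
    by (simp only: T_def P_last word_op_scale ab scale_scale flip: scale_left_distrib)
      (simp add: b2)
  then show "Iop p (J (N - 1) (Iop p v)) = b2 *s Iop p (X (N - 1) (Iop p v))"
    using J_eq_T_X[OF N] by simp
  have "Ti (N - 1) (Iop p v) = a2 *s Iop p v"
    by (simp only: Ti_def P_last ab scale_scale flip: scale_left_distrib) (simp add: b2)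
  then show "Iop p (Ji (N - 1) (Iop p v)) = a2 *s Iop p (Xi (N - 1) (Iop p v))"
    using Ji_eq_Xi_Ti[OF N] K_scale[OF dual_qt tower_Xi] by (simp add: word_op_scale)
qed

lemma word_op_diff: "word_op xs (v - w) = word_op xs v - word_op xs w"
  using word_op_add[of xs v "-1 *s w"] word_op_scale[of xs "-1" w] by simp

lemma bd0_Iop: "Iop True (bd0 a k v) = (a - k * s1) *s Iop True v" "bd0 a k (Iop True v) = (a - k * s1) *s Iop True v"
proof -
  have ab: "E 0 (Iop True w) = s1 *s Iop True w" "Iop True (E 0 w) = s1 *s Iop True w" for w
    using E_Iop[of 0 True w] Iop_E[of 0 True w] by (simp_all add: wt_def)
  show "Iop True (bd0 a k v) = (a - k * s1) *s Iop True v"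
    by (simp add: bd0_def word_op_diff word_op_scale ab scale_left_diff_distrib)
  show "bd0 a k (Iop True v) = (a - k * s1) *s Iop True v"
    by (simp add: bd0_def ab scale_left_diff_distrib)
qed

text \<open>\<open>Iop True\<close> contains \<open>E 0\<close> and absorbs \<open>g_0\<close> and
  its inverse as \<open>b1\<close> and \<open>a1\<close>; only the right boundary remains.\<close>

lemma corner_S0:
  "JJ True v 0 = (a1 * b2 + a2 * b1) *s Iop True (Iop True v)
    + (k2 * (a1 - b1)) *s Iop True (P 0 (Iop True v))"
proof -
  have 1: "a1 - k1 * s1 = b1" "b1 - - k1 * s1 = a1" using k1_s1 by auto
  have "Iop True (J 0 (Iop True v)) = b1 *s Iop True (T 0 (Iop True v))"
    by (simp only: J_0 bd0_Iop 1 T_scale word_op_scale)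
  moreover have "Iop True (Ji 0 (Iop True v)) = a1 *s Iop True (Ti 0 (Iop True v))"
    by (simp only: Ji_0 bd0_Iop 1)
  ultimately show ?thesis
    by (simp add: T_def Ti_def word_op_add word_op_diff word_op_scale algebra_simps)
qed

text \<open>\<open>loop_down\<close> at the left end gives one equation for \<open>J\<close> and one
  for its inverse. Their loop terms around \<open>E 1\<close> are proportional by
  \<open>E_Ji_E\<close>, and eliminating them links index 1 with index 0.\<close>

lemma corner_S0_J1:
  assumes "2 < N"
  shows "(q ^ 3 * c) *s Iop True (J 1 (Iop True v)) = JJ True v 0"
proof -
  have N: "1 \<le> (2::nat)" "2 < N" "even (2::nat) = True" "Suc (Suc 0) < N" using assms by auto
  note ab = absorb[OF N(1-3)]
  let ?A = "Iop True (E 1 (J 0 (E 1 (Iop True v))))"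
  have sand: "(c * c) *s Iop True (K 1 (Iop True v)) = (c * c) *s Iop True (E 1 (K 0 (E 1 (Iop True v))))
      - (r * r * (r' - r) * c) *s Iop True (K 0 (Iop True v))"
    if K: "dual r r'" "tower r K" for r r' K
  proof -
    have "E 2 (K 1 (E 2 (Iop True v))) = E 2 (E 1 (K 0 (E 1 (E 2 (Iop True v)))))
      - (r * r * (r' - r)) *s K 0 (E 2 (Iop True v))"
      using loop_down[OF K N(4), of "Iop True v"] by (simp add: numeral_2_eq_2)
    from arg_cong[OF this, of "Iop True"] show ?thesis
      by (simp add: ab E_scale K_scale[OF K] word_op_scale word_op_diff mult_ac)
  qed
  have link: "Iop True (E 1 (Ji 0 (E 1 (Iop True v)))) = q ^ 4 *s ?A"
    using E_Ji_E[of 0 "Iop True v"] N by (simp add: word_op_scale)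
  have J1: "Iop True (Ji 1 (Iop True v)) = q ^ 6 *s Iop True (J 1 (Iop True v))"
    using corner_Ji[of 1 True v] N by (simp add: numeral_2_eq_2)
  let ?x = "Iop True (J 1 (Iop True v))" and ?y = "Iop True (J 0 (Iop True v))"
    and ?z = "Iop True (Ji 0 (Iop True v))"
  have e1: "(c * c) *s ?A = (c * c) *s ?x + (t * t * (q - t) * c) *s ?y"
    using sand[OF dual_tq tower_J] by simp
  have e2: "(c * c * q ^ 6) *s ?x = (q ^ 4) *s (c * c) *s ?A + (q * q * (q - t) * c) *s ?z"
    using sand[OF dual_qt tower_Ji] unfolding link J1 by (simp add: algebra_simps)
  have "(c * c * q ^ 6 - q ^ 4 * c * c) *s ?x = (q ^ 4 * t * t * (q - t) * c) *s ?y + (q * q * (q - t) * c) *s ?z"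
    using e2 unfolding e1 by (simp add: algebra_simps)
  moreover have "c * c * q ^ 6 - q ^ 4 * c * c = (q * q * (q - t) * c) * (q ^ 3 * c)"
    using qt by Groebner_Basis.algebra
  moreover have "q ^ 4 * t * t * (q - t) * c = q * q * (q - t) * c"
    using qt by Groebner_Basis.algebra
  ultimately have "(q * q * (q - t) * c) *s (q ^ 3 * c) *s ?x = (q * q * (q - t) * c) *s (?y + ?z)"
    by (simp add: scale_right_distrib)
  then show ?thesis
    by (rule scale_cancel[rotated]) (use c_nonzero q_neq_t qt in auto)
qed

text \<open>Index 0 is unpaired; by \<open>corner_S0_J1\<close> it supplies exactly the term
  \<open>q - t\<close> that the geometric sum over the pairs lacks.\<close>

lemma corner_odd_S0:
  assumes N: "N = Suc (2 * m)"
  shows "(q - t) *s (\<Sum>i<N. JJ True v i) = (q ^ N - t ^ N) *s JJ True v 0"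
proof -
  have m: "2 * m + 1 \<le> N" "Suc 1 < N" "0 < N" "2 < N" using N N_ge_2 by auto
  have "{..<N} = insert 0 {1..<2 * m + 1}" using m N by auto
  then have "(\<Sum>i<N. JJ True v i) = JJ True v 0 + (\<Sum>i\<in>{1..<2 * m + 1}. JJ True v i)"
    by simp
  then have "(q - t) *s (\<Sum>i<N. JJ True v i) = (q - t) *s JJ True v 0
    + (q ^ N - t ^ N - (q - t)) *s (q ^ 3 * c) *s Iop True (J 1 (Iop True v))"
    using sum_pairs[of 1 True m v] m by (simp add: N scale_right_distrib mult_ac)
  then show ?thesis
    unfolding corner_S0_J1[OF m(4)] by (simp add: scale_left_diff_distrib)
qed

lemma corner_even_S0:
  assumes N: "N = Suc (Suc (2 * k))"
  shows "(q - t) *s (\<Sum>i<N. JJ True v i)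
    = (q ^ (N - 1) - t ^ (N - 1)) *s JJ True v 0 + (q - t) *s JJ True v (N - 1)"
proof -
  have "{..<N} = insert (N - 1) (insert 0 {1..<2 * k + 1})" using N by auto
  then have "(\<Sum>i<N. JJ True v i) = JJ True v (N - 1) + (JJ True v 0 + (\<Sum>i\<in>{1..<2 * k + 1}. JJ True v i))"
    using N by simp
  moreover have "(q - t) *s (JJ True v 0 + (\<Sum>i\<in>{1..<2 * k + 1}. JJ True v i))
    = (q ^ (N - 1) - t ^ (N - 1)) *s JJ True v 0"
  proof (cases "k = 0")
    case False
    have k: "2 * k + 1 \<le> N" "Suc 1 < N" "2 < N" using N False by auto
    have "(q - t) *s (JJ True v 0 + (\<Sum>i\<in>{1..<2 * k + 1}. JJ True v i)) = (q - t) *s JJ True v 0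
      + (q ^ (N - 1) - t ^ (N - 1) - (q - t)) *s (q ^ 3 * c) *s Iop True (J 1 (Iop True v))"
      using sum_pairs[of 1 True k v] k by (simp add: N scale_right_distrib mult_ac)
    then show ?thesis
      unfolding corner_S0_J1[OF k(3)] by (simp add: scale_left_diff_distrib)
  qed (simp add: N)
  ultimately show ?thesis by (simp add: scale_right_distrib add.commute)
qed

lemma corner_even_J0:
  assumes N: "N = 2 * m"
  shows "(q - t) *s (\<Sum>i<N. JJ False v i) = (q ^ N - t ^ N) *s (q * q * c) *s Iop False (J 0 (Iop False v))"
  using sum_pairs[of 0 False m v] N N_ge_2 by (simp add: lessThan_atLeast0 mult_ac power2_eq_square)

text \<open>The counterpart of \<open>corner_S0_J1\<close> at the right end: \<open>loop_up\<close>
  is used for \<open>J\<close> and for its inverse, and the common loop term around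
  \<open>E (N - 1)\<close> is eliminated.\<close>

lemma corner_odd_J_last:
  assumes N: "N = Suc (2 * Suc m)"
  shows "(q - t) *s (\<Sum>i<N. JJ False v i) = (q ^ N - t ^ N) *s
    (q ^ (N - 1) *s Iop False (J (N - 1) (Iop False v)) + t ^ (N - 1) *s Iop False (Ji (N - 1) (Iop False v)))"
proof -
  let ?i = "Suc (2 * m)" and ?l = "Suc (Suc (2 * m))"
  have i: "1 \<le> ?i" "?i < N" "even ?i = False" "?l < N" using N by auto
  note ab = absorb[OF i(1-3)]
  have sand: "(c * c) *s Iop False (K ?i (Iop False v)) = Iop False (E ?i (E ?l (K ?l (E ?l (E ?i (Iop False v))))))
      + (r' * r' * (r' - r) * c) *s Iop False (K ?l (Iop False v))"
    if K: "dual r r'" "tower r K" for r r' K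
  proof -
    from arg_cong[OF loop_up[OF K i(4), of "Iop False v"], of "Iop False"] show ?thesis
      by (simp add: ab E_scale K_scale[OF K] word_op_scale word_op_add)
  qed
  define x y z where "x = Iop False (J 0 (Iop False v))"
    and "y = Iop False (J ?l (Iop False v))" and "z = Iop False (Ji ?l (Iop False v))"
  define B where "B = Iop False (E ?i (E ?l (J ?l (E ?l (E ?i (Iop False v))))))"
  define Q R where "Q = q ^ (2 * m)" and "R = t ^ (2 * m)"
  have QR: "Q * R = 1" by (simp add: Q_def R_def qt flip: power_mult_distrib)
  have Jx: "Iop False (J ?i (Iop False v)) = (q * q * R) *s x"
    using corner_K_pairs(2)[OF dual_tq tower_J, of 0 False m v] i by (simp add: R_def x_def power2_eq_square)
  have Jix: "Iop False (Ji ?i (Iop False v)) = (t * t * Q * q ^ 4) *s x"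
    using corner_K_pairs(2)[OF dual_qt tower_Ji, of 0 False m v] corner_Ji[of 0 False v] i
    by (simp add: Q_def x_def power2_eq_square)
  have link: "E ?l (Ji ?l (E ?l w)) = (q * q * Q * Q) *s E ?l (J ?l (E ?l w))" for w
  proof -
    have l: "1 \<le> ?l" "?l < N" using i by auto
    have 1: "E ?l (J ?l (E ?l w)) = (q * q) *s E ?l (J ?i (E ?l w))"
      using l by (simp add: J_Suc[of ?i] gg_E_same[OF dual_tq] E_gg_same[OF dual_tq] K_scale[OF dual_tq tower_J] E_scale)
    have "E ?l (Ji ?l (E ?l w)) = (t * t) *s E ?l (Ji ?i (E ?l w))"
      using l by (simp add: Ji_Suc[of ?i] gg_E_same[OF dual_qt] E_gg_same[OF dual_qt] K_scale[OF dual_qt tower_Ji] E_scale)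
    also have "E ?l (Ji ?i (E ?l w)) = q ^ (4 + 2 * ?i) *s E ?l (J ?i (E ?l w))"
      by (rule E_Ji_E) (use i in simp)
    also have "(t * t) *s q ^ (4 + 2 * ?i) *s u = (q * q * Q * Q) *s (q * q) *s u" for u
    proof -
      have "q ^ (4 + 2 * ?i) = q * q * q * q * q * q * Q * Q"
        by (simp add: Q_def power_add power_mult_distrib power2_eq_square eval_nat_numeral power_mult)
      then have "t * t * q ^ (4 + 2 * ?i) = t * t * (q * q * q * q * q * q * Q * Q)" by simp
      also have "\<dots> = q * q * Q * Q * (q * q)" using qt by Groebner_Basis.algebra
      finally have "t * t * q ^ (4 + 2 * ?i) = q * q * Q * Q * (q * q)" .
      then show ?thesis by simp
    qed
    finally show ?thesis unfolding 1 .
  qed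
  have e1: "B = (c * c * q * q * R) *s x - (q * q * (q - t) * c) *s y"
    using sand[OF dual_tq tower_J] unfolding Jx by (simp add: B_def y_def mult_ac)
  have "Iop False (E ?i (E ?l (Ji ?l (E ?l (E ?i (Iop False v)))))) = (q * q * Q * Q) *s B"
    by (simp add: link B_def E_scale word_op_scale)
  then have e2: "(c * c * t * t * Q * q ^ 4) *s x = (q * q * Q * Q) *s B + (t * t * (t - q) * c) *s z"
    using sand[OF dual_qt tower_Ji] unfolding Jix by (simp add: z_def mult_ac)
  have eq: "(c * c * t * t * Q * q ^ 4 - q * q * Q * Q * (c * c * q * q * R)) *s x
      = (t * t * (t - q) * c) *s z - (q * q * Q * Q * (q * q * (q - t) * c)) *s y"
    using e2 unfolding e1 by (simp add: algebra_simps)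
  have "c * c * t * t * Q * q ^ 4 - q * q * Q * Q * (c * c * q * q * R) = - ((q - t) * c * (c * q ^ 3 * Q))"
    "t * t * (t - q) * c = - ((q - t) * c * (t * t))"
    "q * q * Q * Q * (q * q * (q - t) * c) = (q - t) * c * (q ^ 4 * Q * Q)"
    using QR qt by Groebner_Basis.algebra+
  then have "((q - t) * c) *s (c * q ^ 3 * Q) *s x
      = ((q - t) * c) *s ((q ^ 4 * Q * Q) *s y + (t * t) *s z)"
    using arg_cong[OF eq, of uminus] by (simp only: scale_right_distrib scale_minus_left scale_scale) simp
  then have "(c * q ^ 3 * Q) *s x = (q ^ 4 * Q * Q) *s y + (t * t) *s z"
    by (rule scale_cancel[rotated]) (use c_nonzero q_neq_t qt QR in auto)
  then have "(t * R) *s (c * q ^ 3 * Q) *s x = (t * R) *s ((q ^ 4 * Q * Q) *s y + (t * t) *s z)"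
    by simp
  moreover have "t * R * (c * q ^ 3 * Q) = q * q * c" "t * R * (q ^ 4 * Q * Q) = q ^ 3 * Q"
    using QR qt by Groebner_Basis.algebra+
  \<comment> \<open>Here \<open>q ^ 3 * Q\<close> is \<open>q ^ N\<close> and
    \<open>t * R * (t * t)\<close> is \<open>t ^ N\<close>.\<close>
  ultimately have x: "(q * q * c) *s x = (q ^ 3 * Q) *s y + (t * R * (t * t)) *s z"
    by (simp add: scale_right_distrib)
  have "{..<N} = insert ?l {0..<2 * Suc m + 0}" using N by auto
  then have "(\<Sum>i<N. JJ False v i) = (\<Sum>i\<in>{0..<2 * Suc m + 0}. JJ False v i) + (y + z)"
    by (simp add: y_def z_def)
  moreover have "(q - t) *s (\<Sum>i\<in>{0..<2 * Suc m + 0}. JJ False v i)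
      = (q * q * Q - t * t * R) *s (q * q * c) *s x"
    using sum_pairs[of 0 False "Suc m" v] N
    by (simp add: x_def Q_def R_def power2_eq_square mult_ac)
  ultimately have "(q - t) *s (\<Sum>i<N. JJ False v i)
      = (q * q * Q - t * t * R) *s ((q ^ 3 * Q) *s y + (t * R * (t * t)) *s z) + (q - t) *s (y + z)"
    by (simp only: x scale_right_distrib[of "q - t" "\<Sum>i\<in>{0..<2 * Suc m + 0}. JJ False v i"])
  also have "\<dots> = ((q * q * Q - t * t * R) * (q ^ 3 * Q) + (q - t)) *s y
      + ((q * q * Q - t * t * R) * (t * R * (t * t)) + (q - t)) *s z"
    by (simp only: scale_right_distrib scale_left_distrib scale_scale) (simp add: algebra_simps)
  also have "(q * q * Q - t * t * R) * (q ^ 3 * Q) + (q - t) = (q ^ 3 * Q - t ^ 3 * R) * (q * q * Q)"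
    using QR qt by Groebner_Basis.algebra
  also have "(q * q * Q - t * t * R) * (t * R * (t * t)) + (q - t) = (q ^ 3 * Q - t ^ 3 * R) * (t * t * R)"
    using QR qt by Groebner_Basis.algebra
  finally have "(q - t) *s (\<Sum>i<N. JJ False v i)
      = (q ^ 3 * Q - t ^ 3 * R) *s ((q * q * Q) *s y + (t * t * R) *s z)"
    by (simp only: scale_right_distrib scale_scale)
  moreover have "q ^ N = q ^ 3 * Q" "t ^ N = t ^ 3 * R" "q ^ (N - 1) = q * q * Q" "t ^ (N - 1) = t * t * R"
    "N - 1 = ?l"
    by (simp_all add: N Q_def R_def eval_nat_numeral mult_ac)
  ultimately show ?thesis by (simp only: y_def z_def)
qed

section \<open>Evaluation of the end terms\<close>

lemma corner_P0_odd:
  assumes N: "N = Suc (2 * m)"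
  shows "Iop True (P 0 (Iop True v)) = c ^ m *s IJ True (Iop True v)"
proof -
  have "2 * m = N - 1" using N by simp
  then have "P (2 * m) w = E N w" for w using P_last by simp
  moreover have "sites False = below 0 m @ [N]" using sites_below[of m 0] N by simp
  ultimately show ?thesis
    using corner_P_chain[of m 0 True v] N by (simp add: below_def)
qed

text \<open>Expanding \<open>J 0\<close> between two copies of \<open>E 1\<close> leaves a single
  term in which both boundaries survive. There \<open>E 0\<close> and \<open>P 1\<close> start the
  chain that builds \<open>I_2\<close>.\<close>

lemma corner_J0_even:
  assumes N: "N = Suc (Suc (2 * k))"
  shows "(q * q * c) *s Iop False (J 0 (Iop False v)) = (q * a1 * a2 + t * b1 * b2) *s Iop False (Iop False v)
    - (k1 * k2 * c ^ Suc k) *s IJ False (Iop False v)"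
proof -
  have i: "1 \<le> (1::nat)" "1 < N" "even (1::nat) = False" using N by auto
  note ab = absorb[OF i]
  have TL: "E 1 (E 0 (E 1 w)) = E 1 w" for w using E_TL[of 1 0] i by simp
  have sq: "E 1 (E 1 w) = c *s E 1 w" for w using E_sq i by simp
  have P0: "E 1 (P 0 w) = t *s E 1 (P 1 (gg t 1 w))" for w
    using P_step[of 0] E_gg_same[OF dual_qt i(1,2)] i by simp
  have g: "gg t 1 (bd0 a1 k1 (E 1 w)) = (t * b1) *s E 1 w + (t * k1) *s E 0 (E 1 w)" for w
  proof -
    have "gg t 1 (bd0 a1 k1 (E 1 w)) = (a1 * c - k1 - t * a1) *s E 1 w + (t * k1) *s E 0 (E 1 w)"
      by (simp add: gg_def bd0_def E_diff E_scale sq[simplified] TL[simplified] scale_left_diff_distrib)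
        (simp add: algebra_simps)
    also have "a1 * c - k1 - t * a1 = t * b1" using c_eq k1_eq by Groebner_Basis.algebra
    finally show ?thesis .
  qed
  let ?w = "Iop False v"
  have PE: "E 1 (P 1 (E 1 w)) = E 1 w" for w using E_P_E[of 1] i by simp
  have "E 1 (J 0 (E 1 ?w)) = (a2 * (a1 * c - k1) - k2 * t * t * b1) *s E 1 ?w
      - (k1 * k2 * t * t) *s E 1 (P 1 (E 0 (E 1 ?w)))"
  proof -
    have X1: "E 1 (bd0 a1 k1 (E 1 ?w)) = (a1 * c - k1) *s E 1 ?w"
      by (simp add: bd0_def E_diff E_scale sq[simplified] TL[simplified] scale_left_diff_distrib)
    have X2: "E 1 (P 0 (bd0 a1 k1 (E 1 ?w))) = (t * t * b1) *s E 1 ?w + (t * t * k1) *s E 1 (P 1 (E 0 (E 1 ?w)))"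
      unfolding P0 g by (simp add: P_add P_scale E_add E_scale PE[simplified] algebra_simps)
    show ?thesis
      unfolding J_0 T_def E_diff E_scale X1 X2 by (simp add: algebra_simps)
  qed
  from arg_cong[OF this, of "Iop False"]
  have "(c * c) *s Iop False (J 0 ?w) = (c * (a2 * (a1 * c - k1) - k2 * t * t * b1)) *s Iop False ?w
      - (c * c * (k1 * k2 * t * t)) *s Iop False (P 1 (E 0 ?w))"
    by (simp add: ab ab[simplified] E_scale P_scale K_scale[OF dual_tq tower_J] word_op_scale word_op_diff mult_ac)
  also have "Iop False (P 1 (E 0 ?w)) = Iop False (word_op (below 1 0) (P 1 ?w))"
    using i by (simp add: below_def E_P_near)
  also have "\<dots> = c ^ k *s Iop False (word_op (below 1 k) (P (2 * k + 1) ?w))"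
    by (rule corner_P_chain) (use N in auto)
  also have "P (2 * k + 1) ?w = E N ?w"
    using P_last[of ?w] N by simp
  also have "word_op (below 1 k) (E N ?w) = Iop True ?w"
    using sites_below[of k 1] N by simp
  finally have "c *s (c *s Iop False (J 0 ?w)) = c *s ((a2 * (a1 * c - k1) - k2 * t * t * b1) *s Iop False ?w
      - (k1 * k2 * t * t * c ^ Suc k) *s IJ False ?w)"
    by (simp add: scale_right_diff_distrib mult_ac)
  then have "c *s Iop False (J 0 ?w) = (a2 * (a1 * c - k1) - k2 * t * t * b1) *s Iop False ?w
      - (k1 * k2 * t * t * c ^ Suc k) *s IJ False ?w"
    by (rule scale_cancel[OF c_nonzero])
  then have "(q * q) *s c *s Iop False (J 0 ?w) = (q * q * (a2 * (a1 * c - k1) - k2 * t * t * b1)) *s Iop False ?w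
      - (q * q * (k1 * k2 * t * t * c ^ Suc k)) *s IJ False ?w"
    by (simp only: scale_right_diff_distrib scale_scale)
  moreover have "q * q * (a2 * (a1 * c - k1) - k2 * t * t * b1) = q * a1 * a2 + t * b1 * b2"
    using c_eq k1_eq k2_eq qt by Groebner_Basis.algebra
  moreover have "q * q * (k1 * k2 * t * t * C) = k1 * k2 * C" for C
    using qt by Groebner_Basis.algebra
  ultimately show ?thesis by simp
qed

text \<open>At the bottom of the chain, the identity term of the boundary element lets the word
  collapse, and its \<open>E 0\<close> term completes the word to \<open>Iop True\<close>.\<close>

lemma corner_X0:
  assumes K: "dual r r'" "tower r K" "\<And>v. K 0 v = bd0 a k v" and N: "N = Suc (2 * m)"
  shows "Iop False (K (2 * m) (Iop False v)) = (r * r) ^ m *s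
    (a *s Iop False (Iop False v) - (c ^ m * k) *s IJ False (Iop False v))"
proof -
  define ys where "ys = map (\<lambda>j. 2 * j + 0) [Suc 0..<Suc m]"
  have "Iop False (K (2 * m) (Iop False v)) = (r * r * c) ^ m *s Iop False (word_op ys (bd0 a k (Iop False v)))"
    using corner_K_chain[OF K(1,2), of m 0 False m v] N by (simp add: ys_def K(3) del: upt_Suc)
  also have "word_op ys (bd0 a k (Iop False v)) = a *s word_op ys (Iop False v) - k *s word_op ys (E 0 (Iop False v))"
    by (simp add: bd0_def word_op_diff word_op_scale)
  also have "word_op ys (E 0 (Iop False v)) = E 0 (word_op ys (Iop False v))"
    by (rule E_word_op_far[symmetric]) (auto simp: ys_def)
  also have "\<dots> = Iop True (Iop False v)"
  proof -
    have "sites True = 0 # ys"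
      unfolding sites_map(1)[OF N] ys_def by (simp add: upt_conv_Cons del: upt_Suc)
    then show ?thesis by simp
  qed
  finally have "Iop False (K (2 * m) (Iop False v)) = (r * r) ^ m *s
      (a *s c ^ m *s Iop False (word_op ys (Iop False v)) - (c ^ m * k) *s IJ False (Iop False v))"
    by (simp add: word_op_diff word_op_scale scale_right_diff_distrib power_mult_distrib mult_ac)
  also have "c ^ m *s Iop False (word_op ys (Iop False v)) = Iop False (Iop False v)"
    using corner_word_collapse[of m 0 False m v] N by (simp add: ys_def del: upt_Suc)
  finally show ?thesis .
qed

text \<open>Since \<open>E 0\<close> belongs to \<open>Iop True\<close>, the chain stops at
  \<open>K 1\<close>, which is evaluated between two copies of \<open>E 0\<close>. Drawing them out
  costs \<open>s1 * s1\<close>, which is divided out.\<close>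

lemma corner_X1:
  assumes K: "dual r r'" "tower r K" "\<And>v. K 0 v = bd0 a k v" and N: "N = Suc (Suc (2 * m))"
  shows "Iop True (K (2 * m + 1) (Iop True v)) = (r * r) ^ m *s
    ((r * r * (a - k * s1)) *s Iop True (Iop True v)
      + (c ^ m * (a * (r' - r) - k + r * s1 * k + r * s1 * k)) *s IJ True (Iop True v))"
proof -
  define ys where "ys = map (\<lambda>j. 2 * j + 1) [Suc 0..<Suc m]"
  let ?w = "Iop True v"
  have ab: "E 0 (Iop True w) = s1 *s Iop True w" "Iop True (E 0 w) = s1 *s Iop True w" for w
    using E_Iop[of 0 True w] Iop_E[of 0 True w] by (simp_all add: wt_def)
  have TL: "E 1 (E 0 (E 1 w)) = E 1 w" "E 1 (E 1 w) = c *s E 1 w" for w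
    using E_TL[of 1 0] E_sq N by simp_all
  have com: "word_op ys (E i w) = E i (word_op ys w)" if "i \<le> 1" for i w
    by (rule E_word_op_far[symmetric]) (use that in \<open>auto simp: ys_def\<close>)
  have sand: "E 0 (K 1 (E 0 w)) = (r * r * s1 * (a - k * s1)) *s E 0 w
      + (a * (r' - r) - k + r * s1 * k + r * s1 * k) *s E 0 (E 1 (E 0 w))" for w
  proof -
    have "E 0 (K 1 (E 0 w)) = (r * r * s1 * (a - k * s1)) *s E 0 w
      + ((a * c) *s E 0 (E 1 (E 0 w)) - (a * r) *s E 0 (E 1 (E 0 w)) - (a * r) *s E 0 (E 1 (E 0 w))
        - k *s E 0 (E 1 (E 0 w)) + (r * s1 * k) *s E 0 (E 1 (E 0 w)) + (r * s1 * k) *s E 0 (E 1 (E 0 w)))"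
      by (simp add: K_Suc[OF K(1,2)] K(3) bd0_def gg_def E_diff E_scale TL[simplified] E_sq_left
          scale_left_distrib scale_left_diff_distrib scale_right_diff_distrib)
        (simp add: algebra_simps)
    also have "\<dots> = (r * r * s1 * (a - k * s1)) *s E 0 w
      + (a * c - a * r - a * r - k + r * s1 * k + r * s1 * k) *s E 0 (E 1 (E 0 w))"
      by (simp only: scale_left_distrib scale_left_diff_distrib)
    also have "a * c - a * r - a * r - k + r * s1 * k + r * s1 * k = a * (r' - r) - k + r * s1 * k + r * s1 * k"
      using dual_sum[OF K(1,2)] by (simp add: algebra_simps)
    finally show ?thesis .
  qed
  have "(s1 * s1) *s Iop True (word_op ys (K 1 ?w)) = Iop True (word_op ys (E 0 (K 1 (E 0 ?w))))"
    by (simp add: com ab K_scale[OF K(1,2)] word_op_scale)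
  also have "\<dots> = (s1 * s1) *s ((r * r * (a - k * s1)) *s Iop True (word_op ys ?w)
      + (a * (r' - r) - k + r * s1 * k + r * s1 * k) *s Iop True (E 1 (word_op ys ?w)))"
    unfolding sand
    by (simp add: com ab E_scale word_op_scale word_op_add scale_right_distrib mult_ac)
  finally have X1: "Iop True (word_op ys (K 1 ?w)) = (r * r * (a - k * s1)) *s Iop True (word_op ys ?w)
      + (a * (r' - r) - k + r * s1 * k + r * s1 * k) *s Iop True (E 1 (word_op ys ?w))"
    by (rule scale_cancel[rotated]) (simp add: s1_nonzero)
  have "sites False = 1 # ys"
    unfolding sites_map(2)[OF N] ys_def by (simp add: upt_conv_Cons del: upt_Suc)
  then have J: "E 1 (word_op ys ?w) = Iop False ?w" by simp
  have I: "c ^ m *s Iop True (word_op ys ?w) = Iop True ?w"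
    using corner_word_collapse[of m 1 True m v] N by (simp add: ys_def del: upt_Suc)
  have "Iop True (K (2 * m + 1) ?w) = (r * r * c) ^ m *s Iop True (word_op ys (K 1 ?w))"
    using corner_K_chain[OF K(1,2), of m 1 True m v] N by (simp add: ys_def del: upt_Suc)
  also have "\<dots> = (r * r) ^ m *s ((r * r * (a - k * s1)) *s c ^ m *s Iop True (word_op ys ?w)
      + (c ^ m * (a * (r' - r) - k + r * s1 * k + r * s1 * k)) *s IJ True ?w)"
    unfolding X1 J by (simp add: scale_right_distrib power_mult_distrib mult_ac)
  finally show ?thesis unfolding I .
qed

text \<open>As in \<open>corner_X1\<close>, at the right end: the chain stops one step early and is
  closed between two copies of \<open>E N\<close>, at the cost of \<open>s2 * s2\<close>.\<close>

lemma corner_P0_even: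
  assumes N: "N = Suc (Suc (2 * k))"
  shows "Iop True (P 0 (Iop True v)) = s2 *s Iop True (Iop True v) + (c ^ k * (1 - c * s2)) *s IJ True (Iop True v)"
proof -
  let ?w = "Iop True v" and ?j = "Suc (2 * k)"
  have ev: "even N" using N by simp
  have ab: "E N (Iop True w) = s2 *s Iop True w" "Iop True (E N w) = s2 *s Iop True w" for w
    using E_Iop[of N True w] Iop_E[of N True w] ev N_ge_2 by (simp_all add: wt_def)
  have com: "word_op (below 0 k) (E N w) = E N (word_op (below 0 k) w)" for w
    by (rule E_word_op_far[symmetric]) (auto simp: below_def N)
  have TL: "E ?j (E N (E ?j w)) = E ?j w" for w using E_TL[of ?j N] N by simp
  have P: "P (2 * k) w = gg q ?j (E N (gg t ?j w))" for w
    using P_step[of "2 * k" w] P_last N by simp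
  have sand: "E N (P (2 * k) (E N w)) = (s2 * s2) *s E N w + (1 - c * s2) *s E N (E ?j (E N w))" for w
  proof -
    have "E N (P (2 * k) (E N w)) = (q * t * s2 * s2) *s E N w + (1 - q * s2 - t * s2) *s E N (E ?j (E N w))"
      unfolding P gg_def
      by (simp only: E_diff E_scale TL E_sq_right scale_scale scale_right_diff_distrib scale_left_diff_distrib)
        (simp add: algebra_simps)
    then show ?thesis using qt c_eq by (simp add: algebra_simps)
  qed
  have "(s2 * s2) *s Iop True (word_op (below 0 k) (P (2 * k) ?w))
      = Iop True (word_op (below 0 k) (E N (P (2 * k) (E N ?w))))"
    by (simp add: com ab P_scale word_op_scale)
  also have "\<dots> = (s2 * s2) *s (s2 *s Iop True (word_op (below 0 k) ?w)
      + (1 - c * s2) *s Iop True (word_op (below 0 k) (E ?j ?w)))"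
    unfolding sand
    by (simp add: com ab E_scale word_op_scale word_op_add scale_right_distrib mult_ac)
  finally have X: "Iop True (word_op (below 0 k) (P (2 * k) ?w)) = s2 *s Iop True (word_op (below 0 k) ?w)
      + (1 - c * s2) *s Iop True (word_op (below 0 k) (E ?j ?w))"
    by (rule scale_cancel[rotated]) (simp add: s2_nonzero)
  have "sites False = below 0 k @ [?j]"
    using N below_Suc[of 0 k] unfolding sites_def below_def by simp
  then have J: "word_op (below 0 k) (E ?j ?w) = Iop False ?w" by simp
  have I: "c ^ k *s Iop True (word_op (below 0 k) ?w) = Iop True ?w"
    using corner_below_collapse[of k 0 True v] N by (simp add: below_def)
  have "Iop True (P 0 ?w) = c ^ k *s Iop True (word_op (below 0 k) (P (2 * k) ?w))"
    using corner_P_chain[of k 0 True v] N by (simp add: below_def)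
  also have "\<dots> = s2 *s c ^ k *s Iop True (word_op (below 0 k) ?w) + (c ^ k * (1 - c * s2)) *s IJ True ?w"
    unfolding X J by (simp add: scale_right_distrib mult_ac)
  finally show ?thesis unfolding I .
qed

text \<open>After substitution this is \<open>q^x + q^-x\<close> with
  \<open>x = \<omega>1 + \<omega>2 + 1\<close> for even \<open>N\<close> and
  \<open>x = \<omega>1 - \<omega>2\<close> for odd \<open>N\<close>.\<close>

definition zcoef :: complex
  where "zcoef = (if even N then q * a1 * a2 + t * b1 * b2 else a1 * b2 + a2 * b1)"

definition zsign :: complex
  where "zsign = (if even N then -1 else 1)"

text \<open>The boundary generators contained in \<open>Iop p\<close> are none in case A, only
  \<open>E 0\<close> in B, only \<open>E N\<close> in C, and both in D. The weight
  \<open>wts (sites p)\<close> is the factor in \<open>Iop_Iop\<close>, so it cancels when the terms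
  are compared as multiples of \<open>Iop p\<close>.\<close>

theorem corner_Z:
  "(q - t) *s (\<Sum>i<N. JJ p v i) = (q ^ N - t ^ N) *s
    (zcoef *s Iop p (Iop p v) + (zsign * k1 * k2 * wts (sites p)) *s IJ p (Iop p v))"
proof -
  let ?x = "Iop p (Iop p v)" and ?y = "IJ p (Iop p v)"
  consider (A) k where "N = Suc (Suc (2 * k))" "p = False" | (B) m where "N = Suc (2 * m)" "p = True"
    | (C) m where "N = Suc (2 * Suc m)" "p = False" | (D) k where "N = Suc (Suc (2 * k))" "p = True"
  proof (cases "even N")
    case True
    then obtain m where "N = 2 * m" by blast
    then have "N = Suc (Suc (2 * (m - 1)))" using N_ge_2 by simp
    then show ?thesis using that(1,4) by (cases p) blast+
  next
    case False
    then obtain m where m: "N = Suc (2 * m)" by (metis oddE Suc_eq_plus1)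
    then have "N = Suc (2 * Suc (m - 1))" using N_ge_2 by simp
    then show ?thesis using that(2,3) m by (cases p) blast+
  qed
  then show ?thesis
  proof cases
    case A
    have w: "wts (sites False) = c ^ Suc k" using wts_sites(1)[of "Suc k"] A by simp
    have "(q - t) *s (\<Sum>i<N. JJ p v i) = (q ^ N - t ^ N) *s ((q * a1 * a2 + t * b1 * b2) *s ?x - (k1 * k2 * c ^ Suc k) *s ?y)"
      using corner_even_J0[of "Suc k" v] A(1) unfolding corner_J0_even[OF A(1)] A(2) by simp
    moreover have "even N" using A(1) by simp
    ultimately show ?thesis by (simp add: zcoef_def zsign_def w A(2))
  next
    case B
    have w: "wts (sites True) = s1 * c ^ m" using wts_sites(3)[OF B(1)] .
    have "k2 * (a1 - b1) * c ^ m = k1 * k2 * (s1 * c ^ m)" using k1_s1[symmetric] by simp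
    then have "(q - t) *s (\<Sum>i<N. JJ p v i) = (q ^ N - t ^ N) *s ((a1 * b2 + a2 * b1) *s ?x + (k1 * k2 * (s1 * c ^ m)) *s ?y)"
      using corner_odd_S0[OF B(1), of v] unfolding corner_S0 corner_P0_odd[OF B(1)] by (simp add: B(2))
    moreover have "odd N" using B(1) by simp
    ultimately show ?thesis by (simp add: zcoef_def zsign_def w B(2))
  next
    case C
    have w: "wts (sites False) = c ^ Suc m * s2" using wts_sites(2)[OF C(1)] .
    have N1: "N - 1 = 2 * Suc m" using C by simp
    define A B where "A = q ^ (N - 1)" and "B = t ^ (N - 1)"
    have AB: "A * B = 1" by (simp add: A_def B_def qt flip: power_mult_distrib)
    have pw: "(t * t) ^ Suc m = B" "(q * q) ^ Suc m = A"
      unfolding A_def B_def N1 by (simp_all only: power_mult power2_eq_square)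
    have x: "Iop False (J (N - 1) (Iop False v)) = b2 *s B *s (a1 *s ?x - (c ^ Suc m * k1) *s ?y)"
      using corner_X0[OF dual_tq tower_X _ C(1), of a1 k1 v] corner_J_last(1)[of False v] C(1,2)
      unfolding N1 pw by (simp add: X_def)
    have y: "Iop False (Ji (N - 1) (Iop False v)) = a2 *s A *s (b1 *s ?x + (c ^ Suc m * k1) *s ?y)"
      using corner_X0[OF dual_qt tower_Xi _ C(1), of b1 "- k1" v] corner_J_last(2)[of False v] C(1,2)
      unfolding N1 pw by (simp add: Xi_def)
    have "A *s Iop False (J (N - 1) (Iop False v)) + B *s Iop False (Ji (N - 1) (Iop False v))
      = (A * B * (a1 * b2 + a2 * b1)) *s ?x + (A * B * c ^ Suc m * k1 * (a2 - b2)) *s ?y"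
      unfolding x y by (simp add: algebra_simps)
    also have "A * B * c ^ Suc m * k1 * (a2 - b2) = k1 * k2 * (c ^ Suc m * s2)"
      by (simp only: AB k2_s2[symmetric]) simp
    finally have "(q - t) *s (\<Sum>i<N. JJ False v i) = (q ^ N - t ^ N) *s
      ((A * B * (a1 * b2 + a2 * b1)) *s ?x + (k1 * k2 * (c ^ Suc m * s2)) *s ?y)"
      using corner_odd_J_last[OF C(1), of v, folded A_def B_def] by (simp only:)
    moreover have "odd N" using C(1) by simp
    ultimately show ?thesis by (simp add: AB zcoef_def zsign_def w C(2))
  next
    case D
    have w: "wts (sites True) = s1 * c ^ k * s2" using wts_sites(4)[OF D(1)] .
    have N1: "N - 1 = 2 * k + 1" using D by simp
    define A B where "A = q ^ (2 * k)" and "B = t ^ (2 * k)"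
    have AB: "A * B = 1" by (simp add: A_def B_def qt flip: power_mult_distrib)
    have pw: "(t * t) ^ k = B" "(q * q) ^ k = A"
      unfolding A_def B_def by (simp_all only: power_mult power2_eq_square)
    have qN: "q ^ N = q * q * A" "t ^ N = t * t * B" "q ^ (N - 1) = q * A" "t ^ (N - 1) = t * B"
      using D by (simp_all add: A_def B_def)
    have c1: "a1 - k1 * s1 = b1" "a1 * (q - t) - k1 + t * s1 * k1 + t * s1 * k1 = t * (a1 - b1)"
      using k1_s1 k1_eq by Groebner_Basis.algebra+
    have c2: "b1 - - k1 * s1 = a1" "b1 * (t - q) - - k1 + q * s1 * - k1 + q * s1 * - k1 = - (q * (a1 - b1))"
      using k1_s1 k1_eq by Groebner_Basis.algebra+
    have x: "Iop True (J (N - 1) (Iop True v)) = b2 *s B *s ((t * t * b1) *s ?x + (c ^ k * (t * (a1 - b1))) *s ?y)"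
      using corner_X1[OF dual_tq tower_X _ D(1), of a1 k1 v] corner_J_last(1)[of True v] D(1,2)
      unfolding N1 pw c1 by (simp add: X_def)
    have y: "Iop True (Ji (N - 1) (Iop True v)) = a2 *s A *s ((q * q * a1) *s ?x + (c ^ k * - (q * (a1 - b1))) *s ?y)"
      using corner_X1[OF dual_qt tower_Xi _ D(1), of b1 "- k1" v] corner_J_last(2)[of True v] D(1,2)
      unfolding N1 pw c2 by (simp add: Xi_def)
    have S0: "JJ True v 0 = (a1 * b2 + a2 * b1 + k2 * (a1 - b1) * s2) *s ?x + (k2 * (a1 - b1) * (c ^ k * (1 - c * s2))) *s ?y"
      unfolding corner_S0 corner_P0_even[OF D(1)] D(2) by (simp add: algebra_simps)
    have "(q - t) *s (\<Sum>i<N. JJ p v i)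
      = ((q * A - t * B) * (a1 * b2 + a2 * b1 + k2 * (a1 - b1) * s2) + (q - t) * (b2 * B * (t * t * b1) + a2 * A * (q * q * a1))) *s ?x
      + ((q * A - t * B) * (k2 * (a1 - b1) * (c ^ k * (1 - c * s2)))
        + (q - t) * (b2 * B * (c ^ k * (t * (a1 - b1))) + a2 * A * (c ^ k * - (q * (a1 - b1))))) *s ?y"
      using corner_even_S0[OF D(1), of v] unfolding S0 x y qN D(2)
      by (simp only: scale_right_distrib scale_left_distrib scale_scale distrib_left) (simp add: ac_simps)
    also have "(q * A - t * B) * (a1 * b2 + a2 * b1 + k2 * (a1 - b1) * s2) + (q - t) * (b2 * B * (t * t * b1) + a2 * A * (q * q * a1))
      = (q * q * A - t * t * B) * (q * a1 * a2 + t * b1 * b2)"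
      using AB qt k2_s2[symmetric] by Groebner_Basis.algebra
    also have "(q * A - t * B) * (k2 * (a1 - b1) * (c ^ k * (1 - c * s2)))
        + (q - t) * (b2 * B * (c ^ k * (t * (a1 - b1))) + a2 * A * (c ^ k * - (q * (a1 - b1))))
      = (q * q * A - t * t * B) * (- k1 * k2 * (s1 * c ^ k * s2))"
    proof -
      define C where "C = c ^ k"
      show ?thesis unfolding C_def[symmetric]
        using AB qt k2_s2 k1_s1 k2_eq c_eq by Groebner_Basis.algebra
    qed
    finally have "(q - t) *s (\<Sum>i<N. JJ p v i) = ((q * q * A - t * t * B) * (q * a1 * a2 + t * b1 * b2)) *s ?x
      + ((q * q * A - t * t * B) * (- k1 * k2 * (s1 * c ^ k * s2))) *s ?y" .
    moreover have "even N" using D(1) by simp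
    ultimately show ?thesis
      unfolding qN by (simp add: w zcoef_def zsign_def D(2) scale_right_diff_distrib)
  qed
qed

theorem Z_scalar_corner:
  assumes Z: "\<And>v. (\<Sum>i<N. J i v + Ji i v) = z *s v"
    and b: "\<And>v. IJ p (Iop p v) = b *s Iop p v" and u: "Iop p u \<noteq> 0"
  shows "(q - t) * z = (q ^ N - t ^ N) * (zcoef + zsign * k1 * k2 * b)"
proof -
  have "(\<Sum>i<N. JJ p u i) = Iop p (\<Sum>i<N. J i (Iop p u) + Ji i (Iop p u))"
  proof -
    have "Iop p (\<Sum>i\<in>A. f i) = (\<Sum>i\<in>A. Iop p (f i))" if "finite A" for f and A :: "nat set"
      using that by induction (simp_all add: word_op_add)
    then show ?thesis by (simp add: word_op_add)
  qed
  then have "((q - t) * z * wts (sites p)) *s Iop p u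
      = ((q ^ N - t ^ N) * (zcoef + zsign * k1 * k2 * b) * wts (sites p)) *s Iop p u"
    using corner_Z[of p u] unfolding Z b Iop_Iop
    by (simp add: word_op_scale Iop_Iop scale_right_distrib scale_left_distrib distrib_left distrib_right mult_ac)
  then have "(q - t) * z * wts (sites p) = (q ^ N - t ^ N) * (zcoef + zsign * k1 * k2 * b) * wts (sites p)"
    using u scale_right_imp_eq by blast
  then show ?thesis using wts_nonzero by simp
qed

end

section \<open>Algebras, quotients and representations\<close>

text \<open>Scalars act through the elements \<open>c \<odot> \<one>\<close>, so ring ideals are
  closed under scalars and quotients inherit the structure.\<close>

locale complex_algebra = ring A for A :: "(complex, 'a) module" (structure) +
  assumes smult_one_closed: "c \<odot> \<one> \<in> carrier A"
    and smult_eq: "x \<in> carrier A \<Longrightarrow> c \<odot> x = (c \<odot> \<one>) \<otimes> x"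
begin

lemma smult_closed: "x \<in> carrier A \<Longrightarrow> c \<odot> x \<in> carrier A"
  using smult_eq[of x c] m_closed[OF smult_one_closed[of c]] by simp

lemma list_prod_closed: "set xs \<subseteq> carrier A \<Longrightarrow> list_prod A xs \<in> carrier A"
  by (induction xs) (auto simp: list_prod_def)

lemma list_prod_Units: "set xs \<subseteq> Units A \<Longrightarrow> list_prod A xs \<in> Units A"
  by (induction xs) (auto simp: list_prod_def)

end

lemma ring_of_ring_parts:
  fixes S :: "('a, 'b) ring_scheme" and R :: "('a, 'c) ring_scheme"
  assumes "ring R" and eq: "carrier S = carrier R" "monoid.mult S = monoid.mult R" "one S = one R" "zero S = zero R"
    "add S = add R"
  shows "ring S"
proof -
  interpret R: ring R by fact
  show ?thesis
  proof (rule ringI)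
    show "abelian_group S"
      by (rule abelian_groupI) (auto simp: eq R.a_ac intro: R.l_neg)
    show "Group.monoid S"
      by (rule monoidI) (auto simp: eq R.m_assoc)
  qed (auto simp: eq R.l_distr R.r_distr)
qed

locale algebra_ideal = complex_algebra A + ideal I A
  for A :: "(complex, 'a) module" (structure) and I
begin

lemma quotient_carrier: "carrier (quotient_algebra A I) = {I +> x | x. x \<in> carrier A}"
  by (auto simp: quotient_algebra_def FactRing_simps)

lemma quotient_carrierE:
  assumes "X \<in> carrier (quotient_algebra A I)"
  obtains x where "x \<in> carrier A" "X = I +> x"
  using assms by (auto simp: quotient_carrier)

lemma quotient_closed: "x \<in> carrier A \<Longrightarrow> I +> x \<in> carrier (quotient_algebra A I)"
  by (auto simp: quotient_carrier)

lemma quotient_mult: "x \<in> carrier A \<Longrightarrow> y \<in> carrier A \<Longrightarrow>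
    (I +> x) \<otimes>\<^bsub>quotient_algebra A I\<^esub> (I +> y) = I +> (x \<otimes> y)"
  by (simp add: quotient_algebra_def FactRing_def rcoset_mult_add)

lemma quotient_add: "x \<in> carrier A \<Longrightarrow> y \<in> carrier A \<Longrightarrow>
    (I +> x) \<oplus>\<^bsub>quotient_algebra A I\<^esub> (I +> y) = I +> (x \<oplus> y)"
  by (simp add: quotient_algebra_def FactRing_def a_rcos_sum)

lemma quotient_one: "\<one>\<^bsub>quotient_algebra A I\<^esub> = I +> \<one>"
  by (simp add: quotient_algebra_def FactRing_def)

lemma quotient_eq_iff: "x \<in> carrier A \<Longrightarrow> y \<in> carrier A \<Longrightarrow> I +> x = I +> y \<longleftrightarrow> x \<ominus> y \<in> I"
  using quotient_eq_iff_same_a_r_cos[OF is_ideal] by blast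

lemma coset_mem_eq: "x \<in> carrier A \<Longrightarrow> y \<in> I +> x \<Longrightarrow> y \<in> carrier A \<and> I +> y = I +> x"
  using a_r_coset_subset_G[OF a_subset, of x] a_repr_independence[OF _ _ a_subgroup, of y x] by auto

lemma quotient_smult:
  assumes x: "x \<in> carrier A"
  shows "c \<odot>\<^bsub>quotient_algebra A I\<^esub> (I +> x) = I +> (c \<odot> x)"
proof -
  have eq: "I +> (c \<odot> y) = I +> (c \<odot> x)" if y: "y \<in> I +> x" for y
  proof -
    have yc: "y \<in> carrier A" and yx: "I +> y = I +> x" using coset_mem_eq[OF x y] by auto
    have "y \<ominus> x \<in> I" using quotient_eq_iff[OF yc x] yx by simp
    then have "(c \<odot> \<one>) \<otimes> (y \<ominus> x) \<in> I" using I_l_closed smult_one_closed by blast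
    moreover have "(c \<odot> \<one>) \<otimes> (y \<ominus> x) = c \<odot> y \<ominus> c \<odot> x"
      unfolding smult_eq[OF x, of c] smult_eq[OF yc, of c] using x yc smult_one_closed[of c]
      by (simp add: a_minus_def r_distr r_minus)
    ultimately show ?thesis using quotient_eq_iff[OF smult_closed[OF yc, of c] smult_closed[OF x, of c]] by simp
  qed
  have "c \<odot>\<^bsub>quotient_algebra A I\<^esub> (I +> x) = (\<Union>y\<in>I +> x. I +> (c \<odot> y))"
    by (simp add: quotient_algebra_def)
  also have "\<dots> = (\<Union>y\<in>I +> x. I +> (c \<odot> x))"
    using eq by (rule SUP_cong[OF refl])
  also have "\<dots> = I +> (c \<odot> x)"
    using a_rcos_self[OF x] by blast
  finally show ?thesis .
qed

lemma quotient_ring: "ring (quotient_algebra A I)"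
  by (rule ring_of_ring_parts[OF quotient_is_ring]) (simp_all add: quotient_algebra_def)

lemma quotient_complex_algebra: "complex_algebra (quotient_algebra A I)"
proof -
  interpret Q: ring "quotient_algebra A I" by (rule quotient_ring)
  show ?thesis
  proof
    show 1: "c \<odot>\<^bsub>quotient_algebra A I\<^esub> \<one>\<^bsub>quotient_algebra A I\<^esub> \<in> carrier (quotient_algebra A I)" for c
      by (simp add: quotient_one quotient_smult quotient_closed smult_one_closed)
    show "c \<odot>\<^bsub>quotient_algebra A I\<^esub> X
      = (c \<odot>\<^bsub>quotient_algebra A I\<^esub> \<one>\<^bsub>quotient_algebra A I\<^esub>) \<otimes>\<^bsub>quotient_algebra A I\<^esub> X"
      if X: "X \<in> carrier (quotient_algebra A I)" for c X
    proof -
      obtain x where x: "x \<in> carrier A" "X = I +> x" by (rule quotient_carrierE[OF X])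
      then show ?thesis
        by (simp add: quotient_one quotient_smult quotient_mult smult_one_closed smult_eq[OF x(1)])
    qed
  qed
qed

lemma quotient_minus:
  assumes "x \<in> carrier A" "y \<in> carrier A"
  shows "(I +> x) \<ominus>\<^bsub>quotient_algebra A I\<^esub> (I +> y) = I +> (x \<ominus> y)"
proof -
  interpret Q: ring "quotient_algebra A I" by (rule quotient_ring)
  have "(I +> (x \<ominus> y)) \<oplus>\<^bsub>quotient_algebra A I\<^esub> (I +> y) = I +> x"
    using assms by (simp add: quotient_add a_minus_def a_assoc l_neg)
  then have "(I +> x) \<ominus>\<^bsub>quotient_algebra A I\<^esub> (I +> y)
    = ((I +> (x \<ominus> y)) \<oplus>\<^bsub>quotient_algebra A I\<^esub> (I +> y)) \<ominus>\<^bsub>quotient_algebra A I\<^esub> (I +> y)"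
    by simp
  also have "\<dots> = I +> (x \<ominus> y)"
    using assms by (simp add: a_minus_def Q.a_assoc Q.r_neg quotient_closed)
  finally show ?thesis .
qed

end


subsection \<open>Representations\<close>

locale complex_algebra_representation =
  algebra_representation scale A \<rho> + complex_algebra A
  for scale :: "complex \<Rightarrow> 'v::ab_group_add \<Rightarrow> 'v"
    and A :: "(complex, 'a) module" (structure)
    and \<rho> :: "'a \<Rightarrow> 'v \<Rightarrow> 'v"
begin

lemma rep_vadd: "a \<in> carrier A \<Longrightarrow> \<rho> a (v + w) = \<rho> a v + \<rho> a w"
  and rep_vscale: "a \<in> carrier A \<Longrightarrow> \<rho> a (scale c v) = scale c (\<rho> a v)"
  using rep_linear by (auto simp: Vector_Spaces.linear_def module_hom_def module_hom_axioms_def)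

lemma rep_zero: "\<rho> \<zero> v = 0"
  using rep_add[of \<zero> \<zero> v] by simp

lemma rep_minus:
  assumes "a \<in> carrier A" "b \<in> carrier A"
  shows "\<rho> (a \<ominus> b) v = \<rho> a v - \<rho> b v"
  using rep_add[of "a \<ominus> b" b v] assms by (simp add: a_minus_def a_assoc l_neg)

lemma rep_inv: "u \<in> Units A \<Longrightarrow> \<rho> (inv u) (\<rho> u v) = v" "u \<in> Units A \<Longrightarrow> \<rho> u (\<rho> (inv u) v) = v"
  using rep_mult[of "inv u" u v] rep_mult[of u "inv u" v] rep_one by (simp_all add: Units_closed)

lemma rep_inv_eq:
  assumes "u \<in> Units A" "\<And>v. \<rho> u (f v) = v"
  shows "\<rho> (inv u) v = f v"
  using rep_inv(1)[OF assms(1), of "f v"] assms(2) by simp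

lemma rep_list_prod: "set xs \<subseteq> carrier A \<Longrightarrow> \<rho> (list_prod A xs) v = foldr \<rho> xs v"
proof (induction xs)
  case (Cons x xs)
  then show ?case using rep_mult[of x "list_prod A xs"] list_prod_closed[of xs] by (simp add: list_prod_def)
qed (simp add: list_prod_def rep_one)

lemma rep_finsum:
  assumes "finite S" "\<And>i. i \<in> S \<Longrightarrow> f i \<in> carrier A"
  shows "\<rho> (\<Oplus>i\<in>S. f i) v = (\<Sum>i\<in>S. \<rho> (f i) v)"
  using assms
proof (induction S)
  case (insert i S)
  then have "(\<Oplus>i\<in>S. f i) \<in> carrier A" by (intro finsum_closed) auto
  then show ?case using insert by (simp add: finsum_insert rep_add)
qed (simp add: rep_zero)

lemma rep_coset_eq:
  assumes "ideal I A" "\<And>d v. d \<in> I \<Longrightarrow> \<rho> d v = 0" "a \<in> carrier A" "b \<in> I +> a"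
  shows "\<rho> b = \<rho> a"
proof -
  interpret I: ideal I A by fact
  obtain d where "d \<in> I" "b = d \<oplus> a" using assms(4) by (auto simp: a_r_coset_def')
  then show ?thesis using assms by (auto simp: rep_add I.Icarr)
qed

definition rep_kernel :: "'a set"
  where "rep_kernel = {a \<in> carrier A. \<forall>v. \<rho> a v = 0}"

lemma ideal_rep_kernel: "ideal rep_kernel A"
proof (rule idealI[OF ring_axioms])
  show "subgroup rep_kernel (add_monoid A)"
  proof (rule add.subgroupI)
    show "rep_kernel \<noteq> {}" unfolding rep_kernel_def using rep_zero by blast
    fix a assume a: "a \<in> rep_kernel"
    then show "\<ominus> a \<in> rep_kernel"
      using rep_minus[of \<zero> a] rep_zero by (auto simp: rep_kernel_def a_minus_def)
  qed (auto simp: rep_kernel_def rep_add)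
  show "x \<otimes> a \<in> rep_kernel" if "a \<in> rep_kernel" "x \<in> carrier A" for a x
    using that rep_vscale[of x 0 0] by (auto simp: rep_kernel_def rep_mult)
  show "a \<otimes> x \<in> rep_kernel" if "a \<in> rep_kernel" "x \<in> carrier A" for a x
    using that by (auto simp: rep_kernel_def rep_mult)
qed

lemma factor_through_quotient:
  assumes "algebra_ideal A I" "I \<subseteq> rep_kernel"
  shows "\<exists>\<sigma>. algebra_representation scale (quotient_algebra A I) \<sigma> \<and> (\<forall>a\<in>carrier A. \<rho> a = \<sigma> (I +> a))"
proof -
  interpret algebra_ideal A I by fact
  \<comment> \<open>Any representative serves, since two of them differ by an element of the
    kernel.\<close>
  define \<sigma> where "\<sigma> X = \<rho> (SOME a. a \<in> X)" for X
  have \<sigma>: "\<sigma> (I +> a) = \<rho> a" if a: "a \<in> carrier A" for a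
  proof -
    have "(SOME b. b \<in> I +> a) \<in> I +> a" using a_rcos_self[OF a] by (rule someI)
    then show ?thesis
      unfolding \<sigma>_def using assms(2) by (intro rep_coset_eq[OF is_ideal _ a]) (auto simp: rep_kernel_def)
  qed
  have "algebra_representation scale (quotient_algebra A I) \<sigma>"
  proof (intro algebra_representation.intro algebra_representation_axioms.intro)
    show "vector_space scale" by (rule vector_space_axioms)
  next
    fix X c and v :: 'v
    assume X: "X \<in> carrier (quotient_algebra A I)"
    obtain x where x: "x \<in> carrier A" "X = I +> x" by (rule quotient_carrierE[OF X])
    show "Vector_Spaces.linear scale scale (\<sigma> X)" using x by (simp add: \<sigma> rep_linear)
    show "\<sigma> (c \<odot>\<^bsub>quotient_algebra A I\<^esub> X) v = scale c (\<sigma> X v)"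
      using x by (simp add: \<sigma> quotient_smult smult_closed rep_smult)
  next
    fix X Y and v :: 'v
    assume X: "X \<in> carrier (quotient_algebra A I)" and Y: "Y \<in> carrier (quotient_algebra A I)"
    obtain x where x: "x \<in> carrier A" "X = I +> x" by (rule quotient_carrierE[OF X])
    obtain y where y: "y \<in> carrier A" "Y = I +> y" by (rule quotient_carrierE[OF Y])
    show "\<sigma> (X \<otimes>\<^bsub>quotient_algebra A I\<^esub> Y) v = \<sigma> X (\<sigma> Y v)"
      using x y by (simp add: \<sigma> quotient_mult rep_mult)
    show "\<sigma> (X \<oplus>\<^bsub>quotient_algebra A I\<^esub> Y) v = \<sigma> X v + \<sigma> Y v"
      using x y by (simp add: \<sigma> quotient_add rep_add)
  next
    show "\<sigma> \<one>\<^bsub>quotient_algebra A I\<^esub> v = v" for v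
      by (simp add: quotient_one \<sigma> rep_one)
  qed
  then show ?thesis using \<sigma> by auto
qed

end


subsection \<open>The free algebra\<close>

lemma free_algebra_simps [simp]:
  "monoid.mult (free_algebra X) = (*)" "one (free_algebra X) = 1" "zero (free_algebra X) = 0"
  "add (free_algebra X) = (+)" "module.smult (free_algebra X) = (\<lambda>c p. const c * p)"
  by (simp_all add: free_algebra_def const_def)

lemma carrier_free: "p \<in> carrier (free_algebra X) \<longleftrightarrow> (\<forall>w\<in>Poly_Mapping.keys p. set (letters w) \<subseteq> X)"
  by (simp add: free_algebra_def)

lemma free_zero: "0 \<in> carrier (free_algebra X)"
  and free_one: "1 \<in> carrier (free_algebra X)"
  and free_const: "const c \<in> carrier (free_algebra X)"
  and free_uminus: "p \<in> carrier (free_algebra X) \<Longrightarrow> - p \<in> carrier (free_algebra X)"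
  by (auto simp: carrier_free const_def zero_word_def keys_one)

lemma free_gen: "i \<in> X \<Longrightarrow> gen i \<in> carrier (free_algebra X)"
  by (simp add: carrier_free gen_def)

lemma free_add:
  assumes "p \<in> carrier (free_algebra X)" "r \<in> carrier (free_algebra X)"
  shows "p + r \<in> carrier (free_algebra X)"
  using assms Poly_Mapping.keys_add[of p r] unfolding carrier_free by blast

lemma free_diff:
  assumes "p \<in> carrier (free_algebra X)" "r \<in> carrier (free_algebra X)"
  shows "p - r \<in> carrier (free_algebra X)"
  using free_add[OF assms(1) free_uminus[OF assms(2)]] by simp

lemma free_mult:
  assumes "p \<in> carrier (free_algebra X)" "r \<in> carrier (free_algebra X)"
  shows "p * r \<in> carrier (free_algebra X)"
  unfolding carrier_free
proof
  fix w assume "w \<in> Poly_Mapping.keys (p * r)"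
  then obtain a b where "w = a + b" "a \<in> Poly_Mapping.keys p" "b \<in> Poly_Mapping.keys r"
    using Poly_Mapping.keys_mult[of p r] by blast
  then show "set (letters w) \<subseteq> X"
    using assms by (auto simp: carrier_free plus_word_def)
qed

lemmas free_closed = free_zero free_one free_const free_uminus free_gen free_add free_diff free_mult

lemma complex_algebra_free: "complex_algebra (free_algebra X)"
proof -
  have "ring (free_algebra X)"
  proof (rule ringI)
    show "abelian_group (free_algebra X)"
    proof (rule abelian_groupI)
      fix p assume "p \<in> carrier (free_algebra X)"
      then show "\<exists>y\<in>carrier (free_algebra X). y \<oplus>\<^bsub>free_algebra X\<^esub> p = \<zero>\<^bsub>free_algebra X\<^esub>"
        using free_uminus by (intro bexI[of _ "- p"]) auto
    qed (simp_all add: free_closed add_ac)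
    show "Group.monoid (free_algebra X)"
      by (rule monoidI) (simp_all add: free_closed mult.assoc)
  qed (simp_all add: algebra_simps)
  then show ?thesis
    by (simp add: complex_algebra_def complex_algebra_axioms_def free_closed)
qed

lemma free_minus:
  assumes "p \<in> carrier (free_algebra X)" "r \<in> carrier (free_algebra X)"
  shows "p \<ominus>\<^bsub>free_algebra X\<^esub> r = p - r"
proof -
  interpret complex_algebra "free_algebra X" by (rule complex_algebra_free)
  have "\<ominus>\<^bsub>free_algebra X\<^esub> r = - r"
    by (rule minus_equality) (use assms free_uminus in auto)
  then show ?thesis by (simp add: a_minus_def)
qed

lemma const_add: "const (a + b) = const a + const b"
  and const_mult: "const (a * b) = const a * const b"
  and const_1 [simp]: "const 1 = 1"
  and const_0 [simp]: "const 0 = 0"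
  and const_uminus: "const (- a) = - const a"
  by (simp_all add: const_def single_add mult_single single_uminus flip: Poly_Mapping.single_one)

lemma poly_mapping_update: "a \<notin> Poly_Mapping.keys f \<Longrightarrow> Poly_Mapping.update a b f = f + Poly_Mapping.single a b"
  by (rule poly_mapping_eqI) (auto simp: lookup_update lookup_add lookup_single in_keys_iff when_def)

lemma const_commute: "const c * p = p * const c"
proof (induction p rule: update_induct)
  case (update f a b)
  then show ?case
    by (simp add: poly_mapping_update distrib_left distrib_right)
      (simp add: const_def mult_single mult.commute)
qed simp

lemma single_word: "Poly_Mapping.single (Word (x # xs)) 1 = gen x * Poly_Mapping.single (Word xs) 1"
  by (simp add: gen_def mult_single plus_word_def)

lemma single_const: "Poly_Mapping.single w b = const b * Poly_Mapping.single w 1"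
  by (simp add: const_def mult_single)

section \<open>Irreducible representations of the two-boundary Temperley-Lieb algebra\<close>

locale two_BTL_algebra =
  fixes N :: nat and \<delta> s1 s2 :: complex
  assumes N_pos: "1 \<le> N"
begin

abbreviation (input) F where "F \<equiv> free_algebra {0..N}"
abbreviation (input) K where "K \<equiv> btl_ideal N \<delta> s1 s2"
abbreviation (input) A where "A \<equiv> two_BTL N \<delta> s1 s2"

lemma relators_closed: "btl_relators N \<delta> s1 s2 \<subseteq> carrier F"
  unfolding btl_relators_def using N_pos
  by (auto intro!: free_diff free_mult free_const free_gen)

lemma relator_mem: "p \<in> btl_relators N \<delta> s1 s2 \<Longrightarrow> p \<in> K"
proof -
  interpret complex_algebra F by (rule complex_algebra_free)
  show "p \<in> btl_relators N \<delta> s1 s2 \<Longrightarrow> p \<in> K"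
    unfolding btl_ideal_def using genideal_self[OF relators_closed] by blast
qed

sublocale K: algebra_ideal F K
proof -
  interpret complex_algebra F by (rule complex_algebra_free)
  show "algebra_ideal F K"
    unfolding btl_ideal_def
    by (intro algebra_ideal.intro complex_algebra_free genideal_ideal relators_closed)
qed

sublocale A: complex_algebra A
  unfolding two_BTL_def by (rule K.quotient_complex_algebra)

definition cl :: "(word \<Rightarrow>\<^sub>0 complex) \<Rightarrow> btl"
  where "cl p = K +>\<^bsub>F\<^esub> p"

lemma btl_e_cl: "btl_e N \<delta> s1 s2 i = cl (gen i)"
  by (simp add: btl_e_def cl_def)

lemma A_one: "\<one>\<^bsub>A\<^esub> = cl 1"
  using K.quotient_one by (simp add: two_BTL_def cl_def)

lemma cl_closed: "p \<in> carrier F \<Longrightarrow> cl p \<in> carrier A"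
  using K.quotient_closed by (simp add: two_BTL_def cl_def)

lemma carrier_A_cl: "X \<in> carrier A \<Longrightarrow> \<exists>p\<in>carrier F. X = cl p"
  using K.quotient_carrier by (auto simp: two_BTL_def cl_def)

lemma cl_mult: "p \<in> carrier F \<Longrightarrow> r \<in> carrier F \<Longrightarrow> cl p \<otimes>\<^bsub>A\<^esub> cl r = cl (p * r)"
  using K.quotient_mult by (simp add: two_BTL_def cl_def)

lemma cl_add: "p \<in> carrier F \<Longrightarrow> r \<in> carrier F \<Longrightarrow> cl p \<oplus>\<^bsub>A\<^esub> cl r = cl (p + r)"
  using K.quotient_add by (simp add: two_BTL_def cl_def)

lemma cl_smult: "p \<in> carrier F \<Longrightarrow> c \<odot>\<^bsub>A\<^esub> cl p = cl (const c * p)"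
  using K.quotient_smult by (simp add: two_BTL_def cl_def)

lemma cl_minus: "p \<in> carrier F \<Longrightarrow> r \<in> carrier F \<Longrightarrow> cl p \<ominus>\<^bsub>A\<^esub> cl r = cl (p - r)"
  using K.quotient_minus by (simp add: two_BTL_def cl_def free_minus)

lemma cl_eqI: "p \<in> carrier F \<Longrightarrow> r \<in> carrier F \<Longrightarrow> p - r \<in> K \<Longrightarrow> cl p = cl r"
  using K.quotient_eq_iff by (simp add: cl_def free_minus)

text \<open>By the quadratic relation a product of two affine expressions in one generator is again
  affine, and the two conditions say that it is 1. All the \<open>g_i\<close> have this
  form.\<close>

lemma cl_affine_Units:
  assumes i: "i \<le> N" and rel: "gen i * gen i - const s * gen i \<in> K"
    and inv: "\<alpha> * \<alpha>' = 1" "\<alpha> * \<beta>' + \<beta> * \<alpha>' + \<beta> * \<beta>' * s = 0"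
  shows "cl (const \<alpha> + const \<beta> * gen i) \<in> Units A"
proof -
  have g: "gen i \<in> carrier F" using i by (intro free_gen) auto
  have prod: "cl (const \<alpha> + const \<beta> * gen i) \<otimes>\<^bsub>A\<^esub> cl (const \<alpha>' + const \<beta>' * gen i) = \<one>\<^bsub>A\<^esub>"
    if inv: "\<alpha> * \<alpha>' = 1" "\<alpha> * \<beta>' + \<beta> * \<alpha>' + \<beta> * \<beta>' * s = 0" for \<alpha> \<beta> \<alpha>' \<beta>'
  proof -
    have com: "gen i * const c = const c * gen i" "gen i * (const c * x) = const c * (gen i * x)" for c x
      using const_commute[of c "gen i"] by (simp_all flip: mult.assoc)
    have eq: "\<alpha> * \<beta>' + \<beta> * \<alpha>' = - (\<beta> * \<beta>' * s)" using inv(2) by (simp add: add_eq_0_iff2)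
    have "(const \<alpha> + const \<beta> * gen i) * (const \<alpha>' + const \<beta>' * gen i)
      = const (\<alpha> * \<alpha>') + const (\<alpha> * \<beta>' + \<beta> * \<alpha>') * gen i + const (\<beta> * \<beta>') * (gen i * gen i)"
      by (simp add: const_add const_mult com distrib_left distrib_right mult.assoc add_ac)
    also have "\<dots> = 1 + const (\<beta> * \<beta>') * (gen i * gen i - const s * gen i)"
      unfolding eq inv(1) by (simp add: const_uminus const_mult right_diff_distrib mult.assoc)
    finally have "(const \<alpha> + const \<beta> * gen i) * (const \<alpha>' + const \<beta>' * gen i) - 1
      = const (\<beta> * \<beta>') * (gen i * gen i - const s * gen i)" by simp
    moreover have "const (\<beta> * \<beta>') * (gen i * gen i - const s * gen i) \<in> K"
      using K.I_l_closed[OF rel, of "const (\<beta> * \<beta>')"] by (simp add: free_const)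
    ultimately have "cl ((const \<alpha> + const \<beta> * gen i) * (const \<alpha>' + const \<beta>' * gen i)) = cl 1"
      using g by (intro cl_eqI) (simp_all add: free_add free_mult free_const free_one)
    then show ?thesis
      using g by (simp add: A_one cl_mult free_add free_mult free_const)
  qed
  have "\<alpha>' * \<alpha> = 1" "\<alpha>' * \<beta> + \<beta>' * \<alpha> + \<beta>' * \<beta> * s = 0"
    using inv by (simp_all add: algebra_simps)
  then have "cl (const \<alpha>' + const \<beta>' * gen i) \<otimes>\<^bsub>A\<^esub> cl (const \<alpha> + const \<beta> * gen i) = \<one>\<^bsub>A\<^esub>"
    by (rule prod)
  moreover have "cl (const x + const y * gen i) \<in> carrier A" for x y
    by (intro cl_closed free_add free_mult free_const g)
  ultimately show ?thesis
    using prod[OF inv] unfolding Units_def by blast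
qed

lemma relations:
  "1 \<le> i \<Longrightarrow> i < N \<Longrightarrow> gen i * gen i - const \<delta> * gen i \<in> K"
  "gen 0 * gen 0 - const s1 * gen 0 \<in> K"
  "gen N * gen N - const s2 * gen N \<in> K"
  "1 \<le> i \<Longrightarrow> i < N \<Longrightarrow> j = i + 1 \<or> j = i - 1 \<Longrightarrow> gen i * gen j * gen i - gen i \<in> K"
  "Suc i < j \<Longrightarrow> j \<le> N \<Longrightarrow> gen i * gen j - gen j * gen i \<in> K"
proof -
  show "1 \<le> i \<Longrightarrow> i < N \<Longrightarrow> gen i * gen i - const \<delta> * gen i \<in> K"
    by (intro relator_mem) (auto simp: btl_relators_def)
  show "gen 0 * gen 0 - const s1 * gen 0 \<in> K" "gen N * gen N - const s2 * gen N \<in> K"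
    by (intro relator_mem; simp add: btl_relators_def)+
  show "1 \<le> i \<Longrightarrow> i < N \<Longrightarrow> j = i + 1 \<or> j = i - 1 \<Longrightarrow> gen i * gen j * gen i - gen i \<in> K"
    by (intro relator_mem) (fastforce simp: btl_relators_def)
  assume "Suc i < j" "j \<le> N"
  then have "i \<le> N \<and> j \<le> N \<and> \<bar>int i - int j\<bar> > 1" by auto
  then show "gen i * gen j - gen j * gen i \<in> K"
    by (intro relator_mem) (unfold btl_relators_def, blast)
qed

end

locale two_BTL_representation = two_BTL_algebra N \<delta> s1 s2 +
  complex_algebra_representation scale "two_BTL N \<delta> s1 s2" \<rho>
  for N \<delta> s1 s2 and scale :: "complex \<Rightarrow> 'v::ab_group_add \<Rightarrow> 'v" and \<rho> :: "btl \<Rightarrow> 'v \<Rightarrow> 'v"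
begin

definition E :: "nat \<Rightarrow> 'v \<Rightarrow> 'v"
  where "E i v = (if i \<le> N then \<rho> (cl (gen i)) v else 0)"

lemma gen_closed: "i \<le> N \<Longrightarrow> gen i \<in> carrier F"
  by (simp add: free_gen)

lemma rep_cl_mult: "p \<in> carrier F \<Longrightarrow> r \<in> carrier F \<Longrightarrow> \<rho> (cl (p * r)) v = \<rho> (cl p) (\<rho> (cl r) v)"
  using rep_mult[of "cl p" "cl r" v] by (simp add: cl_mult cl_closed)

lemma rep_cl_smult: "p \<in> carrier F \<Longrightarrow> \<rho> (cl (const c * p)) v = scale c (\<rho> (cl p) v)"
  using rep_smult[of "cl p" c v] by (simp add: cl_smult cl_closed)

lemma rep_sq:
  assumes "i \<le> N" "gen i * gen i - const s * gen i \<in> K"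
  shows "E i (E i v) = scale s (E i v)"
proof -
  have "cl (gen i * gen i) = cl (const s * gen i)"
    using assms by (intro cl_eqI free_mult free_const gen_closed)
  then show ?thesis
    using assms(1) rep_cl_mult[of "gen i" "gen i" v] rep_cl_smult[of "gen i" s v] gen_closed
    by (simp add: E_def)
qed

lemma rep_TL:
  assumes "i \<le> N" "j \<le> N" "gen i * gen j * gen i - gen i \<in> K"
  shows "E i (E j (E i v)) = E i v"
proof -
  have "cl (gen i * gen j * gen i) = cl (gen i)"
    using assms by (intro cl_eqI free_mult gen_closed)
  then show ?thesis
    using assms gen_closed by (simp add: E_def free_mult flip: rep_cl_mult) (simp add: mult.assoc)
qed

lemma rep_far:
  assumes "Suc i < j"
  shows "E i (E j v) = E j (E i v)"
proof (cases "j \<le> N")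
  case True
  have "cl (gen i * gen j) = cl (gen j * gen i)"
    using assms True relations(5)[OF assms True] by (intro cl_eqI free_mult gen_closed) auto
  then show ?thesis
    using assms True gen_closed by (simp add: E_def flip: rep_cl_mult)
next
  case False
  have "\<rho> (cl (gen i)) 0 = 0" if "i \<le> N"
    using rep_vscale[OF cl_closed[OF gen_closed[OF that]], of 0 0] by simp
  then show ?thesis using False by (simp add: E_def)
qed

lemma action:
  assumes "2 \<le> N" "\<delta> \<noteq> 0"
  shows "btl_action scale N E \<delta> s1 s2"
proof
  show "E i (v + w) = E i v + E i w" for i v w
    using rep_vadd[OF cl_closed[OF gen_closed]] by (simp add: E_def)
  show "E i (scale a v) = scale a (E i v)" for i a v
    using rep_vscale[OF cl_closed[OF gen_closed]] by (simp add: E_def)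
  show "E i (E i v) = scale \<delta> (E i v)" if "1 \<le> i" "i < N" for i v
    using that relations(1) by (intro rep_sq) auto
  show "E 0 (E 0 v) = scale s1 (E 0 v)" "E N (E N v) = scale s2 (E N v)" for v
    using relations(2,3) by (intro rep_sq; simp)+
  show "E i (E (Suc i) (E i v)) = E i v" if "1 \<le> i" "i < N" for i v
    using that relations(4)[of i "Suc i"] by (intro rep_TL) auto
  show "E (Suc i) (E i (E (Suc i) v)) = E (Suc i) v" if "Suc i < N" for i v
    using that relations(4)[of "Suc i" i] by (intro rep_TL) auto
  show "E i (E j v) = E j (E i v)" if "Suc i < j" for i j v
    using that by (rule rep_far)
qed (use assms in auto)

lemma rep_word: "set xs \<subseteq> {0..N} \<Longrightarrow> \<rho> (cl (Poly_Mapping.single (Word xs) 1)) v = foldr E xs v"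
proof (induction xs arbitrary: v)
  case Nil
  have "Poly_Mapping.single (Word []) (1 :: complex) = 1"
    by (simp flip: zero_word_def)
  then show ?case using rep_one by (simp add: A_one)
next
  case (Cons x xs)
  have "Poly_Mapping.single (Word xs) (1 :: complex) \<in> carrier F"
    using Cons.prems by (auto simp: carrier_free)
  then show ?case
    using Cons gen_closed by (simp add: single_word rep_cl_mult E_def)
qed

text \<open>Irreducibility refers to the whole algebra, the heap argument to generators; the two
  meet because every element is a linear combination of words.\<close>

lemma E_invariant:
  assumes W: "subspace W" and E: "\<And>i w. i \<le> N \<Longrightarrow> w \<in> W \<Longrightarrow> E i w \<in> W"
    and a: "a \<in> carrier A" and w: "w \<in> W"
  shows "\<rho> a w \<in> W"
proof -
  have "p \<in> carrier F \<Longrightarrow> \<rho> (cl p) w \<in> W" for p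
  proof (induction p rule: update_induct)
    case const
    have "\<rho> (cl (const 0 * 1)) w = scale 0 (\<rho> (cl 1) w)"
      by (rule rep_cl_smult) (rule free_one)
    then show ?case using subspace_0[OF W] by simp
  next
    case (update f x b)
    have upd: "Poly_Mapping.update x b f = f + const b * Poly_Mapping.single x 1"
      using update(1) by (simp add: poly_mapping_update flip: single_const)
    have keys: "Poly_Mapping.keys (Poly_Mapping.update x b f) = insert x (Poly_Mapping.keys f)"
      using update(2) by (simp add: keys_update)
    obtain xs where xs: "x = Word xs" by (cases x)
    have f: "f \<in> carrier F" and xsN: "set xs \<subseteq> {0..N}"
      using update.prems keys xs by (auto simp: carrier_free)
    then have s: "Poly_Mapping.single x (1 :: complex) \<in> carrier F"
      by (simp add: carrier_free xs)
    have "foldr E ys w \<in> W" if "set ys \<subseteq> {0..N}" for ys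
      using that by (induction ys) (auto simp: w E)
    then have "scale b (foldr E xs w) \<in> W" using subspace_scale[OF W] xsN by blast
    moreover have "\<rho> (cl (Poly_Mapping.update x b f)) w = \<rho> (cl f) w + scale b (foldr E xs w)"
      unfolding upd using rep_add[of "cl f" "cl (const b * Poly_Mapping.single x 1)"] f s rep_word[OF xsN]
      by (simp add: cl_add cl_closed free_closed rep_cl_smult xs)
    ultimately show ?case using update.IH f subspace_add[OF W] by simp
  qed
  then show ?thesis using carrier_A_cl[OF a] by blast
qed

end

section \<open>Specialisation of the parameters to powers of \<open>q\<close>\<close>

lemma qpow_add: "qpow \<eta> (x + y) = qpow \<eta> x * qpow \<eta> y"
  by (simp add: qpow_def distrib_left exp_add)

lemma qpow_minus: "qpow \<eta> x * qpow \<eta> (- x) = 1"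
  by (simp add: qpow_def flip: exp_add)

lemma qpow_of_nat: "qpow \<eta> (of_nat n) = qpow \<eta> 1 ^ n" "qpow \<eta> (- of_nat n) = qpow \<eta> (-1) ^ n"
  by (simp_all add: qpow_def mult.commute flip: exp_of_nat_mult)

locale two_BTL_irreducible =
  irreducible_representation scale "alg_A N \<eta> \<omega>1 \<omega>2" \<rho>
  for N :: nat and \<eta> \<omega>1 \<omega>2 :: complex and scale :: "complex \<Rightarrow> 'v::ab_group_add \<Rightarrow> 'v"
    and \<rho> :: "btl \<Rightarrow> 'v \<Rightarrow> 'v" +
  assumes N_ge: "N \<ge> 2"
    and not_root: "\<And>n::nat. n \<ge> 1 \<Longrightarrow> qpow \<eta> 1 ^ n \<noteq> 1"
    and qnum_nonzero: "qnum \<eta> \<omega>1 \<noteq> 0" "qnum \<eta> (\<omega>1 + 1) \<noteq> 0" "qnum \<eta> \<omega>2 \<noteq> 0" "qnum \<eta> (\<omega>2 + 1) \<noteq> 0"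
begin

abbreviation (input) q where "q \<equiv> qpow \<eta> 1"
abbreviation (input) t where "t \<equiv> qpow \<eta> (-1)"
abbreviation (input) s1 where "s1 \<equiv> btl_param \<eta> \<omega>1"
abbreviation (input) s2 where "s2 \<equiv> btl_param \<eta> \<omega>2"
abbreviation (input) c where "c \<equiv> qnum \<eta> 2"
abbreviation (input) k1 where "k1 \<equiv> qpow \<eta> (1 + \<omega>1) - qpow \<eta> (- 1 - \<omega>1)"
abbreviation (input) k2 where "k2 \<equiv> qpow \<eta> (1 + \<omega>2) - qpow \<eta> (- 1 - \<omega>2)"

sublocale two_BTL_algebra N c s1 s2
  by unfold_locales (use N_ge in simp)

lemma alg_A_eq: "alg_A N \<eta> \<omega>1 \<omega>2 = A"
  by (simp add: alg_A_def)

lemma qt1: "q * t = 1"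
  using qpow_minus[of \<eta> 1] .

lemma q_ne_t: "q \<noteq> t"
  using not_root[of 2] qt1 by (auto simp: power2_eq_square)

lemma c_qt: "c = q + t"
proof -
  have "qpow \<eta> 2 = q * q" "qpow \<eta> (- 2) = t * t"
    using qpow_add[of \<eta> 1 1] qpow_add[of \<eta> "-1" "-1"] by simp_all
  then have "c = (q * q - t * t) / (q - t)" by (simp add: qnum_def)
  also have "\<dots> = q + t" using q_ne_t by (simp add: field_simps)
  finally show ?thesis .
qed

lemma c_ne_0: "c \<noteq> 0"
proof
  assume "c = 0"
  then have "q = - t" using c_qt by (simp add: add_eq_0_iff2)
  then have "q ^ 4 = (q * t) ^ 2" by (simp add: eval_nat_numeral)
  then show False using qt1 not_root[of 4] by simp
qed

lemma k_eq: "qpow \<eta> (1 + \<omega>) - qpow \<eta> (- 1 - \<omega>) = q * qpow \<eta> \<omega> - t * qpow \<eta> (- \<omega>)"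
  using qpow_add[of \<eta> 1 \<omega>] qpow_add[of \<eta> "-1" "- \<omega>"] by simp

lemma k_qnum: "qpow \<eta> (1 + \<omega>) - qpow \<eta> (- 1 - \<omega>) = qnum \<eta> (\<omega> + 1) * (q - t)"
proof -
  have "- (\<omega> + 1) = - 1 - \<omega>" by simp
  then show ?thesis using q_ne_t by (simp add: qnum_def add.commute)
qed

lemma k_param: "qnum \<eta> (\<omega> + 1) \<noteq> 0 \<Longrightarrow>
    (qpow \<eta> (1 + \<omega>) - qpow \<eta> (- 1 - \<omega>)) * btl_param \<eta> \<omega> = qpow \<eta> \<omega> - qpow \<eta> (- \<omega>)"
  unfolding k_qnum using q_ne_t by (simp add: btl_param_def) (simp add: qnum_def)

sublocale two_BTL_representation N c s1 s2 scale \<rho>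
proof -
  have "algebra_representation scale A \<rho>"
    using algebra_representation_axioms by (simp add: alg_A_eq)
  then show "two_BTL_representation N c s1 s2 scale \<rho>"
    by (intro two_BTL_representation.intro two_BTL_algebra_axioms complex_algebra_representation.intro
        A.complex_algebra_axioms)
qed

sublocale btl_q_action scale N E c s1 s2 q t
    "qpow \<eta> \<omega>1" "qpow \<eta> (- \<omega>1)" k1 "qpow \<eta> \<omega>2" "qpow \<eta> (- \<omega>2)" k2
proof -
  interpret btl_action scale N E c s1 s2
    by (rule action[OF N_ge c_ne_0])
  show "btl_q_action scale N E c s1 s2 q t
    (qpow \<eta> \<omega>1) (qpow \<eta> (- \<omega>1)) k1 (qpow \<eta> \<omega>2) (qpow \<eta> (- \<omega>2)) k2"
  proof
    show "k1 = q * qpow \<eta> \<omega>1 - t * qpow \<eta> (- \<omega>1)" "k2 = q * qpow \<eta> \<omega>2 - t * qpow \<eta> (- \<omega>2)"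
      by (rule k_eq)+
    show "k1 * s1 = qpow \<eta> \<omega>1 - qpow \<eta> (- \<omega>1)" "k2 * s2 = qpow \<eta> \<omega>2 - qpow \<eta> (- \<omega>2)"
      using qnum_nonzero by (intro k_param; simp)+
    show "s1 \<noteq> 0" "s2 \<noteq> 0" using qnum_nonzero by (simp_all add: btl_param_def)
  qed (use c_qt qt1 q_ne_t qpow_minus in auto)
qed

lemma irreducible_E: E_irreducible
  unfolding E_irreducible_def
proof (intro allI impI)
  fix W assume W: "subspace W" and E: "\<forall>i\<le>N. \<forall>w\<in>W. E i w \<in> W"
  show "W = {0} \<or> W = UNIV"
    by (rule rep_irreducible[OF W]) (use E_invariant[OF W] E in \<open>auto simp: alg_A_eq\<close>)
qed

lemma rep_e: "i \<le> N \<Longrightarrow> \<rho> (btl_e N c s1 s2 i) v = E i v"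
  and e_closed: "i \<le> N \<Longrightarrow> btl_e N c s1 s2 i \<in> carrier A"
  by (simp_all add: btl_e_cl E_def cl_closed gen_closed)

lemma rep_list_e: "set is \<subseteq> {..N} \<Longrightarrow> \<rho> (list_prod A (map (btl_e N c s1 s2) is)) v = word_op is v"
proof -
  assume i: "set is \<subseteq> {..N}"
  then have "set (map (btl_e N c s1 s2) is) \<subseteq> carrier A" using e_closed by auto
  moreover have "foldr \<rho> (map (btl_e N c s1 s2) is) v = word_op is v"
    using i by (induction "is") (auto simp: rep_e)
  ultimately show ?thesis by (simp add: rep_list_prod)
qed

lemma I1_closed: "btl_I1 N c s1 s2 \<in> carrier A" and I2_closed: "btl_I2 N c s1 s2 \<in> carrier A"
  unfolding btl_I1_def btl_I2_def by (rule A.list_prod_closed; use e_closed in auto)+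

lemma rep_I1: "\<rho> (btl_I1 N c s1 s2) v = Iop False v" and rep_I2: "\<rho> (btl_I2 N c s1 s2) v = Iop True v"
  unfolding btl_I1_def btl_I2_def sites_def by (subst rep_list_e; auto)+

lemma relations_hold_iff:
  "double_quotient_relations_hold N c s1 s2 b \<rho> \<longleftrightarrow> (\<forall>p v. IJ p (Iop p v) = scale b (Iop p v))"
proof -
  have "\<rho> (btl_I1 N c s1 s2 \<otimes>\<^bsub>A\<^esub> btl_I2 N c s1 s2 \<otimes>\<^bsub>A\<^esub> btl_I1 N c s1 s2) v = IJ False (Iop False v)"
    "\<rho> (btl_I2 N c s1 s2 \<otimes>\<^bsub>A\<^esub> btl_I1 N c s1 s2 \<otimes>\<^bsub>A\<^esub> btl_I2 N c s1 s2) v = IJ True (Iop True v)"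
    "\<rho> (b \<odot>\<^bsub>A\<^esub> btl_I1 N c s1 s2) v = scale b (Iop False v)"
    "\<rho> (b \<odot>\<^bsub>A\<^esub> btl_I2 N c s1 s2) v = scale b (Iop True v)" for v
    by (simp_all add: rep_mult rep_smult I1_closed I2_closed rep_I1 rep_I2)
  then show ?thesis
    by (simp add: double_quotient_relations_hold_def Let_def fun_eq_iff all_bool_eq conj_commute)
qed

lemma relations_imp_factors:
  assumes "double_quotient_relations_hold N c s1 s2 b \<rho>"
  shows "factors_through_double_quotient N c s1 s2 b scale \<rho>"
proof -
  let ?I1 = "btl_I1 N c s1 s2" and ?I2 = "btl_I2 N c s1 s2"
  let ?S = "{?I1 \<otimes>\<^bsub>A\<^esub> ?I2 \<otimes>\<^bsub>A\<^esub> ?I1 \<ominus>\<^bsub>A\<^esub> b \<odot>\<^bsub>A\<^esub> ?I1, ?I2 \<otimes>\<^bsub>A\<^esub> ?I1 \<otimes>\<^bsub>A\<^esub> ?I2 \<ominus>\<^bsub>A\<^esub> b \<odot>\<^bsub>A\<^esub> ?I2}"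
  have sub: "?S \<subseteq> rep_kernel"
    using assms I1_closed I2_closed
    by (auto simp: rep_kernel_def rep_minus A.smult_closed double_quotient_relations_hold_def Let_def)
  have closed: "?S \<subseteq> carrier A" using I1_closed I2_closed by (auto simp: A.smult_closed)
  have "double_quotient_ideal N c s1 s2 b \<subseteq> rep_kernel"
    unfolding double_quotient_ideal_def Let_def by (rule A.genideal_minimal[OF ideal_rep_kernel sub])
  moreover have "algebra_ideal A (double_quotient_ideal N c s1 s2 b)"
    unfolding double_quotient_ideal_def Let_def
    by (intro algebra_ideal.intro A.complex_algebra_axioms A.genideal_ideal closed)
  ultimately have "\<exists>\<sigma>. algebra_representation scale (double_quotient N c s1 s2 b) \<sigma> \<and>
      (\<forall>a\<in>carrier A. \<rho> a = \<sigma> (double_quotient_ideal N c s1 s2 b +>\<^bsub>A\<^esub> a))"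
    unfolding double_quotient_def by (intro factor_through_quotient)
  then show ?thesis
    by (simp only: factors_through_double_quotient_def)
qed

section \<open>The elements \<open>g_i\<close>, \<open>J_i\<close> and \<open>Z_N\<close> as
  operators\<close>

abbreviation (input) g where "g \<equiv> elt_g N \<eta> \<omega>1 \<omega>2"

lemma g_cl:
  "g 0 = cl (const (qpow \<eta> \<omega>1) + const (- k1) * gen 0)"
  "g N = cl (const (qpow \<eta> \<omega>2) + const (- k2) * gen N)"
  "1 \<le> i \<Longrightarrow> i < N \<Longrightarrow> g i = cl (const (- t) + const 1 * gen i)"
  using N_ge
  by (simp_all add: elt_g_def alg_A_eq A_one elt_e_def btl_e_cl cl_smult cl_minus free_closed gen_closed
      const_uminus del: minus_diff_eq)

lemma g_Units: "i \<le> N \<Longrightarrow> g i \<in> Units A"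
proof -
  assume i: "i \<le> N"
  consider "i = 0" | "i = N" | "1 \<le> i" "i < N" using i by linarith
  then show "g i \<in> Units A"
  proof cases
    case 1
    have "qpow \<eta> \<omega>1 * k1 + - k1 * qpow \<eta> (- \<omega>1) + - k1 * k1 * s1 = 0"
      using k1_s1 by Groebner_Basis.algebra
    then show ?thesis
      unfolding 1 g_cl by (intro cl_affine_Units[OF _ relations(2) ab1]) auto
  next
    case 2
    have "qpow \<eta> \<omega>2 * k2 + - k2 * qpow \<eta> (- \<omega>2) + - k2 * k2 * s2 = 0"
      using k2_s2 by Groebner_Basis.algebra
    then show ?thesis
      unfolding 2 g_cl by (intro cl_affine_Units[OF _ relations(3) ab2]) auto
  next
    case 3
    show ?thesis
      unfolding g_cl(3)[OF 3]
      by (rule cl_affine_Units[OF i relations(1)[OF 3], where \<alpha>' = "- q" and \<beta>' = 1]) (use qt c_qt in \<open>auto simp: mult.commute\<close>)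
  qed
qed

lemma rep_cl_affine: "i \<le> N \<Longrightarrow> \<rho> (cl (const \<alpha> + const \<beta> * gen i)) v = scale \<alpha> v + scale \<beta> (E i v)"
proof -
  assume i: "i \<le> N"
  have "\<rho> (cl (const \<alpha> * 1)) v = scale \<alpha> v"
    using rep_cl_smult[OF free_one, of \<alpha> v] rep_one by (simp add: A_one)
  then show ?thesis
    using i rep_add[of "cl (const \<alpha>)" "cl (const \<beta> * gen i)" v]
    by (simp add: cl_add cl_closed free_closed gen_closed rep_cl_smult E_def)
qed

lemma rep_g:
  "\<rho> (g 0) v = bd0 (qpow \<eta> \<omega>1) k1 v"
  "\<rho> (g N) v = T (N - 1) v"
  "1 \<le> i \<Longrightarrow> i < N \<Longrightarrow> \<rho> (g i) v = gg t i v"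
proof -
  show "\<rho> (g 0) v = bd0 (qpow \<eta> \<omega>1) k1 v"
    unfolding g_cl by (subst rep_cl_affine) (simp_all add: bd0_def del: minus_diff_eq)
  show "\<rho> (g N) v = T (N - 1) v"
    unfolding g_cl by (subst rep_cl_affine) (simp_all only: T_def P_last order_refl, simp del: minus_diff_eq)
  show "1 \<le> i \<Longrightarrow> i < N \<Longrightarrow> \<rho> (g i) v = gg t i v"
    unfolding g_cl by (subst rep_cl_affine) (simp_all add: gg_def scale_minus_left)
qed

lemma rep_inv_g: "1 \<le> i \<Longrightarrow> i < N \<Longrightarrow> \<rho> (inv\<^bsub>A\<^esub> g i) v = gg q i v"
  by (rule rep_inv_eq[OF g_Units]) (simp_all add: rep_g gg_tq)

lemma T_unfold: "i < N \<Longrightarrow>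
    foldr (gg q) [Suc i..<N] (T (N - 1) (foldr (gg t) (rev [Suc i..<N]) v)) = T i v"
proof (induction arbitrary: v rule: P_induct)
  case last
  then show ?case using N_ge by simp
next
  case (step n)
  then show ?case by (simp add: upt_conv_Cons T_step[of n])
qed

abbreviation (input) eJ where "eJ \<equiv> elt_J N \<eta> \<omega>1 \<omega>2"

lemma J_Units: "i < N \<Longrightarrow> eJ i \<in> Units A"
proof (induction i)
  case 0
  show ?case
    using g_Units by (auto simp: alg_A_eq intro!: A.list_prod_Units)
next
  case (Suc i)
  then show ?case using g_Units by (simp add: alg_A_eq)
qed

lemma rep_J: "i < N \<Longrightarrow> \<rho> (eJ i) v = J i v"
proof (induction i arbitrary: v)
  case 0
  let ?xs = "map (\<lambda>i. inv\<^bsub>A\<^esub> g i) [1..<N]" and ?ys = "map g (rev [1..<N])"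
  have units: "set (?xs @ [g N] @ ?ys @ [g 0]) \<subseteq> Units A"
    using g_Units by auto
  have xs: "foldr \<rho> ?xs w = foldr (gg q) [1..<N] w" for w
  proof -
    have "set is \<subseteq> {1..<N} \<Longrightarrow> foldr \<rho> (map (\<lambda>i. inv\<^bsub>A\<^esub> g i) is) w = foldr (gg q) is w" for "is"
      by (induction "is") (auto simp: rep_inv_g)
    then show ?thesis by simp
  qed
  have ys: "foldr \<rho> ?ys w = foldr (gg t) (rev [1..<N]) w" for w
  proof -
    have "set is \<subseteq> {1..<N} \<Longrightarrow> foldr \<rho> (map g is) w = foldr (gg t) is w" for "is"
      by (induction "is") (auto simp: rep_g)
    then show ?thesis by simp
  qed
  \<comment> \<open>The list \<open>rev [0..<N]\<close> ends in 0, so \<open>g 0\<close> is the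
    rightmost factor and acts first.\<close>
  have "eJ 0 = list_prod A (?xs @ [g N] @ ?ys @ [g 0])"
    using N_ge by (simp add: alg_A_eq upt_conv_Cons)
  then have "\<rho> (eJ 0) v = foldr \<rho> (?xs @ [g N] @ ?ys @ [g 0]) v"
    using rep_list_prod[of "?xs @ [g N] @ ?ys @ [g 0]" v] units A.Units_closed by (simp only:) blast
  also have "\<dots> = foldr (gg q) [1..<N] (T (N - 1) (foldr (gg t) (rev [1..<N]) (bd0 (qpow \<eta> \<omega>1) k1 v)))"
    by (simp only: foldr_append foldr.simps comp_apply id_apply xs ys rep_g)
  also have "\<dots> = J 0 v"
    using T_unfold[of 0] N_ge by (simp add: J_0)
  finally show ?case .
next
  case (Suc i)
  have cl: "g (Suc i) \<in> carrier A" "eJ i \<in> carrier A"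
    using Suc.prems g_Units[of "Suc i"] J_Units[of i] A.Units_closed by auto
  then show ?case
    using Suc by (simp add: alg_A_eq rep_mult rep_g J_Suc)
qed

lemma rep_Z: "\<rho> (elt_Z N \<eta> \<omega>1 \<omega>2) v = (\<Sum>i<N. J i v + Ji i v)"
proof -
  have inv: "\<rho> (inv\<^bsub>A\<^esub> eJ i) v = Ji i v" if "i < N" for i
    using that by (intro rep_inv_eq J_Units) (simp_all add: rep_J J_inv)
  have "\<rho> (elt_Z N \<eta> \<omega>1 \<omega>2) v = (\<Sum>i\<in>{0..<N}. \<rho> (eJ i \<oplus>\<^bsub>A\<^esub> inv\<^bsub>A\<^esub> eJ i) v)"
    unfolding elt_Z_def alg_A_eq
    by (rule rep_finsum) (use J_Units A.Units_closed in auto)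
  also have "\<dots> = (\<Sum>i\<in>{0..<N}. J i v + Ji i v)"
    using J_Units A.Units_closed by (intro sum.cong) (auto simp: rep_add rep_J inv)
  finally show ?thesis by (simp add: lessThan_atLeast0)
qed

lemma existence:
  "\<exists>b. factors_through_double_quotient N c s1 s2 b scale \<rho> \<and> double_quotient_relations_hold N c s1 s2 b \<rho>"
  using double_quotient_scalar[OF irreducible_E] relations_imp_factors relations_hold_iff by blast

section \<open>The value of \<open>b\<close> in terms of \<theta>\<close>

definition bval :: "complex \<Rightarrow> complex"
  where "bval \<theta> = (if even N
     then qnum \<eta> ((\<omega>1 + \<omega>2 + 1 + \<theta>) / 2) * qnum \<eta> ((\<omega>1 + \<omega>2 + 1 - \<theta>) / 2)
            / (qnum \<eta> (\<omega>1 + 1) * qnum \<eta> (\<omega>2 + 1))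
     else - (qnum \<eta> ((\<omega>1 - \<omega>2 + \<theta>) / 2) * qnum \<eta> ((\<omega>1 - \<omega>2 - \<theta>) / 2)
            / (qnum \<eta> (\<omega>1 + 1) * qnum \<eta> (\<omega>2 + 1))))"

lemma qnum_product:
  "(q - t) * (q - t) * (qnum \<eta> ((x + \<theta>) / 2) * qnum \<eta> ((x - \<theta>) / 2))
    = qpow \<eta> x + qpow \<eta> (- x) - qpow \<eta> \<theta> - qpow \<eta> (- \<theta>)"
proof -
  have m: "(q - t) * qnum \<eta> y = qpow \<eta> y - qpow \<eta> (- y)" for y
    using q_ne_t by (simp add: qnum_def)
  have "(q - t) * (q - t) * (qnum \<eta> ((x + \<theta>) / 2) * qnum \<eta> ((x - \<theta>) / 2))
    = ((q - t) * qnum \<eta> ((x + \<theta>) / 2)) * ((q - t) * qnum \<eta> ((x - \<theta>) / 2))" by simp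
  also have "\<dots> = qpow \<eta> x + qpow \<eta> (- x) - qpow \<eta> \<theta> - qpow \<eta> (- \<theta>)"
    unfolding m
    by (simp add: algebra_simps flip: qpow_add) (simp add: field_simps)
  finally show ?thesis .
qed

lemma k1_k2_bval:
  "zcoef + zsign * k1 * k2 * bval \<theta> = qpow \<eta> \<theta> + qpow \<eta> (- \<theta>)"
proof -
  have d: "q - t \<noteq> 0" using q_ne_t by simp
  let ?n1 = "qnum \<eta> (\<omega>1 + 1)" and ?n2 = "qnum \<eta> (\<omega>2 + 1)"
  have kk: "k1 * k2 * (x / (?n1 * ?n2)) = (q - t) * (q - t) * x" for x
    unfolding k_qnum using qnum_nonzero by simp
  have z: "zsign * k1 * k2 * bval \<theta> = zsign * (k1 * k2 * bval \<theta>)" by (simp only: mult.assoc)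
  show ?thesis
  proof (cases "even N")
    case True
    have "q * qpow \<eta> \<omega>1 * qpow \<eta> \<omega>2 = qpow \<eta> (\<omega>1 + \<omega>2 + 1)"
      "t * qpow \<eta> (- \<omega>1) * qpow \<eta> (- \<omega>2) = qpow \<eta> (- (\<omega>1 + \<omega>2 + 1))"
      by (simp_all add: algebra_simps flip: qpow_add)
    moreover have "k1 * k2 * bval \<theta> = qpow \<eta> (\<omega>1 + \<omega>2 + 1) + qpow \<eta> (- (\<omega>1 + \<omega>2 + 1)) - qpow \<eta> \<theta> - qpow \<eta> (- \<theta>)"
      unfolding bval_def if_P[OF True] kk qnum_product ..
    ultimately show ?thesis using True unfolding z by (simp only: zcoef_def zsign_def) simp
  next
    case False
    have "qpow \<eta> \<omega>1 * qpow \<eta> (- \<omega>2) = qpow \<eta> (\<omega>1 - \<omega>2)"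
      "qpow \<eta> \<omega>2 * qpow \<eta> (- \<omega>1) = qpow \<eta> (- (\<omega>1 - \<omega>2))"
      by (simp_all flip: qpow_add)
    moreover have "k1 * k2 * bval \<theta> = - (qpow \<eta> (\<omega>1 - \<omega>2) + qpow \<eta> (- (\<omega>1 - \<omega>2)) - qpow \<eta> \<theta> - qpow \<eta> (- \<theta>))"
      unfolding bval_def if_not_P[OF False] mult_minus_right kk qnum_product ..
    ultimately show ?thesis using False unfolding z by (simp only: zcoef_def zsign_def) simp
  qed
qed

lemma bval_relations:
  assumes "\<forall>v. \<rho> (elt_Z N \<eta> \<omega>1 \<omega>2) v = scale (qnum \<eta> (of_nat N) * (qpow \<eta> \<theta> + qpow \<eta> (- \<theta>))) v"
  shows "double_quotient_relations_hold N c s1 s2 (bval \<theta>) \<rho>"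
proof -
  obtain b where b: "\<And>p v. IJ p (Iop p v) = scale b (Iop p v)"
    using double_quotient_scalar[OF irreducible_E] by blast
  show ?thesis
  proof (cases "\<exists>p u. Iop p u \<noteq> 0")
    case True
    then obtain p u where u: "Iop p u \<noteq> 0" by blast
    have "(q - t) * (qnum \<eta> (of_nat N) * (qpow \<eta> \<theta> + qpow \<eta> (- \<theta>)))
      = (q ^ N - t ^ N) * (zcoef + zsign * k1 * k2 * b)"
      by (rule Z_scalar_corner[OF _ b u]) (use assms rep_Z in simp)
    moreover have "(q - t) * qnum \<eta> (of_nat N) = q ^ N - t ^ N"
      using q_ne_t by (simp add: qnum_def qpow_of_nat)
    ultimately have "(q ^ N - t ^ N) * (qpow \<eta> \<theta> + qpow \<eta> (- \<theta>))
      = (q ^ N - t ^ N) * (zcoef + zsign * k1 * k2 * b)"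
      by (metis mult.assoc)
    \<comment> \<open>Equality would give \<open>q ^ (2 * N) = 1\<close>.\<close>
    moreover have "q ^ N \<noteq> t ^ N"
    proof
      assume "q ^ N = t ^ N"
      then have "q ^ (N + N) = (q * t) ^ N" by (simp add: power_add power_mult_distrib)
      then show False using not_root[of "N + N"] qt1 N_ge by simp
    qed
    ultimately have "qpow \<eta> \<theta> + qpow \<eta> (- \<theta>) = zcoef + zsign * k1 * k2 * b" by simp
    then have "zsign * k1 * k2 * b = zsign * k1 * k2 * bval \<theta>"
      using k1_k2_bval[of \<theta>] by (metis add_left_cancel)
    moreover have "zsign * k1 * k2 \<noteq> 0"
      unfolding k_qnum using qnum_nonzero q_ne_t by (simp add: zsign_def)
    ultimately have "b = bval \<theta>" by (metis mult_cancel_left)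
    then show ?thesis using b by (simp add: relations_hold_iff)
  next
    \<comment> \<open>If both products act as zero, the relations hold for every value of
      \<open>b\<close>.\<close>
    case False
    then show ?thesis by (simp add: relations_hold_iff)
  qed
qed

end

theorem theorem4p1:
  fixes N :: nat and \<eta> \<omega>1 \<omega>2 :: complex
    and scale :: "complex \<Rightarrow> 'v::ab_group_add \<Rightarrow> 'v"
    and \<rho> :: "btl \<Rightarrow> 'v \<Rightarrow> 'v"
  assumes "N \<ge> 2"
    and "\<forall>n::nat. n \<ge> 1 \<longrightarrow> qpow \<eta> 1 ^ n \<noteq> 1"
    and "qnum \<eta> \<omega>1 \<noteq> 0" "qnum \<eta> (\<omega>1 + 1) \<noteq> 0" "qnum \<eta> \<omega>2 \<noteq> 0" "qnum \<eta> (\<omega>2 + 1) \<noteq> 0"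
    and "irreducible_representation scale (alg_A N \<eta> \<omega>1 \<omega>2) \<rho>"
  shows "(\<exists>b. factors_through_double_quotient N
                 (qnum \<eta> 2) (btl_param \<eta> \<omega>1) (btl_param \<eta> \<omega>2) b scale \<rho> \<and>
              double_quotient_relations_hold N
                 (qnum \<eta> 2) (btl_param \<eta> \<omega>1) (btl_param \<eta> \<omega>2) b \<rho>) \<and>
         (\<forall>\<theta>. (\<forall>v. \<rho> (elt_Z N \<eta> \<omega>1 \<omega>2) v
                     = scale (qnum \<eta> (of_nat N) * (qpow \<eta> \<theta> + qpow \<eta> (- \<theta>))) v) \<longrightarrow>
              double_quotient_relations_hold N
                (qnum \<eta> 2) (btl_param \<eta> \<omega>1) (btl_param \<eta> \<omega>2)
                (if even N
                 then qnum \<eta> ((\<omega>1 + \<omega>2 + 1 + \<theta>) / 2) * qnum \<eta> ((\<omega>1 + \<omega>2 + 1 - \<theta>) / 2)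
                        / (qnum \<eta> (\<omega>1 + 1) * qnum \<eta> (\<omega>2 + 1))
                 else - (qnum \<eta> ((\<omega>1 - \<omega>2 + \<theta>) / 2) * qnum \<eta> ((\<omega>1 - \<omega>2 - \<theta>) / 2)
                        / (qnum \<eta> (\<omega>1 + 1) * qnum \<eta> (\<omega>2 + 1)))) \<rho>)"
proof -
  interpret two_BTL_irreducible N \<eta> \<omega>1 \<omega>2 scale \<rho>
    using assms by (simp add: two_BTL_irreducible_def two_BTL_irreducible_axioms_def)
  show ?thesis using existence bval_relations unfolding bval_def by blast
qed

end
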